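(* Suppose $\gamma_l=\gamma_h$ (so $\gamma_n=\gamma_l=\gamma_h$), $\left|\frac{r-\gamma_n}{1+\gamma_n}\right|<1$, $r\ne\gamma_n$, and $\gamma_n>-1$. Let $((\mu_1^\bullet,\mu_2^\infty,\gamma_n),c^\infty)$ be the unique steady state. Provided $\underline\mu_1<\mu_1^\bullet<\bar\mu_1$ and $\underline\mu_2<\mu_2^\infty<\bar\mu_2$, almost surely $\lim_{t\to\infty}\tilde C_t=c^\infty$ and $(\tilde\mu_{1,t},\tilde\mu_{2,t})_{t\ge1}$ converges in $L^1$ to $(\mu_1^\bullet,\mu_2^\infty)$; that is, almost surely $\int\big(|\mu_1-\mu_1^\bullet|+|\mu_2-\mu_2^\infty|\big)\,d\tilde M_t(\mu_1,\mu_2)\to0$.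
   Context: Fix $\sigma>0$, $q\in[0,1)$, $\kappa\in\mathbb R$, true means $\mu_1^\bullet,\mu_2^\bullet\in\mathbb R$, a true reversal parameter $r\ne-1$, and the agents' dogmatic reversal parameter $\gamma_n=\gamma_l=\gamma_h$. $\phi(\cdot\mid\mu)$ is the density of $\mathcal N(\mu,\sigma^2)$. Stage game: observe $X_1=x_1$ and either stop, with payoff $u_1(x_1)=x_1$, or continue, in which case $X_2=x_2$ is drawn and the payoff is $u_2(x_1,x_2)=q\max(x_1,x_2)+(1-q)x_2-\kappa$. $\Psi(\mu_1,\mu_2;\gamma)$ is the joint law with $X_1\sim\mathcal N(\mu_1,\sigma^2)$, $X_2\mid(X_1=x_1)\sim\mathcal N(\mu_2-\gamma(x_1-\mu_1),\sigma^2)$; the true law is $\Psi(\mu_1^\bullet,\mu_2^\bullet;r)$. Steady state: numbers $\mu_1^\infty,\mu_2^\infty,c^\infty$ such that stopping iff $X_1\ge c^\infty$ is optimal among all stopping strategies under $\Psi(\mu_1^\infty,\mu_2^\infty;\gamma_n)$, and $(\mu_1^\infty,\mu_2^\infty)$ minimizes over $\mathbb R^2$ the Kullback–Leibler divergence from the true law of the history to the law of the history under $\Psi(\mu_1,\mu_2;\gamma_n)$, where the history is $X_1$ alone if $X_1\ge c^\infty$ and $(X_1,X_2)$ otherwise. Under the hypotheses on $r,\gamma_n$ the steady state exists, is unique, and has $\mu_1^\infty=\mu_1^\bullet$. Learning dynamics: let $(X_{1,t},X_{2,t})_{t\ge1}$ be i.i.d. draws from $\Psi(\mu_1^\bullet,\mu_2^\bullet;r)$.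 The prior $M_0$ has a continuously differentiable, strictly positive density $m_0$ on $[\underline\mu_1,\bar\mu_1]\times[\underline\mu_2,\bar\mu_2]$; put $\tilde M_0=M_0$. In round $t\ge1$, agent $t$ uses the cutoff $\tilde C_t$ that is optimal given belief $\tilde M_{t-1}$ (with no belief updating within the stage game): $\tilde C_t$ is the unique $x_1$ solving $u_1(x_1)=\int\mathbb E_{\Psi(\mu_1,\mu_2;\gamma_n)}[u_2(x_1,X_2)\mid X_1=x_1]\,d\tilde M_{t-1}(\mu_1,\mu_2)$; she continues if $X_{1,t}\le\tilde C_t$ and stops if $X_{1,t}>\tilde C_t$. Her history $\tilde H_t$ is $(X_{1,t},X_{2,t})$ if she continues and $(X_{1,t},\varnothing)$ if she stops. $\tilde M_t$ is the Bayesian update of $\tilde M_{t-1}$ with likelihood $\phi(x_1\mid\mu_1)$ for history $(x_1,\varnothing)$ and $\phi(x_1\mid\mu_1)\phi(x_2\mid\mu_2-\gamma_n(x_1-\mu_1))$ for history $(x_1,x_2)$. $(\tilde\mu_{1,t},\tilde\mu_{2,t})$ denotes a random element with law $\tilde M_t$. "Almost surely" is with respect to the realization of all draws $(X_{1,t},X_{2,t})_{t\ge1}$. *)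

theory Defs
  imports "HOL-Probability.Probability"
begin

definition u1 :: "real \<Rightarrow> real" where
  "u1 x1 = x1"

definition u2 :: "real \<Rightarrow> real \<Rightarrow> real \<Rightarrow> real \<Rightarrow> real" where
  "u2 q \<kappa> x1 x2 = q * max x1 x2 + (1 - q) * x2 - \<kappa>"

definition X2_law :: "real \<Rightarrow> real \<Rightarrow> real \<Rightarrow> real \<Rightarrow> real \<Rightarrow> real measure" where
  "X2_law \<sigma> \<gamma> \<mu>1 \<mu>2 x1 = density lborel (\<lambda>x2. ennreal (normal_density (\<mu>2 - \<gamma> * (x1 - \<mu>1)) \<sigma> x2))"

(* Joint density = density of X1 times the density of X2_law at x1, the conditional law of X2
   given X1 = x1. *)
definition Psi :: "real \<Rightarrow> real \<Rightarrow> real \<Rightarrow> real \<Rightarrow> (real \<times> real) measure" where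
  "Psi \<sigma> \<mu>1 \<mu>2 \<gamma> = density lborel (\<lambda>(x1, x2).
     ennreal (normal_density \<mu>1 \<sigma> x1 * normal_density (\<mu>2 - \<gamma> * (x1 - \<mu>1)) \<sigma> x2))"

(* A stopping strategy is a measurable predicate on the first draw; S x1 means "stop at x1". *)
definition payoff :: "real \<Rightarrow> real \<Rightarrow> (real \<Rightarrow> bool) \<Rightarrow> real \<times> real \<Rightarrow> real" where
  "payoff q \<kappa> S = (\<lambda>(x1, x2). if S x1 then u1 x1 else u2 q \<kappa> x1 x2)"

definition optimal_strategy :: "real \<Rightarrow> real \<Rightarrow> (real \<times> real) measure \<Rightarrow> (real \<Rightarrow> bool) \<Rightarrow> bool" where
  "optimal_strategy q \<kappa> M S \<longleftrightarrow> Measurable.pred borel S \<and>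
     (\<forall>S'. Measurable.pred borel S' \<longrightarrow>
        integral\<^sup>L M (payoff q \<kappa> S') \<le> integral\<^sup>L M (payoff q \<kappa> S))"

(* None stands for an unobserved second draw. *)
type_synonym history = "real \<times> real option"

definition history :: "(real \<Rightarrow> bool) \<Rightarrow> real \<times> real \<Rightarrow> history" where
  "history S = (\<lambda>(x1, x2). if S x1 then (x1, None) else (x1, Some x2))"

(* Second factor: the Borel sigma-algebra on the disjoint union of {None} and a copy of the line. *)
definition history_space :: "history measure" where
  "history_space = borel \<Otimes>\<^sub>M sigma UNIV {A. Some -` A \<in> sets borel}"

definition history_law :: "(real \<times> real) measure \<Rightarrow> (real \<Rightarrow> bool) \<Rightarrow> history measure" where
  "history_law M S = distr M history_space (history S)"

(* KL_divergence b M N is the divergence from N to M, so the true law is its last argument.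
   Being real-valued it would be 0 for a non-integrable log-likelihood ratio; for two laws Psi with
   the same \<sigma> > 0 the ratio is at most a quadratic polynomial in the draws, hence integrable. *)
definition history_KL :: "(real \<times> real) measure \<Rightarrow> (real \<times> real) measure \<Rightarrow> (real \<Rightarrow> bool) \<Rightarrow> real" where
  "history_KL T M S = KL_divergence (exp 1) (history_law M S) (history_law T S)"

definition steady_state ::
    "real \<Rightarrow> real \<Rightarrow> real \<Rightarrow> (real \<times> real) measure \<Rightarrow> real \<Rightarrow> real \<Rightarrow> real \<Rightarrow> real \<Rightarrow> bool" where
  "steady_state \<sigma> q \<kappa> T \<gamma> \<mu>1 \<mu>2 c \<longleftrightarrow>
     optimal_strategy q \<kappa> (Psi \<sigma> \<mu>1 \<mu>2 \<gamma>) (\<lambda>x1. c \<le> x1) \<and>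
     (\<forall>m1 m2. history_KL T (Psi \<sigma> \<mu>1 \<mu>2 \<gamma>) (\<lambda>x1. c \<le> x1)
            \<le> history_KL T (Psi \<sigma> m1 m2 \<gamma>) (\<lambda>x1. c \<le> x1))"

(* One-sided derivatives on the boundary of R; D is unique when R is a nondegenerate rectangle. *)
definition C1_on :: "(real \<times> real) set \<Rightarrow> (real \<times> real \<Rightarrow> real) \<Rightarrow> bool" where
  "C1_on R f \<longleftrightarrow> (\<exists>D :: real \<times> real \<Rightarrow> (real \<times> real) \<Rightarrow>\<^sub>L real.
     continuous_on R D \<and> (\<forall>p\<in>R. (f has_derivative blinfun_apply (D p)) (at p within R)))"

(* The inner integral is the conditional expectation of u2 given X1 = x1; M is not updated on x1. *)
definition opt_cutoff :: "real \<Rightarrow> real \<Rightarrow> real \<Rightarrow> real \<Rightarrow> (real \<times> real) measure \<Rightarrow> real" where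
  "opt_cutoff \<sigma> q \<kappa> \<gamma> M = (THE x1.
     u1 x1 = (\<integral>(\<mu>1, \<mu>2). (\<integral>x2. u2 q \<kappa> x1 x2 \<partial>X2_law \<sigma> \<gamma> \<mu>1 \<mu>2 x1) \<partial>M))"

definition likelihood :: "real \<Rightarrow> real \<Rightarrow> history \<Rightarrow> real \<times> real \<Rightarrow> real" where
  "likelihood \<sigma> \<gamma> h = (\<lambda>(\<mu>1, \<mu>2). case h of
       (x1, None) \<Rightarrow> normal_density \<mu>1 \<sigma> x1
     | (x1, Some x2) \<Rightarrow> normal_density \<mu>1 \<sigma> x1 * normal_density (\<mu>2 - \<gamma> * (x1 - \<mu>1)) \<sigma> x2)"

definition bayes_update ::
    "real \<Rightarrow> real \<Rightarrow> history \<Rightarrow> (real \<times> real) measure \<Rightarrow> (real \<times> real) measure" where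
  "bayes_update \<sigma> \<gamma> h M =
     density M (\<lambda>p. ennreal (likelihood \<sigma> \<gamma> h p / (\<integral>p'. likelihood \<sigma> \<gamma> h p' \<partial>M)))"

(* x t is the pair of potential draws of agent t, for t \<ge> 1; x 0 is never used.
   The agent stops exactly when her first draw is strictly above the cutoff. *)
primrec belief :: "real \<Rightarrow> real \<Rightarrow> real \<Rightarrow> real \<Rightarrow> (real \<times> real) measure \<Rightarrow>
    (nat \<Rightarrow> real \<times> real) \<Rightarrow> nat \<Rightarrow> (real \<times> real) measure" where
  "belief \<sigma> q \<kappa> \<gamma> M0 x 0 = M0"
| "belief \<sigma> q \<kappa> \<gamma> M0 x (Suc t) =
     bayes_update \<sigma> \<gamma>
       (history (\<lambda>x1. opt_cutoff \<sigma> q \<kappa> \<gamma> (belief \<sigma> q \<kappa> \<gamma> M0 x t) < x1) (x (Suc t)))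
       (belief \<sigma> q \<kappa> \<gamma> M0 x t)"

(* Meaningful for t \<ge> 1. *)
definition cutoff :: "real \<Rightarrow> real \<Rightarrow> real \<Rightarrow> real \<Rightarrow> (real \<times> real) measure \<Rightarrow>
    (nat \<Rightarrow> real \<times> real) \<Rightarrow> nat \<Rightarrow> real" where
  "cutoff \<sigma> q \<kappa> \<gamma> M0 x t = opt_cutoff \<sigma> q \<kappa> \<gamma> (belief \<sigma> q \<kappa> \<gamma> M0 x (t - 1))"

end

theory Submission
  imports Defs "HOL-Library.Discrete_Functions"
begin

text \<open>
  Write \<open>\<nu> = \<mu>2 + \<gamma> \<mu>1\<close> and \<open>u = \<nu> - \<nu>inf\<close>. The log-likelihood of the first \<open>t\<close> histories is
  quadratic in \<open>(\<mu>1, \<nu>)\<close>, and the posterior is controlled without locating its mode: comparing it with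
  its image under the contraction of the prior rectangle towards \<open>(\<mu>1b, \<mu>2inf)\<close> bounds an exponential
  moment of the gain in log-likelihood. Hence \<open>\<bar>u\<bar>\<close> exceeds a fixed multiple (arbitrarily close to 1) of
  \<open>\<bar>V - \<nu>inf\<bar>\<close> only negligibly, where \<open>V\<close> is the average of \<open>X2 + \<gamma> X1\<close> over the continuing agents.
  The cutoff lies within that distance of \<open>cinf\<close>, up to the factor \<open>1 + \<gamma>\<close>. By a strong law for
  orthogonal increments, \<open>V - \<nu>inf\<close> is asymptotically a weighted average of conditional means given
  \<open>X1 \<le> C\<close>; these vanish at \<open>cinf\<close>, by minimality of the divergence, and are Lipschitz in \<open>C\<close> with
  constant \<open>\<bar>r - \<gamma>\<bar>\<close>, because truncated Gaussian means are 1-Lipschitz. As \<open>\<bar>r - \<gamma>\<bar> < 1 + \<gamma>\<close>, the limit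
  superior of \<open>\<bar>V - \<nu>inf\<bar>\<close> is at most a factor below one times itself, so it is zero.
\<close>

section \<open>Weighted averages\<close>

text \<open>Two obstacles shape the proof. Which second draws are seen is decided by cutoffs that
  depend on all earlier draws, so the continuing agents form no i.i.d. sample. And the prior lives
  on a rectangle with a density known only to lie between two positive constants, so the posterior
  has no closed form and its mode may sit on the boundary. The contraction answers the second
  obstacle: a convex rectangle is mapped into itself, and the price, a Jacobian and the ratio of the
  two bounds, does not grow with \<open>t\<close>, while the log-likelihood does. Contracting by the
  fraction \<open>a\<close> costs a factor \<open>1 / (1 - a / 2)\<close> in the bound on the
  deviation; since the feedback factor \<open>\<bar>r - \<gamma>\<bar> / (1 + \<gamma>)\<close> is
  strictly below one, a small \<open>a\<close> is affordable. The coordinate \<nu> is forced: given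
  \<open>X1 = x\<close> the agents believe in the mean \<open>\<nu> - \<gamma> * x\<close> for
  \<open>X2\<close>, so second draws and cutoffs meet the belief through \<nu> alone. Probability
  enters only through the limits of three averages of the draws; the argument that closes the loop
  is deterministic along each path.\<close>

lemma weighted_sum_eventually_le:
  fixes w d :: "nat \<Rightarrow> real"
  assumes p: "0 < p" and w: "\<And>s. p \<le> w s" "\<And>s. w s \<le> 1"
    and d: "\<forall>\<^sub>F s in sequentially. d s \<le> m" and "0 < \<delta>"
  shows "\<forall>\<^sub>F t in sequentially. (\<Sum>s=1..t. w s * d s) \<le> (m + \<delta>) * (\<Sum>s=1..t. w s)"
proof -
  obtain n where n: "\<And>s. s \<ge> n \<Longrightarrow> d s \<le> m" using d unfolding eventually_sequentially by blast
  \<comment> \<open>\<open>K\<close> bounds what the terms with \<open>s \<le> n\<close> can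
    contribute above the level \<open>m\<close>. It does not depend on \<open>t\<close>, while the
    total weight grows at least like \<open>p * t\<close>.\<close>
  define K where "K = (\<Sum>s=1..n. w s * \<bar>d s - m\<bar>)"
  have *: "(\<Sum>s=1..t. w s * (d s - m)) \<le> K" for t
  proof -
    have "(\<Sum>s=1..t. w s * (d s - m)) \<le> (\<Sum>s=1..t. if s \<le> n then w s * \<bar>d s - m\<bar> else 0)"
    proof (intro sum_mono)
      fix s
      have "0 \<le> w s" using w(1)[of s] p by linarith
      then show "w s * (d s - m) \<le> (if s \<le> n then w s * \<bar>d s - m\<bar> else 0)"
        using n[of s] by (auto intro!: mult_left_mono mult_nonneg_nonpos)
    qed
    also have "\<dots> = (\<Sum>s\<in>{1..t} \<inter> {s. s \<le> n}. w s * \<bar>d s - m\<bar>)"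
      by (simp add: sum.inter_restrict)
    also have "\<dots> \<le> K" unfolding K_def
    proof (rule sum_mono2)
      show "0 \<le> w s * \<bar>d s - m\<bar>" for s
        using w(1)[of s] p by simp
    qed auto
    finally show ?thesis .
  qed
  have "\<forall>\<^sub>F t in sequentially. K / (\<delta> * p) \<le> real t"
    using filterlim_real_sequentially unfolding filterlim_at_top by blast
  then show ?thesis
  proof eventually_elim
    case (elim t)
    have "K \<le> \<delta> * (real t * p)" using elim p \<open>0 < \<delta>\<close> by (simp add: field_simps)
    also have "real t * p = (\<Sum>s=1..t. p)" by simp
    also have "\<delta> * (\<Sum>s=1..t. p) \<le> \<delta> * (\<Sum>s=1..t. w s)"
      using \<open>0 < \<delta>\<close> w(1) by (intro mult_left_mono sum_mono) auto
    finally have "(\<Sum>s=1..t. w s * (d s - m)) \<le> \<delta> * (\<Sum>s=1..t. w s)"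
      using *[of t] by linarith
    moreover have "(\<Sum>s=1..t. w s * (d s - m)) = (\<Sum>s=1..t. w s * d s) - m * (\<Sum>s=1..t. w s)"
      by (simp add: sum_distrib_left sum_subtractf algebra_simps)
    ultimately show ?case by (simp add: algebra_simps)
  qed
qed

text \<open>The feedback loop in abstract form: an eventual bound on \<open>d\<close> passes to
  \<open>a\<close> up to a small error (\<open>step\<close>), and an eventual bound on
  \<open>a\<close> returns to \<open>d\<close> multiplied by \<open>k < 1\<close>
  (\<open>drop\<close>). The infimum of the eventual bounds on \<open>a\<close> can then only be
  zero. Later \<open>w s\<close> is the probability of continuing in round \<open>s\<close>,
  \<open>d s\<close> a multiple of the distance of its cutoff from the limit, \<open>N\<close> the
  number of continuations and \<open>e\<close> the posterior error.\<close>

lemma weighted_average_contraction: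
  fixes w d a e N B eB :: "nat \<Rightarrow> real"
  assumes p: "0 < p" and w: "\<And>s. p \<le> w s" "\<And>s. w s \<le> 1"
    and k: "0 \<le> k" "k < 1"
    and d_bdd: "\<And>s. d s \<le> U"
    and d: "\<And>s. 1 \<le> s \<Longrightarrow> d s \<le> k * a (s - 1) + e s" and e: "e \<longlonglongrightarrow> 0"
    and N: "(\<lambda>t. (N t - (\<Sum>s=1..t. w s)) / t) \<longlonglongrightarrow> 0"
    and B: "(\<lambda>t. eB t / t) \<longlonglongrightarrow> 0" "\<And>t. B t \<le> (\<Sum>s=1..t. w s * d s) + eB t"
    and a: "\<And>t. 1 \<le> t \<Longrightarrow> a t * N t \<le> B t" "\<And>t. 0 \<le> a t"
  shows "a \<longlonglongrightarrow> 0"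
proof -
  have W: "real t * p \<le> (\<Sum>s=1..t. w s)" for t
    using sum_mono[of "{1..t}" "\<lambda>_. p" w] w(1) by simp
  have step: "\<forall>\<^sub>F t in sequentially. a t \<le> m + \<delta>"
    if "0 \<le> m" "0 < \<delta>" and dm: "\<forall>\<^sub>F s in sequentially. d s \<le> m" for m \<delta>
  proof -
    \<comment> \<open>The inequality \<open>\<eta>'\<close> amounts to
      \<open>\<eta> * (m + \<delta> + 2) \<le> \<delta>\<close>; this choice meets it with a factor
      two to spare.\<close>
    define \<eta> where "\<eta> = \<delta> / (m + \<delta> + 2) / 2"
    have \<eta>: "0 < \<eta>" "\<eta> < 1" using that(1,2) by (auto simp: \<eta>_def field_simps)
    have \<eta>': "m + 2 * \<eta> \<le> (m + \<delta>) * (1 - \<eta>)"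
      using that(1,2) by (simp add: \<eta>_def field_simps)
    have 1: "\<forall>\<^sub>F t in sequentially. (\<Sum>s=1..t. w s * d s) \<le> (m + \<eta>) * (\<Sum>s=1..t. w s)"
      by (rule weighted_sum_eventually_le[OF p w dm \<eta>(1)])
    have 2: "\<forall>\<^sub>F t in sequentially. \<bar>(N t - (\<Sum>s=1..t. w s)) / t\<bar> < \<eta> * p"
      using N \<eta> p by (auto simp: tendsto_iff dist_real_def elim!: allE[of _ "\<eta> * p"])
    have 3: "\<forall>\<^sub>F t in sequentially. \<bar>eB t / t\<bar> < \<eta> * p"
      using B(1) \<eta> p by (auto simp: tendsto_iff dist_real_def elim!: allE[of _ "\<eta> * p"])
    show ?thesis using 1 2 3 eventually_ge_at_top[of 1]
    proof eventually_elim
      case (elim t)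
      define S where "S = (\<Sum>s=1..t. w s)"
      have t: "0 < real t" using elim(4) by simp
      have "0 < real t * p" using t p by simp
      then have S: "0 < S" using W[of t] unfolding S_def by linarith
      have pS: "\<eta> * p * t \<le> \<eta> * S" using W[of t] \<eta> unfolding S_def by (simp add: mult.assoc mult.commute mult_left_mono)
      have "\<bar>N t - S\<bar> < \<eta> * p * t" using elim(2) t by (simp add: S_def abs_divide field_simps)
      then have Nt: "(1 - \<eta>) * S \<le> N t" using pS by (simp add: algebra_simps)
      have "\<bar>eB t\<bar> < \<eta> * p * t" using elim(3) t by (simp add: abs_divide field_simps)
      then have "B t \<le> (m + 2 * \<eta>) * S"
        using B(2)[of t] elim(1)[folded S_def] pS distrib_right[of "m + \<eta>" \<eta> S] by (simp add: add.assoc)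
      also have "\<dots> \<le> (m + \<delta>) * (1 - \<eta>) * S" using \<eta>' S by (intro mult_right_mono) auto
      also have "\<dots> \<le> (m + \<delta>) * N t"
        using mult_left_mono[OF Nt, of "m + \<delta>"] that(1,2) by (simp add: mult.assoc)
      finally have "a t * N t \<le> (m + \<delta>) * N t" using a(1)[of t] elim(4) by linarith
      moreover have "0 < (1 - \<eta>) * S" using \<eta>(2) S by simp
      then have "0 < N t" using Nt by linarith
      ultimately show ?case by simp
    qed
  qed
  have drop: "\<forall>\<^sub>F s in sequentially. d s \<le> k * m + \<delta>"
    if "0 < \<delta>" and am: "\<forall>\<^sub>F t in sequentially. a t \<le> m" for m \<delta>
  proof -
    have 1: "\<forall>\<^sub>F s in sequentially. a (s - 1) \<le> m"
      using am by (rule eventually_compose_filterlim[OF _ filterlim_minus_const_nat_at_top])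
    have 2: "\<forall>\<^sub>F s in sequentially. e s < \<delta>"
      using order_tendstoD(2)[OF e \<open>0 < \<delta>\<close>] .
    show ?thesis using 1 2 eventually_ge_at_top[of 1]
    proof eventually_elim
      case (elim s)
      show ?case using d[OF elim(3)] mult_left_mono[OF elim(1) k(1)] elim(2) by linarith
    qed
  qed
  define L where "L = {m. 0 \<le> m \<and> (\<forall>\<^sub>F t in sequentially. a t \<le> m)}"
  \<comment> \<open>The a priori bound \<open>U\<close> starts the loop by providing one finite
    eventual bound.\<close>
  have "\<bar>U\<bar> + 1 \<in> L"
  proof -
    have "\<forall>\<^sub>F s in sequentially. d s \<le> \<bar>U\<bar>"
      by (intro always_eventually allI order_trans[OF d_bdd abs_ge_self])
    from step[OF _ _ this, of 1] show ?thesis by (simp add: L_def)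
  qed
  then have ne: "L \<noteq> {}" by blast
  have bdd: "bdd_below L" by (auto simp: L_def intro: bdd_belowI[of _ 0])
  define l where "l = Inf L"
  have l0: "0 \<le> l" unfolding l_def using ne by (intro cInf_greatest) (auto simp: L_def)
  have "l = 0"
  proof (rule ccontr)
    assume "l \<noteq> 0"
    then have l: "0 < l" using l0 by simp
    \<comment> \<open>One round trip from \<open>m < l + \<delta>\<close> ends below
      \<open>k * l + 3 * \<delta>\<close>, which is less than \<open>l\<close> because
      \<open>4 * \<delta> = (1 - k) * l\<close>.\<close>
    define \<delta> where "\<delta> = (1 - k) * l / 4"
    have \<delta>: "0 < \<delta>" using l k by (simp add: \<delta>_def)
    have "Inf L < l + \<delta>" using \<delta> by (simp add: l_def)
    then obtain m where m: "m \<in> L" "m < l + \<delta>" using cInf_lessD[OF ne] by blast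
    then have m': "0 \<le> m" "\<forall>\<^sub>F t in sequentially. a t \<le> m" by (auto simp: L_def)
    have "\<forall>\<^sub>F t in sequentially. a t \<le> (k * m + \<delta>) + \<delta>"
      by (rule step[OF _ \<delta> drop[OF \<delta> m'(2)]]) (use m' k \<delta> in auto)
    then have "k * m + \<delta> + \<delta> \<in> L" using m' k \<delta> by (simp add: L_def)
    then have "l \<le> k * m + \<delta> + \<delta>" unfolding l_def by (intro cInf_lower bdd)
    also have "k * m \<le> k * (l + \<delta>)" using m(2) k by (intro mult_left_mono) auto
    also have "k * (l + \<delta>) \<le> k * l + \<delta>" using k \<delta> by (simp add: algebra_simps mult_left_le)
    finally show False using l k by (simp add: \<delta>_def field_simps)
  qed
  show ?thesis
  proof (rule order_tendstoI)
    fix c :: real assume "c < 0"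
    then show "\<forall>\<^sub>F t in sequentially. c < a t" using a(2) by (auto intro: always_eventually less_le_trans)
  next
    fix c :: real assume "0 < c"
    then have "Inf L < c" using \<open>l = 0\<close> by (simp add: l_def)
    then obtain m where "m \<in> L" "m < c" using cInf_lessD[OF ne] by blast
    then show "\<forall>\<^sub>F t in sequentially. a t < c"
      by (auto simp: L_def elim: eventually_mono)
  qed
qed

section \<open>A strong law for adapted cutoffs\<close>

text \<open>By Tonelli the series of the \<open>Z k\<close> has finite expectation, so it converges
  almost surely and its terms vanish.\<close>

lemma (in prob_space) AE_tendsto_0_of_summable_expectation:
  fixes Z :: "nat \<Rightarrow> 'a \<Rightarrow> real"
  assumes Z: "\<And>k. integrable M (Z k)" "\<And>k \<omega>. 0 \<le> Z k \<omega>"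
    and c: "\<And>k. expectation (Z k) \<le> c k" "summable c"
  shows "AE \<omega> in M. (\<lambda>k. Z k \<omega>) \<longlonglongrightarrow> 0"
proof -
  have [measurable]: "Z k \<in> borel_measurable M" for k using Z(1) by auto
  have c0: "0 \<le> c k" for k
    using Z(2) by (intro order_trans[OF _ c(1)[of k]]) simp
  have "(\<integral>\<^sup>+\<omega>. (\<Sum>k. ennreal (Z k \<omega>)) \<partial>M) = (\<Sum>k. \<integral>\<^sup>+\<omega>. ennreal (Z k \<omega>) \<partial>M)"
    by (intro nn_integral_suminf) simp
  also have "\<dots> = (\<Sum>k. ennreal (expectation (Z k)))"
    using Z by (simp add: nn_integral_eq_integral)
  also have "\<dots> \<le> (\<Sum>k. ennreal (c k))"
    using c(1) by (intro suminf_le) (auto intro: ennreal_leI)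
  also have "\<dots> < \<infinity>" using c c0 by (simp add: suminf_ennreal2 less_top[symmetric])
  finally have "AE \<omega> in M. (\<Sum>k. ennreal (Z k \<omega>)) \<noteq> \<infinity>"
    by (intro nn_integral_noteq_infinite) auto
  then show ?thesis
  proof eventually_elim
    case (elim \<omega>)
    then have "summable (\<lambda>k. Z k \<omega>)" using Z(2) by (intro summable_suminf_not_top) auto
    then show ?case by (rule summable_LIMSEQ_zero)
  qed
qed

text \<open>Between two consecutive squares the partial sum moves by at most the sum of absolute
  values over the block, so control at the squares and of the blocks is enough. Both assumptions are
  squared because they will come from second moments.\<close>

lemma average_tendsto_0_of_squares:
  fixes y :: "nat \<Rightarrow> real"
  assumes sq: "(\<lambda>k. ((\<Sum>s=1..(Suc k)\<^sup>2. y s) / (Suc k)\<^sup>2)\<^sup>2) \<longlonglongrightarrow> 0"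
    and blk: "(\<lambda>k. ((\<Sum>s\<in>{(Suc k)\<^sup>2<..(Suc (Suc k))\<^sup>2}. \<bar>y s\<bar>) / (Suc k)\<^sup>2)\<^sup>2) \<longlonglongrightarrow> 0"
  shows "(\<lambda>t. (\<Sum>s=1..t. y s) / t) \<longlonglongrightarrow> 0"
proof -
  define A where "A k = \<bar>(\<Sum>s=1..(Suc k)\<^sup>2. y s) / (Suc k)\<^sup>2\<bar>" for k
  define R where "R k = (\<Sum>s\<in>{(Suc k)\<^sup>2<..(Suc (Suc k))\<^sup>2}. \<bar>y s\<bar>) / (Suc k)\<^sup>2" for k
  have A0: "0 \<le> A k" for k by (simp add: A_def)
  have R0: "0 \<le> R k" for k unfolding R_def by (intro divide_nonneg_nonneg sum_nonneg) auto
  have "(\<lambda>k. sqrt ((A k)\<^sup>2)) \<longlonglongrightarrow> sqrt 0"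
    using sq unfolding A_def power2_abs by (intro tendsto_real_sqrt)
  moreover have "(\<lambda>k. sqrt ((R k)\<^sup>2)) \<longlonglongrightarrow> sqrt 0"
    using blk unfolding R_def by (intro tendsto_real_sqrt)
  ultimately have lim: "(\<lambda>k. A k + R k) \<longlonglongrightarrow> 0"
    using tendsto_add[of "\<lambda>k. sqrt ((A k)\<^sup>2)" "sqrt 0" sequentially "\<lambda>k. sqrt ((R k)\<^sup>2)" "sqrt 0"] R0 A0
    by (simp only: real_sqrt_abs abs_of_nonneg real_sqrt_zero add_0)
  \<comment> \<open>The largest square up to \<open>t\<close> is \<open>(Suc k)\<^sup>2\<close> with
    \<open>k = floor_sqrt t - 1\<close>; counting from \<open>Suc k\<close> keeps the denominators
    positive.\<close>
  have "filterlim (\<lambda>t. floor_sqrt t - 1) sequentially sequentially"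
    unfolding filterlim_at_top
  proof
    fix n show "\<forall>\<^sub>F t in sequentially. n \<le> floor_sqrt t - 1"
      using eventually_ge_at_top[of "(n + 1)\<^sup>2"]
    proof eventually_elim
      case (elim t)
      then have "n + 1 \<le> floor_sqrt t" by (rule le_floor_sqrtI)
      then show ?case by simp
    qed
  qed
  from filterlim_compose[OF lim this]
  have lim': "(\<lambda>t. A (floor_sqrt t - 1) + R (floor_sqrt t - 1)) \<longlonglongrightarrow> 0" .
  have "\<forall>\<^sub>F t in sequentially. norm ((\<Sum>s=1..t. y s) / t) \<le> A (floor_sqrt t - 1) + R (floor_sqrt t - 1)"
    using eventually_ge_at_top[of 1]
  proof eventually_elim
    case (elim t)
    have "1 \<le> floor_sqrt t" using le_floor_sqrtI[of 1 t] elim by simp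
    then obtain k where k: "floor_sqrt t = Suc k" by (cases "floor_sqrt t") auto
    have k1: "(Suc k)\<^sup>2 \<le> t" unfolding k[symmetric] by (rule floor_sqrt_power2_le)
    have k2: "t < (Suc (Suc k))\<^sup>2" unfolding k[symmetric] by (rule Suc_floor_sqrt_power2_gt)
    have pos: "0 < real ((Suc k)\<^sup>2)" by simp
    have "(\<Sum>s=1..t. y s) = (\<Sum>s=1..(Suc k)\<^sup>2. y s) + (\<Sum>s\<in>{(Suc k)\<^sup>2<..t}. y s)"
    proof -
      have "{1..t} = {1..(Suc k)\<^sup>2} \<union> {(Suc k)\<^sup>2<..t}" using k1 by auto
      then show ?thesis by (simp only:) (subst sum.union_disjoint, auto)
    qed
    then have "\<bar>\<Sum>s=1..t. y s\<bar> \<le> \<bar>\<Sum>s=1..(Suc k)\<^sup>2. y s\<bar> + \<bar>\<Sum>s\<in>{(Suc k)\<^sup>2<..t}. y s\<bar>" by simp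
    also have "\<bar>\<Sum>s\<in>{(Suc k)\<^sup>2<..t}. y s\<bar> \<le> (\<Sum>s\<in>{(Suc k)\<^sup>2<..t}. \<bar>y s\<bar>)" by (rule sum_abs)
    also have "\<dots> \<le> (\<Sum>s\<in>{(Suc k)\<^sup>2<..(Suc (Suc k))\<^sup>2}. \<bar>y s\<bar>)"
      using k2 by (intro sum_mono2) auto
    finally have num: "\<bar>\<Sum>s=1..t. y s\<bar> \<le> \<bar>\<Sum>s=1..(Suc k)\<^sup>2. y s\<bar> + (\<Sum>s\<in>{(Suc k)\<^sup>2<..(Suc (Suc k))\<^sup>2}. \<bar>y s\<bar>)"
      by simp
    have "\<bar>\<Sum>s=1..t. y s\<bar> / t \<le> \<bar>\<Sum>s=1..t. y s\<bar> / real ((Suc k)\<^sup>2)"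
    proof (rule divide_left_mono)
      show "real ((Suc k)\<^sup>2) \<le> real t" using k1 by (simp only: of_nat_le_iff)
      then show "0 < real t * real ((Suc k)\<^sup>2)" using pos by (intro mult_pos_pos) linarith+
    qed simp
    also have "\<dots> \<le> A k + R k"
      using divide_right_mono[OF num, of "real ((Suc k)\<^sup>2)"]
      by (simp add: A_def R_def abs_divide add_divide_distrib del: of_nat_power of_nat_Suc)
    finally show ?case by (simp add: k)
  qed
  from Lim_null_comparison[OF this lim'] show ?thesis .
qed

text \<open>Orthogonality gives the sum of \<open>n\<close> terms a second moment of at most
  \<open>n * K\<close>. At \<open>n = (Suc k)\<^sup>2\<close> the averages then have second moments
  at most \<open>K / (Suc k)\<^sup>2\<close>, which are summable; the blocks between squares are
  short enough for Cauchy-Schwarz to give the same order.\<close>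

lemma (in prob_space) orthogonal_strong_law:
  fixes Y :: "nat \<Rightarrow> 'a \<Rightarrow> real"
  assumes Y[measurable]: "\<And>s. 1 \<le> s \<Longrightarrow> random_variable borel (Y s)"
    and sq: "\<And>s. 1 \<le> s \<Longrightarrow> integrable M (\<lambda>\<omega>. (Y s \<omega>)\<^sup>2)"
    and K: "\<And>s. 1 \<le> s \<Longrightarrow> expectation (\<lambda>\<omega>. (Y s \<omega>)\<^sup>2) \<le> K"
    and orth: "\<And>s t. 1 \<le> s \<Longrightarrow> s < t \<Longrightarrow> expectation (\<lambda>\<omega>. Y s \<omega> * Y t \<omega>) = 0"
  shows "AE \<omega> in M. (\<lambda>t. (\<Sum>s=1..t. Y s \<omega>) / t) \<longlonglongrightarrow> 0"
proof -
  have prod: "integrable M (\<lambda>\<omega>. Y s \<omega> * Y t \<omega>)" if "1 \<le> s" "1 \<le> t" for s t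
  proof (rule Bochner_Integration.integrable_bound)
    show "integrable M (\<lambda>\<omega>. (Y s \<omega>)\<^sup>2 + (Y t \<omega>)\<^sup>2)" using sq that by simp
    show "AE \<omega> in M. norm (Y s \<omega> * Y t \<omega>) \<le> norm ((Y s \<omega>)\<^sup>2 + (Y t \<omega>)\<^sup>2)"
    proof (rule AE_I2)
      fix \<omega>
      have "0 \<le> (\<bar>Y s \<omega>\<bar> - \<bar>Y t \<omega>\<bar>)\<^sup>2" "0 \<le> (Y s \<omega>)\<^sup>2" "0 \<le> (Y t \<omega>)\<^sup>2" by simp_all
      then show "norm (Y s \<omega> * Y t \<omega>) \<le> norm ((Y s \<omega>)\<^sup>2 + (Y t \<omega>)\<^sup>2)"
        unfolding power2_diff power2_abs real_norm_def abs_mult by linarith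
    qed
  qed (use that in measurable)
  have K0: "0 \<le> K" by (rule order_trans[OF _ K[of 1]]) simp_all
  have partial: "integrable M (\<lambda>\<omega>. (\<Sum>s=1..n. Y s \<omega>)\<^sup>2) \<and> expectation (\<lambda>\<omega>. (\<Sum>s=1..n. Y s \<omega>)\<^sup>2) \<le> n * K" for n
  proof (induction n)
    case (Suc n)
    have eq: "(\<Sum>s=1..Suc n. Y s \<omega>)\<^sup>2 = (\<Sum>s=1..n. Y s \<omega>)\<^sup>2 + 2 * (\<Sum>s=1..n. Y s \<omega> * Y (Suc n) \<omega>) + (Y (Suc n) \<omega>)\<^sup>2" for \<omega>
      by (simp add: power2_sum sum_distrib_right[symmetric])
    have c: "integrable M (\<lambda>\<omega>. \<Sum>s=1..n. Y s \<omega> * Y (Suc n) \<omega>)"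
      by (intro Bochner_Integration.integrable_sum prod) auto
    have "expectation (\<lambda>\<omega>. \<Sum>s=1..n. Y s \<omega> * Y (Suc n) \<omega>) = (\<Sum>s=1..n. expectation (\<lambda>\<omega>. Y s \<omega> * Y (Suc n) \<omega>))"
      by (intro Bochner_Integration.integral_sum prod) auto
    also have "\<dots> = 0" by (intro sum.neutral) (auto intro!: orth)
    finally have "expectation (\<lambda>\<omega>. \<Sum>s=1..n. Y s \<omega> * Y (Suc n) \<omega>) = 0" .
    then show ?case unfolding eq using Suc c sq[of "Suc n"] K[of "Suc n"] by (simp add: algebra_simps)
  qed simp
  have abs_block: "integrable M (\<lambda>\<omega>. (\<Sum>s\<in>I. \<bar>Y s \<omega>\<bar>)\<^sup>2) \<and>
      expectation (\<lambda>\<omega>. (\<Sum>s\<in>I. \<bar>Y s \<omega>\<bar>)\<^sup>2) \<le> (real (card I))\<^sup>2 * K" if I: "finite I" "\<And>s. s \<in> I \<Longrightarrow> 1 \<le> s" for I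
  proof -
    have [measurable]: "Y s \<in> borel_measurable M" if "s \<in> I" for s using I that by simp
    have b: "(\<Sum>s\<in>I. \<bar>Y s \<omega>\<bar>)\<^sup>2 \<le> (\<Sum>s\<in>I. (Y s \<omega>)\<^sup>2) * card I" for \<omega>
      using sum_squared_le_sum_of_squares[of "\<lambda>s. \<bar>Y s \<omega>\<bar>" I] I by simp
    have i: "integrable M (\<lambda>\<omega>. (\<Sum>s\<in>I. (Y s \<omega>)\<^sup>2) * card I)"
      by (intro Bochner_Integration.integrable_sum integrable_mult_left sq I)
    have i': "integrable M (\<lambda>\<omega>. (\<Sum>s\<in>I. \<bar>Y s \<omega>\<bar>)\<^sup>2)"
      by (rule Bochner_Integration.integrable_bound[OF i])
         (measurable, intro AE_I2, use b in \<open>simp add: sum_nonneg\<close>)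
    have "expectation (\<lambda>\<omega>. (\<Sum>s\<in>I. \<bar>Y s \<omega>\<bar>)\<^sup>2) \<le> expectation (\<lambda>\<omega>. (\<Sum>s\<in>I. (Y s \<omega>)\<^sup>2) * card I)"
      using i' i b by (intro integral_mono) auto
    also have "\<dots> = (\<Sum>s\<in>I. expectation (\<lambda>\<omega>. (Y s \<omega>)\<^sup>2)) * card I"
      using sq I by simp
    also have "\<dots> \<le> (\<Sum>s\<in>I. K) * card I"
      using K I by (intro mult_right_mono sum_mono) auto
    finally show ?thesis using i' by (simp add: power2_eq_square mult_ac)
  qed
  have sum1: "summable (\<lambda>k. C / (real (Suc k))\<^sup>2)" for C
  proof -
    have "summable (\<lambda>k. inverse (real (Suc k) ^ 2))"
      using inverse_power_summable[of 2, where ?'a = real] by (subst summable_Suc_iff) simp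
    then show ?thesis by (simp add: divide_inverse summable_mult)
  qed
  have "AE \<omega> in M. (\<lambda>k. ((\<Sum>s=1..(Suc k)\<^sup>2. Y s \<omega>) / (Suc k)\<^sup>2)\<^sup>2) \<longlonglongrightarrow> 0"
  proof (rule AE_tendsto_0_of_summable_expectation)
    show "integrable M (\<lambda>\<omega>. ((\<Sum>s=1..(Suc k)\<^sup>2. Y s \<omega>) / (Suc k)\<^sup>2)\<^sup>2)" for k
      using partial[of "(Suc k)\<^sup>2"] by (simp add: power_divide del: of_nat_power of_nat_Suc)
    show "expectation (\<lambda>\<omega>. ((\<Sum>s=1..(Suc k)\<^sup>2. Y s \<omega>) / (Suc k)\<^sup>2)\<^sup>2) \<le> K / (real (Suc k))\<^sup>2" for k
    proof -
      have "expectation (\<lambda>\<omega>. ((\<Sum>s=1..(Suc k)\<^sup>2. Y s \<omega>) / (Suc k)\<^sup>2)\<^sup>2)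
        \<le> real ((Suc k)\<^sup>2) * K / (real ((Suc k)\<^sup>2))\<^sup>2"
        using partial[of "(Suc k)\<^sup>2"] by (simp add: power_divide divide_right_mono del: of_nat_power of_nat_Suc)
      also have "\<dots> = K / (real (Suc k))\<^sup>2" by (simp add: power2_eq_square del: of_nat_Suc mult_Suc mult_Suc_right)
      finally show ?thesis .
    qed
  qed (simp_all add: sum1 del: of_nat_Suc)
  moreover have "AE \<omega> in M. (\<lambda>k. ((\<Sum>s\<in>{(Suc k)\<^sup>2<..(Suc (Suc k))\<^sup>2}. \<bar>Y s \<omega>\<bar>) / (Suc k)\<^sup>2)\<^sup>2) \<longlonglongrightarrow> 0"
  proof (rule AE_tendsto_0_of_summable_expectation)
    note ab = abs_block[of "{(Suc k)\<^sup>2<..(Suc (Suc k))\<^sup>2}" for k, simplified]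
    show "integrable M (\<lambda>\<omega>. ((\<Sum>s\<in>{(Suc k)\<^sup>2<..(Suc (Suc k))\<^sup>2}. \<bar>Y s \<omega>\<bar>) / (Suc k)\<^sup>2)\<^sup>2)" for k
      using ab[of k] by (simp add: power_divide del: of_nat_power of_nat_Suc)
    show "expectation (\<lambda>\<omega>. ((\<Sum>s\<in>{(Suc k)\<^sup>2<..(Suc (Suc k))\<^sup>2}. \<bar>Y s \<omega>\<bar>) / (Suc k)\<^sup>2)\<^sup>2) \<le> 9 * K / (real (Suc k))\<^sup>2" for k
    proof -
      define m where "m = real (Suc k)"
      have m: "1 \<le> m" by (simp add: m_def)
      \<comment> \<open>The block has \<open>2 * k + 3\<close> elements.\<close>
      have card: "real (card {(Suc k)\<^sup>2<..(Suc (Suc k))\<^sup>2}) \<le> 3 * m"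
        by (simp add: m_def power2_eq_square)
      have "expectation (\<lambda>\<omega>. ((\<Sum>s\<in>{(Suc k)\<^sup>2<..(Suc (Suc k))\<^sup>2}. \<bar>Y s \<omega>\<bar>) / (Suc k)\<^sup>2)\<^sup>2)
        = expectation (\<lambda>\<omega>. (\<Sum>s\<in>{(Suc k)\<^sup>2<..(Suc (Suc k))\<^sup>2}. \<bar>Y s \<omega>\<bar>)\<^sup>2) / (m\<^sup>2)\<^sup>2"
        by (simp add: power_divide m_def)
      also have "\<dots> \<le> (real (card {(Suc k)\<^sup>2<..(Suc (Suc k))\<^sup>2}))\<^sup>2 * K / (m\<^sup>2)\<^sup>2"
        by (intro divide_right_mono conjunct2[OF abs_block]) auto
      also have "\<dots> \<le> (3 * m)\<^sup>2 * K / (m\<^sup>2)\<^sup>2"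
        using card K0 by (intro divide_right_mono mult_right_mono power_mono) auto
      also have "\<dots> = 9 * K / m\<^sup>2" using m by (simp add: power2_eq_square field_simps)
      finally show ?thesis by (simp add: m_def)
    qed
  qed (simp_all add: sum1 del: of_nat_Suc)
  ultimately show ?thesis
    by eventually_elim (rule average_tendsto_0_of_squares)
qed

text \<open>The cutoff of round \<open>t\<close> is a function of the draws before \<open>t\<close>.
  Given these, it is a constant, and the term of round \<open>t\<close> has mean zero by
  \<open>mean\<close>; hence terms of different rounds are orthogonal although they are not
  independent.\<close>

lemma (in prob_space) adapted_strong_law:
  fixes X :: "nat \<Rightarrow> 'a \<Rightarrow> 'b" and C :: "(nat \<Rightarrow> 'b) \<Rightarrow> nat \<Rightarrow> real"
    and \<psi> :: "real \<Rightarrow> 'b \<Rightarrow> real" and b :: "'b \<Rightarrow> real"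
  assumes X: "indep_vars (\<lambda>_. N) X {1..}" and T: "\<And>t. 1 \<le> t \<Longrightarrow> distr M N (X t) = T"
    and C_cong: "\<And>t x x'. (\<And>s. 1 \<le> s \<Longrightarrow> s < t \<Longrightarrow> x s = x' s) \<Longrightarrow> C x t = C x' t"
    and C_meas: "\<And>t. 1 \<le> t \<Longrightarrow> (\<lambda>x. C x t) \<in> borel_measurable (PiM {1..<t} (\<lambda>_. N))"
    and \<psi>[measurable]: "(\<lambda>(c, y). \<psi> c y) \<in> borel_measurable (borel \<Otimes>\<^sub>M N)"
    and bound: "\<And>c y. \<bar>\<psi> c y\<bar> \<le> b y" and b: "b \<in> borel_measurable N" "integrable T (\<lambda>y. (b y)\<^sup>2)"
    and mean: "\<And>c. (\<integral>y. \<psi> c y \<partial>T) = 0"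
  shows "AE \<omega> in M. (\<lambda>t. (\<Sum>s=1..t. \<psi> (C (\<lambda>s. X s \<omega>) s) (X s \<omega>)) / t) \<longlonglongrightarrow> 0"
proof (rule orthogonal_strong_law[where K = "\<integral>y. (b y)\<^sup>2 \<partial>T"])
  note [measurable] = b(1)
  have Xm[measurable]: "X t \<in> M \<rightarrow>\<^sub>M N" if "1 \<le> t" for t
    using X that by (auto simp: indep_vars_def)
  \<comment> \<open>By \<open>C_cong\<close> forgetting the draws from \<open>t\<close> on does not
    change the cutoff; it becomes a function of a block of coordinates that is independent of
    \<open>X t\<close>.\<close>
  define past where "past t \<omega> = (\<lambda>s\<in>{1..<t}. X s \<omega>)" for t \<omega>
  have past[measurable]: "past t \<in> M \<rightarrow>\<^sub>M PiM {1..<t} (\<lambda>_. N)" for t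
    unfolding past_def by (intro measurable_restrict) auto
  have C_past: "C (\<lambda>s. X s \<omega>) t = C (past t' \<omega>) t" if "t \<le> t'" for t t' \<omega>
    using that by (intro C_cong) (auto simp: past_def)
  have C_m: "(\<lambda>x. C x s) \<in> borel_measurable (PiM {1..<t} (\<lambda>_. N))" if "1 \<le> s" "s \<le> t" for s t
  proof -
    have "(\<lambda>x. restrict x {1..<s}) \<in> PiM {1..<t} (\<lambda>_. N) \<rightarrow>\<^sub>M PiM {1..<s} (\<lambda>_. N)"
      using that by (intro measurable_restrict_subset) auto
    then have "(\<lambda>x. C (restrict x {1..<s}) s) \<in> borel_measurable (PiM {1..<t} (\<lambda>_. N))"
      by (rule measurable_compose[OF _ C_meas[OF that(1)]])
    moreover have "C (restrict x {1..<s}) s = C x s" for x by (rule C_cong) simp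
    ultimately show ?thesis by simp
  qed
  show Ym: "random_variable borel (\<lambda>\<omega>. \<psi> (C (\<lambda>s. X s \<omega>) s) (X s \<omega>))" if s: "1 \<le> s" for s
  proof -
    have [measurable]: "(\<lambda>\<omega>. C (past s \<omega>) s) \<in> borel_measurable M"
      using measurable_compose[OF past C_meas[OF s]] .
    have "(\<lambda>\<omega>. \<psi> (C (past s \<omega>) s) (X s \<omega>)) \<in> borel_measurable M"
      using measurable_compose[OF measurable_Pair \<psi>, of "\<lambda>\<omega>. C (past s \<omega>) s" M "X s"] s by simp
    then show ?thesis by (simp add: C_past[of s s])
  qed
  have b2: "integrable M (\<lambda>\<omega>. (b (X s \<omega>))\<^sup>2)" "expectation (\<lambda>\<omega>. (b (X s \<omega>))\<^sup>2) = (\<integral>y. (b y)\<^sup>2 \<partial>T)" if s: "1 \<le> s" for s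
  proof -
    have "integrable (distr M N (X s)) (\<lambda>y. (b y)\<^sup>2)" using b(2) T[OF s] by simp
    then show "integrable M (\<lambda>\<omega>. (b (X s \<omega>))\<^sup>2)" by (subst (asm) integrable_distr_eq) (use s in auto)
    show "expectation (\<lambda>\<omega>. (b (X s \<omega>))\<^sup>2) = (\<integral>y. (b y)\<^sup>2 \<partial>T)"
      unfolding T[OF s, symmetric] by (subst integral_distr) (use s in auto)
  qed
  have le: "(\<psi> c y)\<^sup>2 \<le> (b y)\<^sup>2" for c y
    using bound[of c y] by (metis abs_ge_zero power2_abs power_mono)
  show sq: "integrable M (\<lambda>\<omega>. (\<psi> (C (\<lambda>s. X s \<omega>) s) (X s \<omega>))\<^sup>2)" if s: "1 \<le> s" for s
    by (rule Bochner_Integration.integrable_bound[OF b2(1)[OF s]]) (use Ym[OF s] le in auto)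
  show "expectation (\<lambda>\<omega>. (\<psi> (C (\<lambda>s. X s \<omega>) s) (X s \<omega>))\<^sup>2) \<le> (\<integral>y. (b y)\<^sup>2 \<partial>T)" if s: "1 \<le> s" for s
    unfolding b2(2)[OF s, symmetric] by (intro integral_mono sq b2 s le)
  show "expectation (\<lambda>\<omega>. \<psi> (C (\<lambda>s. X s \<omega>) s) (X s \<omega>) * \<psi> (C (\<lambda>s. X s \<omega>) t) (X t \<omega>)) = 0"
    if st: "1 \<le> s" "s < t" for s t
  proof -
    have t: "1 \<le> t" using st by simp
    define f where "f z = \<psi> (C z s) (z s)" for z
    define h where "h z = f (fst z) * \<psi> (C (fst z) t) (snd z t)" for z :: "(nat \<Rightarrow> 'b) \<times> (nat \<Rightarrow> 'b)"
    \<comment> \<open>The single draw \<open>X t\<close> is kept as a family over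
      \<open>{t}\<close>, the form in which independence of disjoint index blocks applies.\<close>
    define last where "last \<omega> = (\<lambda>i\<in>{t}. X i \<omega>)" for \<omega>
    let ?Q = "PiM {t} (\<lambda>_. N)"
    have last[measurable]: "last \<in> M \<rightarrow>\<^sub>M ?Q"
      unfolding last_def using t by (intro measurable_restrict) auto
    have last_t: "last \<omega> t = X t \<omega>" for \<omega> by (simp add: last_def)
    have zt[measurable]: "(\<lambda>z. z t) \<in> ?Q \<rightarrow>\<^sub>M N"
      by (intro measurable_component_singleton) simp
    let ?P = "PiM {1..<t} (\<lambda>_. N)"
    have Cs[measurable]: "(\<lambda>x. C x s) \<in> borel_measurable ?P"
      by (rule C_m) (use st in simp_all)
    have Ct[measurable]: "(\<lambda>x. C x t) \<in> borel_measurable ?P"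
      by (rule C_m) (use st in simp_all)
    have zs[measurable]: "(\<lambda>z. z s) \<in> ?P \<rightarrow>\<^sub>M N"
      using st by (intro measurable_component_singleton) auto
    have f[measurable]: "f \<in> borel_measurable ?P"
      unfolding f_def using measurable_compose[OF measurable_Pair[OF Cs zs] \<psi>] by simp
    have "(\<lambda>z. \<psi> (C (fst z) t) (snd z t)) \<in> borel_measurable (?P \<Otimes>\<^sub>M ?Q)"
      using measurable_compose[OF measurable_Pair[OF measurable_compose[OF measurable_fst Ct] measurable_compose[OF measurable_snd zt]] \<psi>]
      by simp
    then have h[measurable]: "h \<in> borel_measurable (?P \<Otimes>\<^sub>M ?Q)" unfolding h_def by measurable
    have "indep_var ?P (past t) ?Q last"
      unfolding past_def[abs_def] last_def[abs_def] by (rule indep_var_restrict[OF X]) (use t in auto)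
    then have joint: "distr M ?P (past t) \<Otimes>\<^sub>M distr M ?Q last = distr M (?P \<Otimes>\<^sub>M ?Q) (\<lambda>\<omega>. (past t \<omega>, last \<omega>))"
      by (simp add: indep_var_distribution_eq)
    have pm[measurable]: "(\<lambda>\<omega>. (past t \<omega>, last \<omega>)) \<in> M \<rightarrow>\<^sub>M ?P \<Otimes>\<^sub>M ?Q" by measurable
    have mean': "(\<integral>w. \<psi> a (w t) \<partial>distr M ?Q last) = 0" for a
    proof -
      have \<psi>a: "\<psi> a \<in> borel_measurable N"
        using measurable_compose[OF measurable_Pair1' \<psi>, of a] by simp
      have "(\<integral>w. \<psi> a (w t) \<partial>distr M ?Q last) = expectation (\<lambda>\<omega>. \<psi> a (X t \<omega>))"
        by (subst integral_distr[OF last measurable_compose[OF zt \<psi>a]]) (simp add: last_t)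
      also have "\<dots> = (\<integral>y. \<psi> a y \<partial>T)"
        unfolding T[OF t, symmetric] by (rule integral_distr[OF Xm[OF t] \<psi>a, symmetric])
      finally show ?thesis by (simp add: mean)
    qed
    have eq: "\<psi> (C (\<lambda>s. X s \<omega>) s) (X s \<omega>) * \<psi> (C (\<lambda>s. X s \<omega>) t) (X t \<omega>) = h (past t \<omega>, last \<omega>)" for \<omega>
      using st C_past[of s t \<omega>] C_past[of t t \<omega>] by (simp add: h_def f_def past_def last_def)
    interpret T: prob_space "distr M ?Q last" by (rule prob_space_distr[OF last])
    interpret D: prob_space "distr M ?P (past t)" by (rule prob_space_distr[OF past])
    interpret pair_prob_space "distr M ?P (past t)" "distr M ?Q last" ..
    have "integrable M (\<lambda>\<omega>. h (past t \<omega>, last \<omega>))"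
    proof (rule Bochner_Integration.integrable_bound)
      show "integrable M (\<lambda>\<omega>. (b (X s \<omega>))\<^sup>2 + (b (X t \<omega>))\<^sup>2)" using b2 st t by simp
      show "AE \<omega> in M. norm (h (past t \<omega>, last \<omega>)) \<le> norm ((b (X s \<omega>))\<^sup>2 + (b (X t \<omega>))\<^sup>2)"
      proof (rule AE_I2)
        fix \<omega>
        have "norm (h (past t \<omega>, last \<omega>)) \<le> b (X s \<omega>) * b (X t \<omega>)"
          unfolding eq[symmetric] real_norm_def abs_mult
          using bound by (intro mult_mono) (auto intro: order_trans[OF abs_ge_zero])
        also have "\<dots> \<le> (b (X s \<omega>))\<^sup>2 + (b (X t \<omega>))\<^sup>2"
        proof -
          have "0 \<le> (b (X s \<omega>) - b (X t \<omega>))\<^sup>2" "0 \<le> (b (X s \<omega>))\<^sup>2" "0 \<le> (b (X t \<omega>))\<^sup>2" by simp_all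
          then show ?thesis unfolding power2_diff by linarith
        qed
        finally show "norm (h (past t \<omega>, last \<omega>)) \<le> norm ((b (X s \<omega>))\<^sup>2 + (b (X t \<omega>))\<^sup>2)" by simp
      qed
    qed measurable
    then have "integrable (distr M (?P \<Otimes>\<^sub>M ?Q) (\<lambda>\<omega>. (past t \<omega>, last \<omega>))) h"
      by (subst integrable_distr_eq[OF pm h])
    then have hint: "integrable (distr M ?P (past t) \<Otimes>\<^sub>M distr M ?Q last) h" by (simp only: joint)
    have "(\<integral>\<omega>. h (past t \<omega>, last \<omega>) \<partial>M) = integral\<^sup>L (distr M (?P \<Otimes>\<^sub>M ?Q) (\<lambda>\<omega>. (past t \<omega>, last \<omega>))) h"
      by (rule integral_distr[OF pm h, symmetric])
    also have "\<dots> = integral\<^sup>L (distr M ?P (past t) \<Otimes>\<^sub>M distr M ?Q last) h" by (simp only: joint)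
    \<comment> \<open>Fubini with the newest draw innermost: for a frozen past the cutoffs and the
      factor of round \<open>s\<close> are constants, and \<open>mean'\<close> makes the inner
      integral vanish.\<close>
    also have "\<dots> = (\<integral>z. \<integral>y. h (z, y) \<partial>distr M ?Q last \<partial>distr M ?P (past t))"
      by (rule integral_fst'[OF hint, symmetric])
    also have "\<dots> = 0" by (simp add: h_def mean')
    finally show ?thesis unfolding eq .
  qed
qed

text \<open>The adapted law for the centred truncations of \<open>v\<close>. With
  \<open>v = 1\<close> it compares the number of continuing agents with the sum of their
  continuation probabilities; with \<open>v\<close> the residual of \<open>X2 + \<gamma> X1\<close>
  it treats the sum of the observed residuals.\<close>

lemma (in prob_space) truncated_strong_law:
  fixes X :: "nat \<Rightarrow> 'a \<Rightarrow> real \<times> real" and C :: "(nat \<Rightarrow> real \<times> real) \<Rightarrow> nat \<Rightarrow> real"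
    and v :: "real \<times> real \<Rightarrow> real"
  assumes X: "indep_vars (\<lambda>_. borel) X {1..}" and T: "\<And>t. 1 \<le> t \<Longrightarrow> distr M borel (X t) = T"
    and C_cong: "\<And>t x x'. (\<And>s. 1 \<le> s \<Longrightarrow> s < t \<Longrightarrow> x s = x' s) \<Longrightarrow> C x t = C x' t"
    and C_meas: "\<And>t. 1 \<le> t \<Longrightarrow> (\<lambda>x. C x t) \<in> borel_measurable (PiM {1..<t} (\<lambda>_. borel))"
    and v[measurable]: "v \<in> borel_measurable borel" and v2: "integrable T (\<lambda>y. (v y)\<^sup>2)"
  shows "AE \<omega> in M. (\<lambda>t. ((\<Sum>s=1..t. indicator {..C (\<lambda>s. X s \<omega>) s} (fst (X s \<omega>)) * v (X s \<omega>))
      - (\<Sum>s=1..t. \<integral>y. indicator {..C (\<lambda>s. X s \<omega>) s} (fst y) * v y \<partial>T)) / t) \<longlonglongrightarrow> 0"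
proof -
  have X1: "X 1 \<in> M \<rightarrow>\<^sub>M borel" using X by (auto simp: indep_vars_def)
  interpret T: prob_space T unfolding T[OF order_refl, symmetric] by (rule prob_space_distr[OF X1])
  have setsT[simp, measurable_cong]: "sets T = sets borel" using T[of 1] by auto
  have fst[measurable]: "(fst :: real \<times> real \<Rightarrow> real) \<in> borel_measurable borel"
    by (subst borel_prod[symmetric]) measurable
  have v1: "integrable T v" by (rule T.square_integrable_imp_integrable[OF _ v2]) simp
  define I where "I c y = indicat_real {..c} (fst y) * v y" for c and y :: "real \<times> real"
  have I_m: "(\<lambda>(c, y). I c y) \<in> borel_measurable (borel \<Otimes>\<^sub>M borel)"
  proof -
    have "(\<lambda>z. (if fst (snd z) \<le> fst z then 1 else 0) * v (snd z)) \<in> borel_measurable (borel \<Otimes>\<^sub>M borel)"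
      by measurable
    also have "(\<lambda>z. (if fst (snd z) \<le> fst z then 1 else 0) * v (snd z)) = (\<lambda>(c, y). I c y)"
      by (auto simp: I_def fun_eq_iff)
    finally show ?thesis .
  qed
  have I_T: "(\<lambda>c. \<integral>y. I c y \<partial>T) \<in> borel_measurable borel"
    by (rule T.borel_measurable_lebesgue_integral) (use I_m in \<open>simp cong: measurable_cong_sets sets_pair_measure_cong\<close>)
  have I_int: "integrable T (I c)" for c
  proof -
    have "integrable T (\<lambda>y. v y * indicator (fst -` {..c}) y)"
      by (intro integrable_real_mult_indicator v1) (use measurable_sets[OF fst, of "{..c}"] in simp)
    then show ?thesis by (simp add: I_def[abs_def] indicator_vimage comp_def mult.commute)
  qed
  \<comment> \<open>The dominating function has to serve all cutoffs at once:
    \<open>\<bar>v y\<bar>\<close> covers the truncated value and its mean covers the truncated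
    mean.\<close>
  have bound: "\<bar>I c y - (\<integral>y. I c y \<partial>T)\<bar> \<le> \<bar>v y\<bar> + (\<integral>y. \<bar>v y\<bar> \<partial>T)" for c y
  proof -
    have Iv: "\<bar>I c y\<bar> \<le> \<bar>v y\<bar>" for y by (auto simp: I_def indicator_def)
    have "\<bar>\<integral>y. I c y \<partial>T\<bar> \<le> (\<integral>y. \<bar>I c y\<bar> \<partial>T)" by (rule integral_abs_bound)
    also have "\<dots> \<le> (\<integral>y. \<bar>v y\<bar> \<partial>T)" using I_int v1 Iv by (intro integral_mono) auto
    finally show ?thesis using Iv[of y] by linarith
  qed
  have b2: "integrable T (\<lambda>y. (\<bar>v y\<bar> + (\<integral>y. \<bar>v y\<bar> \<partial>T))\<^sup>2)"
    using v1 v2 by (simp add: power2_sum)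
  have "AE \<omega> in M. (\<lambda>t. (\<Sum>s=1..t. (\<lambda>c y. I c y - (\<integral>y. I c y \<partial>T)) (C (\<lambda>s. X s \<omega>) s) (X s \<omega>)) / t) \<longlonglongrightarrow> 0"
  proof (rule adapted_strong_law[OF X T C_cong C_meas _ bound _ b2])
    show "(\<lambda>(c, y). I c y - (\<integral>y. I c y \<partial>T)) \<in> borel_measurable (borel \<Otimes>\<^sub>M borel)"
      unfolding case_prod_beta'
      by (intro borel_measurable_diff measurable_compose[OF measurable_fst I_T])
         (use I_m in \<open>simp add: case_prod_beta'\<close>)
    show "(\<integral>y. I c y - (\<integral>y. I c y \<partial>T) \<partial>T) = 0" for c
      using I_int T.prob_space by simp
  qed simp_all
  then show ?thesis by (simp add: sum_subtractf I_def)
qed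

section \<open>Gaussian laws and the stage game\<close>

abbreviation gauss :: "real \<Rightarrow> real \<Rightarrow> real measure" where
  "gauss \<mu> \<sigma> \<equiv> density lborel (\<lambda>x. ennreal (normal_density \<mu> \<sigma> x))"

lemma integrable_gauss_power:
  assumes "0 < \<sigma>" shows "integrable (gauss \<mu> \<sigma>) (\<lambda>x. (x - \<mu>) ^ k)"
  using integrable_normal_moment[OF assms, of \<mu> k] by (subst integrable_real_density) auto

lemma integrable_gauss_id:
  assumes "0 < \<sigma>" shows "integrable (gauss \<mu> \<sigma>) (\<lambda>x. x)"
  using integrable_normal_moment_nz_1[OF assms, of \<mu>] by (subst integrable_real_density) auto

lemma integral_gauss_id:
  assumes "0 < \<sigma>" shows "(\<integral>x. x \<partial>gauss \<mu> \<sigma>) = \<mu>"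
  using integral_normal_moment_nz_1[OF assms, of \<mu>] by (subst integral_real_density) auto

lemma gauss_shift: "distr (gauss 0 \<sigma>) borel ((+) m) = gauss m \<sigma>"
proof (rule measure_eqI)
  fix A assume "A \<in> sets (distr (gauss 0 \<sigma>) borel ((+) m))"
  then have [measurable]: "A \<in> sets borel" by simp
  have "emeasure (gauss m \<sigma>) A = (\<integral>\<^sup>+x. ennreal (normal_density m \<sigma> x) * indicator A x \<partial>lborel)"
    by (simp add: emeasure_density)
  also have "\<dots> = (\<integral>\<^sup>+x. ennreal (normal_density m \<sigma> (m + 1 * x)) * indicator A (m + 1 * x) \<partial>lborel)"
    by (subst nn_integral_real_affine[where c = 1 and t = m]) simp_all
  also have "\<dots> = (\<integral>\<^sup>+x. ennreal (normal_density 0 \<sigma> x) * indicator A (m + x) \<partial>lborel)"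
    by (simp add: normal_density_def)
  also have "\<dots> = emeasure (distr (gauss 0 \<sigma>) borel ((+) m)) A"
  proof -
    have "emeasure (distr (gauss 0 \<sigma>) borel ((+) m)) A = (\<integral>\<^sup>+x. indicator A x \<partial>distr (gauss 0 \<sigma>) borel ((+) m))"
      by simp
    also have "\<dots> = (\<integral>\<^sup>+x. indicator A (m + x) \<partial>gauss 0 \<sigma>)"
      by (subst nn_integral_distr) simp_all
    also have "\<dots> = (\<integral>\<^sup>+x. ennreal (normal_density 0 \<sigma> x) * indicator A (m + x) \<partial>lborel)"
      by (subst nn_integral_density) simp_all
    finally show ?thesis ..
  qed
  finally show "emeasure (distr (gauss 0 \<sigma>) borel ((+) m)) A = emeasure (gauss m \<sigma>) A" ..
qed simp

lemma nn_integral_Psi: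
  assumes [measurable]: "f \<in> borel_measurable borel"
  shows "(\<integral>\<^sup>+p. f p \<partial>Psi \<sigma> \<mu>1 \<mu>2 \<gamma>) =
    (\<integral>\<^sup>+x. \<integral>\<^sup>+y. f (x, y) \<partial>gauss (\<mu>2 - \<gamma> * (x - \<mu>1)) \<sigma> \<partial>gauss \<mu>1 \<sigma>)"
proof -
  have [measurable]: "(\<lambda>p. normal_density (\<mu>2 - \<gamma> * (fst p - \<mu>1)) \<sigma> (snd p)) \<in> borel_measurable (borel \<Otimes>\<^sub>M borel)"
    unfolding normal_density_def by measurable
  have [measurable]: "f \<in> borel_measurable (borel \<Otimes>\<^sub>M borel)"
    using assms by (simp add: borel_prod)
  have "(\<integral>\<^sup>+p. f p \<partial>Psi \<sigma> \<mu>1 \<mu>2 \<gamma>) = (\<integral>\<^sup>+p. ennreal (normal_density \<mu>1 \<sigma> (fst p) *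
      normal_density (\<mu>2 - \<gamma> * (fst p - \<mu>1)) \<sigma> (snd p)) * f p \<partial>(lborel \<Otimes>\<^sub>M lborel))"
    unfolding Psi_def lborel_prod[symmetric]
    by (subst nn_integral_density) (auto simp: case_prod_beta' borel_prod)
  also have "\<dots> = (\<integral>\<^sup>+x. \<integral>\<^sup>+y. ennreal (normal_density \<mu>1 \<sigma> x *
      normal_density (\<mu>2 - \<gamma> * (x - \<mu>1)) \<sigma> y) * f (x, y) \<partial>lborel \<partial>lborel)"
    by (subst lborel.nn_integral_fst[symmetric]) simp_all
  also have "\<dots> = (\<integral>\<^sup>+x. ennreal (normal_density \<mu>1 \<sigma> x) *
     (\<integral>\<^sup>+y. ennreal (normal_density (\<mu>2 - \<gamma> * (x - \<mu>1)) \<sigma> y) * f (x, y) \<partial>lborel) \<partial>lborel)"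
    by (simp add: ennreal_mult mult.assoc nn_integral_cmult)
  also have "\<dots> = (\<integral>\<^sup>+x. \<integral>\<^sup>+y. f (x, y) \<partial>gauss (\<mu>2 - \<gamma> * (x - \<mu>1)) \<sigma> \<partial>gauss \<mu>1 \<sigma>)"
    by (simp add: nn_integral_density)
  finally show ?thesis .
qed

text \<open>The second draw is its conditional mean plus independent noise. This presents the joint
  law as the image of a product of two normal laws under a shear, so that in Fubini the inner
  measure does not depend on \<open>x\<close>.\<close>

lemma Psi_eq_distr:
  assumes "0 < \<sigma>"
  shows "Psi \<sigma> \<mu>1 \<mu>2 \<gamma> = distr (gauss \<mu>1 \<sigma> \<Otimes>\<^sub>M gauss 0 \<sigma>) borel (\<lambda>(x, z). (x, \<mu>2 - \<gamma> * (x - \<mu>1) + z))"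
    (is "_ = distr ?N borel ?h")
proof (rule measure_eqI)
  show "sets (Psi \<sigma> \<mu>1 \<mu>2 \<gamma>) = sets (distr ?N borel ?h)"
    by (simp add: Psi_def)
  fix A assume "A \<in> sets (Psi \<sigma> \<mu>1 \<mu>2 \<gamma>)"
  then have A[measurable]: "A \<in> sets borel" by (simp add: Psi_def)
  have [measurable]: "A \<in> sets (borel \<Otimes>\<^sub>M borel)"
    using A by (metis borel_prod)
  interpret Z: prob_space "gauss 0 \<sigma>" using assms by (rule prob_space_normal_density)
  have [measurable]: "?h \<in> ?N \<rightarrow>\<^sub>M borel" by (subst borel_prod[symmetric]) measurable
  have "emeasure (Psi \<sigma> \<mu>1 \<mu>2 \<gamma>) A = (\<integral>\<^sup>+p. indicator A p \<partial>Psi \<sigma> \<mu>1 \<mu>2 \<gamma>)"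
    using A by (simp add: Psi_def)
  also have "\<dots> = (\<integral>\<^sup>+x. \<integral>\<^sup>+y. indicator A (x, y) \<partial>gauss (\<mu>2 - \<gamma> * (x - \<mu>1)) \<sigma> \<partial>gauss \<mu>1 \<sigma>)"
    by (simp add: nn_integral_Psi)
  also have "\<dots> = (\<integral>\<^sup>+x. \<integral>\<^sup>+z. indicator A (?h (x, z)) \<partial>gauss 0 \<sigma> \<partial>gauss \<mu>1 \<sigma>)"
    by (subst gauss_shift[symmetric]) (simp add: nn_integral_distr)
  also have "\<dots> = (\<integral>\<^sup>+p. indicator A (?h p) \<partial>?N)"
    by (subst Z.nn_integral_fst) simp_all
  also have "\<dots> = emeasure (distr ?N borel ?h) A"
  proof -
    have "(\<integral>\<^sup>+p. indicator A (?h p) \<partial>?N) = (\<integral>\<^sup>+p. indicator A p \<partial>distr ?N borel ?h)"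
      by (subst nn_integral_distr) simp_all
    then show ?thesis by simp
  qed
  finally show "emeasure (Psi \<sigma> \<mu>1 \<mu>2 \<gamma>) A = emeasure (distr ?N borel ?h) A" .
qed

lemma prob_space_Psi:
  assumes "0 < \<sigma>" shows "prob_space (Psi \<sigma> \<mu>1 \<mu>2 \<gamma>)"
proof -
  interpret X: prob_space "gauss \<mu>1 \<sigma>" using assms by (rule prob_space_normal_density)
  interpret Z: prob_space "gauss 0 \<sigma>" using assms by (rule prob_space_normal_density)
  interpret pair_prob_space "gauss \<mu>1 \<sigma>" "gauss 0 \<sigma>" ..
  show ?thesis unfolding Psi_eq_distr[OF assms]
    by (intro prob_space_distr) (subst borel_prod[symmetric], measurable)
qed

lemma sets_Psi [measurable_cong, simp]: "sets (Psi \<sigma> \<mu>1 \<mu>2 \<gamma>) = sets borel"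
  by (simp add: Psi_def)

lemma space_Psi [simp]: "space (Psi \<sigma> \<mu>1 \<mu>2 \<gamma>) = UNIV"
  by (simp add: Psi_def)

lemma measurable_shear [measurable]:
  "(\<lambda>(x::real, z::real). (x, m - \<gamma> * (x - \<mu>) + z)) \<in> gauss a \<sigma> \<Otimes>\<^sub>M gauss b \<sigma> \<rightarrow>\<^sub>M borel"
  by (subst borel_prod[symmetric]) measurable

lemma integrable_Psi_iff:
  fixes f :: "real \<times> real \<Rightarrow> real"
  assumes "0 < \<sigma>" and [measurable]: "f \<in> borel_measurable borel"
  shows "integrable (Psi \<sigma> \<mu>1 \<mu>2 \<gamma>) f \<longleftrightarrow>
    integrable (gauss \<mu>1 \<sigma> \<Otimes>\<^sub>M gauss 0 \<sigma>) (\<lambda>(x, z). f (x, \<mu>2 - \<gamma> * (x - \<mu>1) + z))"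
  unfolding Psi_eq_distr[OF assms(1)]
  by (subst integrable_distr_eq) (auto simp: case_prod_beta')

lemma integral_Psi:
  fixes f :: "real \<times> real \<Rightarrow> real"
  assumes "0 < \<sigma>" and f: "integrable (Psi \<sigma> \<mu>1 \<mu>2 \<gamma>) f"
  shows "integral\<^sup>L (Psi \<sigma> \<mu>1 \<mu>2 \<gamma>) f =
    (\<integral>x. \<integral>z. f (x, \<mu>2 - \<gamma> * (x - \<mu>1) + z) \<partial>gauss 0 \<sigma> \<partial>gauss \<mu>1 \<sigma>)"
proof -
  interpret X: prob_space "gauss \<mu>1 \<sigma>" using assms by (intro prob_space_normal_density)
  interpret Z: prob_space "gauss 0 \<sigma>" using assms by (intro prob_space_normal_density)
  interpret pair_prob_space "gauss \<mu>1 \<sigma>" "gauss 0 \<sigma>" ..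
  have [measurable]: "f \<in> borel_measurable borel"
    using borel_measurable_integrable[OF f] by simp
  have "integrable (gauss \<mu>1 \<sigma> \<Otimes>\<^sub>M gauss 0 \<sigma>) (\<lambda>(x, z). f (x, \<mu>2 - \<gamma> * (x - \<mu>1) + z))"
    using f integrable_Psi_iff[OF assms(1), of f] by simp
  from integral_fst'[OF this] show ?thesis
    unfolding Psi_eq_distr[OF assms(1)]
    by (subst integral_distr) (auto simp: case_prod_beta')
qed

lemma integrable_Psi_square:
  assumes "0 < \<sigma>"
  shows "integrable (Psi \<sigma> \<mu>1 \<mu>2 \<gamma>) (\<lambda>(x, y). (a + b * x + c * y)\<^sup>2)"
proof -
  interpret X: prob_space "gauss \<mu>1 \<sigma>" using assms by (rule prob_space_normal_density)
  interpret Z: prob_space "gauss 0 \<sigma>" using assms by (rule prob_space_normal_density)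
  interpret pair_prob_space "gauss \<mu>1 \<sigma>" "gauss 0 \<sigma>" ..
  let ?N = "gauss \<mu>1 \<sigma> \<Otimes>\<^sub>M gauss 0 \<sigma>"
  \<comment> \<open>Value of the affine function at the two means. In terms of the noise
    \<open>z\<close> the function is \<open>a' + (b - c * \<gamma>) * (x - \<mu>1) + c * z\<close>,
    so centred second moments suffice.\<close>
  define a' where "a' = a + b * \<mu>1 + c * \<mu>2"
  have "integrable (gauss \<mu>1 \<sigma>) (\<lambda>x. a'\<^sup>2 * 2 + (2 * (b - c * \<gamma>)\<^sup>2) * (x - \<mu>1)\<^sup>2)"
    using integrable_gauss_power[OF assms, of \<mu>1 2] by simp
  then have "integrable (distr ?N (gauss \<mu>1 \<sigma>) fst) (\<lambda>x. a'\<^sup>2 * 2 + (2 * (b - c * \<gamma>)\<^sup>2) * (x - \<mu>1)\<^sup>2)"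
    by (simp add: Z.distr_pair_fst)
  then have 1: "integrable ?N (\<lambda>p. a'\<^sup>2 * 2 + (2 * (b - c * \<gamma>)\<^sup>2) * (fst p - \<mu>1)\<^sup>2)"
    by (subst (asm) integrable_distr_eq) simp_all
  interpret ZX: pair_prob_space "gauss 0 \<sigma>" "gauss \<mu>1 \<sigma>" ..
  have "integrable (distr (gauss 0 \<sigma> \<Otimes>\<^sub>M gauss \<mu>1 \<sigma>) (gauss 0 \<sigma>) fst) (\<lambda>z. c\<^sup>2 * z\<^sup>2)"
    using integrable_gauss_power[OF assms, of 0 2] by (simp add: X.distr_pair_fst)
  then have "integrable (gauss 0 \<sigma> \<Otimes>\<^sub>M gauss \<mu>1 \<sigma>) (\<lambda>p. c\<^sup>2 * (fst p)\<^sup>2)"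
    by (subst (asm) integrable_distr_eq) simp_all
  from ZX.integrable_product_swap[OF this]
  have 2: "integrable ?N (\<lambda>p. c\<^sup>2 * (snd p)\<^sup>2)"
    by (simp add: case_prod_beta')
  have "integrable ?N (\<lambda>p. 2 * (a'\<^sup>2 * 2 + (2 * (b - c * \<gamma>)\<^sup>2) * (fst p - \<mu>1)\<^sup>2) + 2 * (c\<^sup>2 * (snd p)\<^sup>2))"
    by (intro Bochner_Integration.integrable_add integrable_mult_right[OF 1] integrable_mult_right[OF 2])
  then have "integrable ?N (\<lambda>(x, z). (a + b * x + c * (\<mu>2 - \<gamma> * (x - \<mu>1) + z))\<^sup>2)"
  proof (rule Bochner_Integration.integrable_bound)
    show "AE p in ?N. norm (case p of (x, z) \<Rightarrow> (a + b * x + c * (\<mu>2 - \<gamma> * (x - \<mu>1) + z))\<^sup>2)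
       \<le> norm (2 * (a'\<^sup>2 * 2 + (2 * (b - c * \<gamma>)\<^sup>2) * (fst p - \<mu>1)\<^sup>2) + 2 * (c\<^sup>2 * (snd p)\<^sup>2))"
    proof (intro AE_I2, clarify)
      fix x z :: real
      have sq: "(s + t)\<^sup>2 \<le> 2 * s\<^sup>2 + 2 * t\<^sup>2" for s t :: real
        using sum_squares_ge_zero[of "s - t" 0] by (simp add: power2_eq_square algebra_simps)
      have "(a + b * x + c * (\<mu>2 - \<gamma> * (x - \<mu>1) + z))\<^sup>2 = ((a' + (b - c * \<gamma>) * (x - \<mu>1)) + c * z)\<^sup>2"
        by (simp add: a'_def algebra_simps)
      also have "\<dots> \<le> 2 * (2 * a'\<^sup>2 + 2 * ((b - c * \<gamma>) * (x - \<mu>1))\<^sup>2) + 2 * (c * z)\<^sup>2"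
        by (rule order_trans[OF sq]) (intro add_right_mono mult_left_mono sq, simp)
      finally show "norm ((a + b * x + c * (\<mu>2 - \<gamma> * (x - \<mu>1) + z))\<^sup>2) \<le>
        norm (2 * (a'\<^sup>2 * 2 + (2 * (b - c * \<gamma>)\<^sup>2) * (fst (x, z) - \<mu>1)\<^sup>2) + 2 * (c\<^sup>2 * (snd (x, z))\<^sup>2))"
        by (simp add: power_mult_distrib mult.commute)
    qed
  qed measurable
  then show ?thesis
    using integrable_Psi_iff[OF assms, of "\<lambda>(x, y). (a + b * x + c * y)\<^sup>2" \<mu>1 \<mu>2 \<gamma>]
    by (simp add: borel_prod[symmetric])
qed

lemma integrable_Psi_affine:
  assumes "0 < \<sigma>"
  shows "integrable (Psi \<sigma> \<mu>1 \<mu>2 \<gamma>) (\<lambda>(x, y). a + b * x + c * y)"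
proof -
  interpret prob_space "Psi \<sigma> \<mu>1 \<mu>2 \<gamma>" using assms by (rule prob_space_Psi)
  have [measurable]: "(\<lambda>(x, y). a + b * x + c * y) \<in> borel_measurable (borel :: (real \<times> real) measure)"
    by (subst borel_prod[symmetric]) measurable
  show ?thesis
    by (rule square_integrable_imp_integrable)
       (measurable, use integrable_Psi_square[OF assms, of \<mu>1 \<mu>2 \<gamma> a b c] in \<open>auto simp: case_prod_beta'\<close>)
qed

text \<open>The payoff \<open>x1\<close> of stopping minus the expected payoff of continuing, as a function of the distance
  \<open>y\<close> of \<open>x1\<close> from the conditional mean of \<open>X2\<close>.\<close>

definition gap :: "real \<Rightarrow> real \<Rightarrow> real \<Rightarrow> real \<Rightarrow> real" where
  "gap q \<kappa> \<sigma> y = y + \<kappa> - q * (\<integral>z. max y z \<partial>gauss 0 \<sigma>)"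

lemma integrable_gauss_max:
  assumes "0 < \<sigma>" shows "integrable (gauss \<mu> \<sigma>) (\<lambda>z. max y z)"
proof -
  interpret prob_space "gauss \<mu> \<sigma>" using assms by (rule prob_space_normal_density)
  show ?thesis using integrable_gauss_id[OF assms] by (intro integrable_max) simp_all
qed

text \<open>Raising \<open>y\<close> raises the expected maximum by at least zero and at most as
  much, so \<open>gap\<close> has slopes between \<open>1 - q\<close> and \<open>1\<close>. The
  lower bound makes cutoffs unique and yields the later factor \<open>1 / (1 - q)\<close>; the upper
  one makes \<open>gap\<close> Lipschitz with constant one.\<close>

lemma gap_slope:
  assumes "0 < \<sigma>" "0 \<le> q" "y \<le> y'"
  shows "(1 - q) * (y' - y) \<le> gap q \<kappa> \<sigma> y' - gap q \<kappa> \<sigma> y"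
    and "gap q \<kappa> \<sigma> y' - gap q \<kappa> \<sigma> y \<le> y' - y"
proof -
  interpret prob_space "gauss 0 \<sigma>" using assms(1) by (rule prob_space_normal_density)
  note int = integrable_gauss_max[OF assms(1), of 0]
  have d: "(\<integral>z. max y' z \<partial>gauss 0 \<sigma>) - (\<integral>z. max y z \<partial>gauss 0 \<sigma>) = (\<integral>z. max y' z - max y z \<partial>gauss 0 \<sigma>)"
    using int by simp
  have "0 \<le> (\<integral>z. max y' z - max y z \<partial>gauss 0 \<sigma>)"
    using assms(3) by (intro integral_nonneg_AE) auto
  moreover have "(\<integral>z. max y' z - max y z \<partial>gauss 0 \<sigma>) \<le> (\<integral>z. y' - y \<partial>gauss 0 \<sigma>)"
    using int assms(3) by (intro integral_mono) auto
  ultimately have "0 \<le> (\<integral>z. max y' z \<partial>gauss 0 \<sigma>) - (\<integral>z. max y z \<partial>gauss 0 \<sigma>)"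
      "(\<integral>z. max y' z \<partial>gauss 0 \<sigma>) - (\<integral>z. max y z \<partial>gauss 0 \<sigma>) \<le> y' - y"
    using d prob_space by simp_all
  then have "0 \<le> q * ((\<integral>z. max y' z \<partial>gauss 0 \<sigma>) - (\<integral>z. max y z \<partial>gauss 0 \<sigma>))"
      "q * ((\<integral>z. max y' z \<partial>gauss 0 \<sigma>) - (\<integral>z. max y z \<partial>gauss 0 \<sigma>)) \<le> q * (y' - y)"
    using assms(2) by (auto intro: mult_left_mono)
  then show "(1 - q) * (y' - y) \<le> gap q \<kappa> \<sigma> y' - gap q \<kappa> \<sigma> y"
    and "gap q \<kappa> \<sigma> y' - gap q \<kappa> \<sigma> y \<le> y' - y"
    by (auto simp: gap_def algebra_simps)
qed

lemma gap_lipschitz: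
  assumes "0 < \<sigma>" "0 \<le> q" "q < 1"
  shows "\<bar>gap q \<kappa> \<sigma> y' - gap q \<kappa> \<sigma> y\<bar> \<le> \<bar>y' - y\<bar>"
proof (cases "y \<le> y'")
  case True
  then have "0 \<le> (1 - q) * (y' - y)" using assms(3) by simp
  with gap_slope[OF assms(1,2) True, of \<kappa>] True show ?thesis by linarith
next
  case False
  then have le: "y' \<le> y" by simp
  have "0 \<le> (1 - q) * (y - y')" using assms(3) le by simp
  with gap_slope[OF assms(1,2) le, of \<kappa>] le show ?thesis by linarith
qed

lemma continuous_on_gap:
  assumes "0 < \<sigma>" "0 \<le> q" "q < 1"
  shows "continuous_on UNIV (gap q \<kappa> \<sigma>)"
  unfolding continuous_on_iff
  using gap_lipschitz[OF assms, of \<kappa>] by (metis dist_real_def order_le_less_trans)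

lemma borel_measurable_gap [measurable]:
  assumes "0 < \<sigma>" "0 \<le> q" "q < 1"
  shows "gap q \<kappa> \<sigma> \<in> borel_measurable borel"
  by (intro borel_measurable_continuous_onI continuous_on_gap assms)

lemma integral_u2:
  assumes "0 < \<sigma>"
  shows "(\<integral>x2. u2 q \<kappa> x1 (m + x2) \<partial>gauss 0 \<sigma>) = x1 - gap q \<kappa> \<sigma> (x1 - m)"
proof -
  interpret prob_space "gauss 0 \<sigma>" using assms by (rule prob_space_normal_density)
  have "(\<integral>x2. u2 q \<kappa> x1 (m + x2) \<partial>gauss 0 \<sigma>) = (\<integral>z. (m - \<kappa>) + (1 - q) * z + q * max (x1 - m) z \<partial>gauss 0 \<sigma>)"
    by (intro Bochner_Integration.integral_cong) (auto simp: u2_def max_def algebra_simps)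
  also have "\<dots> = (m - \<kappa>) + q * (\<integral>z. max (x1 - m) z \<partial>gauss 0 \<sigma>)"
    using integrable_gauss_id[OF assms, of 0] integrable_gauss_max[OF assms, of 0 "x1 - m"]
      integral_gauss_id[OF assms, of 0] prob_space by simp
  finally show ?thesis by (simp add: gap_def)
qed

text \<open>A higher first draw raises the stopping payoff one for one and lowers the believed mean
  of the second draw at rate \<gamma>, so the argument of \<open>gap\<close> moves at rate
  \<open>1 + \<gamma>\<close>. The two means enter only through
  \<open>\<mu>2 + \<gamma> * \<mu>1\<close>.\<close>

lemma integral_u2_X2_law:
  assumes "0 < \<sigma>"
  shows "(\<integral>x2. u2 q \<kappa> x1 x2 \<partial>X2_law \<sigma> \<gamma> \<mu>1 \<mu>2 x1) = x1 - gap q \<kappa> \<sigma> ((1 + \<gamma>) * x1 - (\<mu>2 + \<gamma> * \<mu>1))"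
proof -
  have "(\<integral>x2. u2 q \<kappa> x1 x2 \<partial>X2_law \<sigma> \<gamma> \<mu>1 \<mu>2 x1) =
     (\<integral>x2. u2 q \<kappa> x1 (\<mu>2 - \<gamma> * (x1 - \<mu>1) + x2) \<partial>gauss 0 \<sigma>)"
    unfolding X2_law_def gauss_shift[symmetric, of "\<mu>2 - \<gamma> * (x1 - \<mu>1)"]
    by (subst integral_distr) (simp_all add: u2_def[abs_def])
  also have "\<dots> = x1 - gap q \<kappa> \<sigma> (x1 - (\<mu>2 - \<gamma> * (x1 - \<mu>1)))"
    by (rule integral_u2[OF assms])
  also have "x1 - (\<mu>2 - \<gamma> * (x1 - \<mu>1)) = (1 + \<gamma>) * x1 - (\<mu>2 + \<gamma> * \<mu>1)"
    by (simp add: algebra_simps)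
  finally show ?thesis .
qed

section \<open>Optimal thresholds and indifference\<close>

lemma measure_gauss_Ico_pos:
  assumes "0 < \<sigma>" "a < b" shows "0 < measure (gauss \<mu> \<sigma>) {a..<b}"
proof -
  interpret prob_space "gauss \<mu> \<sigma>" using assms(1) by (rule prob_space_normal_density)
  have "emeasure (gauss \<mu> \<sigma>) {a..<b} \<noteq> 0"
  proof
    assume "emeasure (gauss \<mu> \<sigma>) {a..<b} = 0"
    then have "{a..<b} \<in> null_sets (gauss \<mu> \<sigma>)" by (intro null_setsI) simp_all
    then have "AE x in lborel. x \<in> {a..<b} \<longrightarrow> ennreal (normal_density \<mu> \<sigma> x) = 0"
      by (subst (asm) null_sets_density_iff) simp_all
    then have "AE x in lborel. x \<notin> {a..<b}"
    proof eventually_elim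
      case (elim x)
      then show ?case using normal_density_pos[OF assms(1), of \<mu> x] by (auto simp: ennreal_eq_0_iff)
    qed
    then have "{a..<b} \<in> null_sets lborel"
      by (subst AE_iff_null_sets) simp_all
    then have "emeasure lborel {a..<b} = 0" by (rule null_setsD1)
    then show False using assms(2) by simp
  qed
  then show ?thesis by (simp add: emeasure_eq_measure measure_le_0_iff zero_less_measure_iff)
qed

lemma measure_gauss_atMost_pos:
  assumes "0 < \<sigma>" shows "0 < measure (gauss \<mu> \<sigma>) {..c}"
proof -
  interpret prob_space "gauss \<mu> \<sigma>" using assms(1) by (rule prob_space_normal_density)
  have "measure (gauss \<mu> \<sigma>) {c - 1..<c} \<le> measure (gauss \<mu> \<sigma>) {..c}"
    by (intro finite_measure_mono) auto
  with measure_gauss_Ico_pos[OF assms, of "c - 1" c \<mu>] show ?thesis by simp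
qed

lemma integrable_payoff:
  assumes "0 < \<sigma>" "0 \<le> q" "q < 1" and [measurable]: "Measurable.pred borel S"
  shows "integrable (Psi \<sigma> \<mu>1 \<mu>2 \<gamma>) (payoff q \<kappa> S)"
proof (rule Bochner_Integration.integrable_bound)
  show "integrable (Psi \<sigma> \<mu>1 \<mu>2 \<gamma>)
     (\<lambda>p. \<bar>case p of (x, y) \<Rightarrow> 0 + 1 * x + 0 * y\<bar> + 2 * \<bar>case p of (x, y) \<Rightarrow> 0 + 0 * x + 1 * y\<bar> + \<bar>case p of (x, y) \<Rightarrow> \<kappa> + 0 * x + 0 * y\<bar>)"
    by (intro Bochner_Integration.integrable_add integrable_mult_right integrable_abs integrable_Psi_affine assms)
  show "payoff q \<kappa> S \<in> borel_measurable (Psi \<sigma> \<mu>1 \<mu>2 \<gamma>)"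
    unfolding payoff_def u1_def u2_def measurable_cong_sets[OF sets_Psi refl] by (subst borel_prod[symmetric]) measurable
  show "AE p in Psi \<sigma> \<mu>1 \<mu>2 \<gamma>. norm (payoff q \<kappa> S p) \<le>
    norm (\<bar>case p of (x, y) \<Rightarrow> 0 + 1 * x + 0 * y\<bar> + 2 * \<bar>case p of (x, y) \<Rightarrow> 0 + 0 * x + 1 * y\<bar> + \<bar>case p of (x, y) \<Rightarrow> \<kappa> + 0 * x + 0 * y\<bar>)"
  proof (intro AE_I2)
    fix p :: "real \<times> real"
    obtain x y where p: "p = (x, y)" by (cases p)
    have "\<bar>q * max x y\<bar> \<le> \<bar>x\<bar> + \<bar>y\<bar>"
      using mult_mono[of q 1 "\<bar>max x y\<bar>" "\<bar>x\<bar> + \<bar>y\<bar>"] assms by (simp add: abs_mult max_def)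
    moreover have "\<bar>(1 - q) * y\<bar> \<le> \<bar>y\<bar>"
      using mult_right_mono[of "1 - q" 1 "\<bar>y\<bar>"] assms by (simp add: abs_mult)
    moreover have tri: "\<bar>a + b - \<kappa>\<bar> \<le> \<bar>a\<bar> + \<bar>b\<bar> + \<bar>\<kappa>\<bar>" for a b :: real by linarith
    moreover note tri[of "q * max x y" "(1 - q) * y"]
    ultimately have "\<bar>q * max x y + (1 - q) * y - \<kappa>\<bar> \<le> \<bar>x\<bar> + 2 * \<bar>y\<bar> + \<bar>\<kappa>\<bar>" by linarith
    then show "norm (payoff q \<kappa> S p) \<le>
      norm (\<bar>case p of (x, y) \<Rightarrow> 0 + 1 * x + 0 * y\<bar> + 2 * \<bar>case p of (x, y) \<Rightarrow> 0 + 0 * x + 1 * y\<bar> + \<bar>case p of (x, y) \<Rightarrow> \<kappa> + 0 * x + 0 * y\<bar>)"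
      by (auto simp: p payoff_def u1_def u2_def)
  qed
qed

text \<open>The two strategies disagree only for first draws in \<open>{a..<b}\<close>, where the
  lower threshold stops and the higher one continues.\<close>

lemma payoff_threshold_diff:
  assumes "0 < \<sigma>" "0 \<le> q" "q < 1" "a \<le> b"
  shows "integral\<^sup>L (Psi \<sigma> \<mu>1 \<mu>2 \<gamma>) (payoff q \<kappa> (\<lambda>x. a \<le> x)) - integral\<^sup>L (Psi \<sigma> \<mu>1 \<mu>2 \<gamma>) (payoff q \<kappa> (\<lambda>x. b \<le> x))
     = (\<integral>x. indicator {a..<b} x * gap q \<kappa> \<sigma> ((1 + \<gamma>) * x - (\<mu>2 + \<gamma> * \<mu>1)) \<partial>gauss \<mu>1 \<sigma>)"
proof -
  interpret Z: prob_space "gauss 0 \<sigma>" using assms(1) by (rule prob_space_normal_density)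
  have i: "integrable (Psi \<sigma> \<mu>1 \<mu>2 \<gamma>) (payoff q \<kappa> (\<lambda>x. c \<le> x))" for c
    by (intro integrable_payoff assms) simp
  have u: "integrable (gauss 0 \<sigma>) (\<lambda>z. u2 q \<kappa> x (m + z))" for x m
  proof -
    have "(\<lambda>z. u2 q \<kappa> x (m + z)) = (\<lambda>z. (m - \<kappa>) + (1 - q) * z + q * max (x - m) z)"
      by (auto simp: u2_def max_def algebra_simps)
    then show ?thesis
      using integrable_gauss_id[OF assms(1), of 0] integrable_gauss_max[OF assms(1), of 0 "x - m"] by simp
  qed
  have "integral\<^sup>L (Psi \<sigma> \<mu>1 \<mu>2 \<gamma>) (payoff q \<kappa> (\<lambda>x. a \<le> x)) - integral\<^sup>L (Psi \<sigma> \<mu>1 \<mu>2 \<gamma>) (payoff q \<kappa> (\<lambda>x. b \<le> x))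
    = (\<integral>p. payoff q \<kappa> (\<lambda>x. a \<le> x) p - payoff q \<kappa> (\<lambda>x. b \<le> x) p \<partial>Psi \<sigma> \<mu>1 \<mu>2 \<gamma>)"
    using i by simp
  also have "\<dots> = (\<integral>x. \<integral>z. payoff q \<kappa> (\<lambda>x. a \<le> x) (x, \<mu>2 - \<gamma> * (x - \<mu>1) + z)
      - payoff q \<kappa> (\<lambda>x. b \<le> x) (x, \<mu>2 - \<gamma> * (x - \<mu>1) + z) \<partial>gauss 0 \<sigma> \<partial>gauss \<mu>1 \<sigma>)"
    by (intro integral_Psi assms Bochner_Integration.integrable_diff i)
  also have "\<dots> = (\<integral>x. indicator {a..<b} x * gap q \<kappa> \<sigma> ((1 + \<gamma>) * x - (\<mu>2 + \<gamma> * \<mu>1)) \<partial>gauss \<mu>1 \<sigma>)"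
  proof (intro Bochner_Integration.integral_cong refl)
    fix x
    let ?m = "\<mu>2 - \<gamma> * (x - \<mu>1)"
    have "(\<integral>z. payoff q \<kappa> (\<lambda>x. a \<le> x) (x, ?m + z) - payoff q \<kappa> (\<lambda>x. b \<le> x) (x, ?m + z) \<partial>gauss 0 \<sigma>)
      = (\<integral>z. indicator {a..<b} x * (x - u2 q \<kappa> x (?m + z)) \<partial>gauss 0 \<sigma>)"
      using assms(4) by (intro Bochner_Integration.integral_cong) (auto simp: payoff_def u1_def indicator_def)
    also have "\<dots> = indicator {a..<b} x * (x - (x - gap q \<kappa> \<sigma> (x - ?m)))"
      using u[of x ?m] integral_u2[OF assms(1), of q \<kappa> x ?m] Z.prob_space by simp
    also have "x - ?m = (1 + \<gamma>) * x - (\<mu>2 + \<gamma> * \<mu>1)" by (simp add: algebra_simps)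
    finally show "(\<integral>z. payoff q \<kappa> (\<lambda>x. a \<le> x) (x, ?m + z) - payoff q \<kappa> (\<lambda>x. b \<le> x) (x, ?m + z) \<partial>gauss 0 \<sigma>)
      = indicator {a..<b} x * gap q \<kappa> \<sigma> ((1 + \<gamma>) * x - (\<mu>2 + \<gamma> * \<mu>1))" by simp
  qed
  finally show ?thesis .
qed

lemma gap_mono:
  assumes "0 < \<sigma>" "0 \<le> q" "q < 1" "y \<le> y'" shows "gap q \<kappa> \<sigma> y \<le> gap q \<kappa> \<sigma> y'"
proof -
  have "0 \<le> (1 - q) * (y' - y)" using assms by simp
  then show ?thesis using gap_slope(1)[OF assms(1,2,4), of \<kappa>] by linarith
qed

lemma integrable_gap:
  assumes "0 < \<sigma>" "0 \<le> q" "q < 1"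
  shows "integrable (gauss \<mu> \<sigma>) (\<lambda>x. indicator {a..<b} x * gap q \<kappa> \<sigma> (c * x - d))"
proof -
  interpret prob_space "gauss \<mu> \<sigma>" using assms(1) by (rule prob_space_normal_density)
  note [measurable] = borel_measurable_gap[OF assms]
  have "integrable (gauss \<mu> \<sigma>) (\<lambda>x. gap q \<kappa> \<sigma> (c * x - d))"
  proof (rule Bochner_Integration.integrable_bound)
    show "integrable (gauss \<mu> \<sigma>) (\<lambda>x. \<bar>gap q \<kappa> \<sigma> 0\<bar> + \<bar>c * x - d\<bar>)"
      using integrable_gauss_id[OF assms(1), of \<mu>]
      by (intro Bochner_Integration.integrable_add integrable_abs Bochner_Integration.integrable_diff integrable_mult_right) simp_all
    show "AE x in gauss \<mu> \<sigma>. norm (gap q \<kappa> \<sigma> (c * x - d)) \<le> norm (\<bar>gap q \<kappa> \<sigma> 0\<bar> + \<bar>c * x - d\<bar>)"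
      using gap_lipschitz[OF assms, of \<kappa> _ 0] by (intro AE_I2) (smt (verit) real_norm_def)
  qed measurable
  then have "integrable (gauss \<mu> \<sigma>) (\<lambda>x. gap q \<kappa> \<sigma> (c * x - d) * indicator {a..<b} x)"
    by (rule integrable_real_mult_indicator[rotated]) simp
  then show ?thesis by (simp add: mult.commute)
qed

text \<open>If the gap at the threshold were nonzero, it would keep its sign on a short interval
  next to \<open>c\<close>, and moving the threshold to the far end of that interval would strictly
  raise the payoff, since the interval has positive probability.\<close>

lemma optimal_threshold_indifference:
  assumes "0 < \<sigma>" "0 \<le> q" "q < 1" "- 1 < \<gamma>"
    and opt: "optimal_strategy q \<kappa> (Psi \<sigma> \<mu>1 \<mu>2 \<gamma>) (\<lambda>x. c \<le> x)"
  shows "gap q \<kappa> \<sigma> ((1 + \<gamma>) * c - (\<mu>2 + \<gamma> * \<mu>1)) = 0"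
proof -
  interpret prob_space "gauss \<mu>1 \<sigma>" using assms(1) by (rule prob_space_normal_density)
  define g where "g x = gap q \<kappa> \<sigma> ((1 + \<gamma>) * x - (\<mu>2 + \<gamma> * \<mu>1))" for x
  have mono: "g x \<le> g y" if "x \<le> y" for x y
    unfolding g_def using assms that by (intro gap_mono) (auto intro: mult_left_mono)
  have int: "integrable (gauss \<mu>1 \<sigma>) (\<lambda>x. indicator {a..<b} x * g x)" for a b
    unfolding g_def by (intro integrable_gap assms)
  have int': "integrable (gauss \<mu>1 \<sigma>) (\<lambda>x. indicator {a..<b} x * k)" for a b k :: real
    by (intro integrable_mult_left integrable_real_indicator) (simp_all add: emeasure_eq_measure)
  have const: "(\<integral>x. indicator {a..<b} x * k \<partial>gauss \<mu>1 \<sigma>) = measure (gauss \<mu>1 \<sigma>) {a..<b} * k" for a b k :: real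
    by (subst integral_mult_left_zero, subst Bochner_Integration.integral_indicator) simp
  have lip: "\<bar>g x - g y\<bar> \<le> (1 + \<gamma>) * \<bar>x - y\<bar>" for x y
    using gap_lipschitz[OF assms(1-3), of \<kappa> "(1 + \<gamma>) * x - (\<mu>2 + \<gamma> * \<mu>1)" "(1 + \<gamma>) * y - (\<mu>2 + \<gamma> * \<mu>1)"] assms(4)
    by (simp add: g_def right_diff_distrib[symmetric] abs_mult)
  have opt': "integral\<^sup>L (Psi \<sigma> \<mu>1 \<mu>2 \<gamma>) (payoff q \<kappa> (\<lambda>x. b \<le> x)) \<le> integral\<^sup>L (Psi \<sigma> \<mu>1 \<mu>2 \<gamma>) (payoff q \<kappa> (\<lambda>x. c \<le> x))" for b
    using opt unfolding optimal_strategy_def by auto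
  have below: "(\<integral>x. indicator {b..<c} x * g x \<partial>gauss \<mu>1 \<sigma>) \<le> 0" if "b \<le> c" for b
    using payoff_threshold_diff[OF assms(1-3) that, of \<mu>1 \<mu>2 \<gamma> \<kappa>] opt'[of b] by (simp add: g_def)
  have above: "(\<integral>x. indicator {c..<b} x * g x \<partial>gauss \<mu>1 \<sigma>) \<ge> 0" if "c \<le> b" for b
    using payoff_threshold_diff[OF assms(1-3) that, of \<mu>1 \<mu>2 \<gamma> \<kappa>] opt'[of b] by (simp add: g_def)
  \<comment> \<open>As \<open>g\<close> has Lipschitz constant \<open>1 + \<gamma>\<close>, it
    changes by at most half of \<open>\<bar>g c\<bar>\<close> over this distance.\<close>
  define \<epsilon> where "\<epsilon> = \<bar>g c\<bar> / (2 * (1 + \<gamma>))"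
  have eps: "(1 + \<gamma>) * \<epsilon> = \<bar>g c\<bar> / 2" using assms(4) by (simp add: \<epsilon>_def field_simps)
  have "g c = 0"
  proof (rule ccontr)
    assume ne: "g c \<noteq> 0"
    then have \<epsilon>: "0 < \<epsilon>" using assms(4) by (simp add: \<epsilon>_def)
    show False
    proof (cases "0 < g c")
      case True
      have "g c / 2 \<le> g (c - \<epsilon>)" using abs_le_D1[OF lip[of c "c - \<epsilon>"]] eps \<epsilon> True by simp
      then have "(\<integral>x. indicator {c - \<epsilon>..<c} x * (g c / 2) \<partial>gauss \<mu>1 \<sigma>) \<le> (\<integral>x. indicator {c - \<epsilon>..<c} x * g x \<partial>gauss \<mu>1 \<sigma>)"
        using mono[of "c - \<epsilon>"] by (intro integral_mono int int') (auto simp: indicator_def intro: order_trans)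
      also have "\<dots> \<le> 0" using below[of "c - \<epsilon>"] \<epsilon> by simp
      finally show False
        using measure_gauss_Ico_pos[OF assms(1), of "c - \<epsilon>" c \<mu>1] \<epsilon> True
        unfolding const by (simp add: mult_le_0_iff)
    next
      case False
      then have neg: "g c < 0" using ne by simp
      have "g (c + \<epsilon>) \<le> g c / 2" using abs_le_D1[OF lip[of "c + \<epsilon>" c]] eps \<epsilon> neg by simp
      then have up: "g x \<le> g c / 2" if "x < c + \<epsilon>" for x
        using mono[of x "c + \<epsilon>"] that by linarith
      have "(\<integral>x. indicator {c..<c + \<epsilon>} x * g x \<partial>gauss \<mu>1 \<sigma>) \<le> (\<integral>x. indicator {c..<c + \<epsilon>} x * (g c / 2) \<partial>gauss \<mu>1 \<sigma>)"
        using up by (intro integral_mono int int') (auto simp: indicator_def)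
      moreover have "0 \<le> (\<integral>x. indicator {c..<c + \<epsilon>} x * g x \<partial>gauss \<mu>1 \<sigma>)" using above[of "c + \<epsilon>"] \<epsilon> by simp
      ultimately have "0 \<le> (\<integral>x. indicator {c..<c + \<epsilon>} x * (g c / 2) \<partial>gauss \<mu>1 \<sigma>)" by linarith
      then show False
        using measure_gauss_Ico_pos[OF assms(1), of c "c + \<epsilon>" \<mu>1] \<epsilon> neg
        unfolding const by (simp add: zero_le_mult_iff)
    qed
  qed
  then show ?thesis by (simp add: g_def)
qed

section \<open>Truncated Gaussian means\<close>

lemma truncated_moment_shift:
  assumes "0 < \<sigma>"
  shows "(\<integral>x. indicator {..c + d} x * (x - (e + d)) \<partial>gauss \<mu> \<sigma>) = (\<integral>x. indicator {..c} x * (x - e) \<partial>gauss (\<mu> - d) \<sigma>)"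
proof -
  have "(\<integral>x. indicator {..c + d} x * (x - (e + d)) \<partial>gauss \<mu> \<sigma>) =
    (\<integral>z. indicator {..c + d} (\<mu> + z) * (\<mu> + z - (e + d)) \<partial>gauss 0 \<sigma>)"
    by (subst gauss_shift[symmetric], subst integral_distr) simp_all
  also have "\<dots> = (\<integral>z. indicator {..c} ((\<mu> - d) + z) * ((\<mu> - d) + z - e) \<partial>gauss 0 \<sigma>)"
    by (intro Bochner_Integration.integral_cong) (auto simp: indicator_def)
  also have "\<dots> = (\<integral>x. indicator {..c} x * (x - e) \<partial>gauss (\<mu> - d) \<sigma>)"
    by (subst gauss_shift[symmetric, of "\<mu> - d"], subst integral_distr) simp_all
  finally show ?thesis .
qed

lemma integrable_truncated:
  assumes "0 < \<sigma>" "A \<in> sets borel"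
  shows "integrable (gauss \<mu> \<sigma>) (\<lambda>x. indicator A x * (x - e))"
proof -
  interpret prob_space "gauss \<mu> \<sigma>" using assms(1) by (rule prob_space_normal_density)
  have "integrable (gauss \<mu> \<sigma>) (\<lambda>x. (x - e) * indicator A x)"
    using integrable_gauss_id[OF assms(1), of \<mu>] assms(2)
    by (intro integrable_real_mult_indicator Bochner_Integration.integrable_diff) simp_all
  then show ?thesis by (simp add: mult.commute)
qed

text \<open>Moving the mean of a normal law by \<open>- d\<close> multiplies its density by a monotone weight \<open>w\<close>,
  and \<open>(x - e) (w x - w e)\<close> has a constant sign.\<close>

lemma truncated_moment_tilt:
  assumes "0 < \<sigma>" and J: "(\<integral>x. indicator {..c} x * (x - e) \<partial>gauss \<mu> \<sigma>) = 0"
  shows "0 \<le> d \<Longrightarrow> (\<integral>x. indicator {..c} x * (x - e) \<partial>gauss (\<mu> - d) \<sigma>) \<le> 0"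
    and "d \<le> 0 \<Longrightarrow> 0 \<le> (\<integral>x. indicator {..c} x * (x - e) \<partial>gauss (\<mu> - d) \<sigma>)"
proof -
  define w where "w x = exp (- (d * (x - \<mu>) + d\<^sup>2 / 2) / \<sigma>\<^sup>2)" for x
  have w: "normal_density (\<mu> - d) \<sigma> x = normal_density \<mu> \<sigma> x * w x" for x
  proof -
    have "- (x - (\<mu> - d))\<^sup>2 / (2 * \<sigma>\<^sup>2) = - (x - \<mu>)\<^sup>2 / (2 * \<sigma>\<^sup>2) + - (d * (x - \<mu>) + d\<^sup>2 / 2) / \<sigma>\<^sup>2"
      using assms(1) by (simp add: field_simps power2_eq_square)
    then show ?thesis by (simp add: normal_density_def w_def exp_add[symmetric])
  qed
  define f where "f x = indicator {..c} x * (x - e)" for x :: real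
  have f[measurable]: "f \<in> borel_measurable borel" by (simp add: f_def[abs_def])
  have int: "integrable lborel (\<lambda>x. normal_density m \<sigma> x * f x)" for m
    using integrable_truncated[OF assms(1), of "{..c}" m e, simplified]
    by (subst (asm) integrable_real_density) (simp_all add: f_def)
  have eq: "(\<integral>x. indicator {..c} x * (x - e) \<partial>gauss m \<sigma>) = (\<integral>x. normal_density m \<sigma> x * f x \<partial>lborel)" for m
    by (subst integral_real_density) (simp_all add: f_def)
  \<comment> \<open>The moment vanishes under the mean \<mu>, so a constant multiple of it may be
    subtracted at no cost; after that the comparison is pointwise.\<close>
  have zero: "(\<integral>x. w e * (normal_density \<mu> \<sigma> x * f x) \<partial>lborel) = 0"
    using J eq[of \<mu>] by simp
  { assume d: "0 \<le> d"
    have "(\<integral>x. normal_density (\<mu> - d) \<sigma> x * f x \<partial>lborel) \<le> (\<integral>x. w e * (normal_density \<mu> \<sigma> x * f x) \<partial>lborel)"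
    proof (intro integral_mono int integrable_mult_right)
      fix x
      have "w x * f x \<le> w e * f x"
      proof (cases "e \<le> x")
        case True
        then have "w x \<le> w e" using d assms(1) unfolding w_def
          by (auto intro!: divide_right_mono mult_left_mono)
        moreover have "0 \<le> f x" using True by (simp add: f_def)
        ultimately show ?thesis by (rule mult_right_mono)
      next
        case False
        then have "w e \<le> w x" using d assms(1) unfolding w_def
          by (auto intro!: divide_right_mono mult_left_mono)
        moreover have "f x \<le> 0" using False by (auto simp: f_def mult_le_0_iff)
        ultimately show ?thesis by (rule mult_right_mono_neg)
      qed
      from mult_left_mono[OF this normal_density_nonneg[of \<mu> \<sigma> x]]
      show "normal_density (\<mu> - d) \<sigma> x * f x \<le> w e * (normal_density \<mu> \<sigma> x * f x)"
        by (simp add: w mult_ac)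
    qed
    then show "(\<integral>x. indicator {..c} x * (x - e) \<partial>gauss (\<mu> - d) \<sigma>) \<le> 0"
      using zero eq[of "\<mu> - d"] by linarith }
  { assume d: "d \<le> 0"
    have "(\<integral>x. w e * (normal_density \<mu> \<sigma> x * f x) \<partial>lborel) \<le> (\<integral>x. normal_density (\<mu> - d) \<sigma> x * f x \<partial>lborel)"
    proof (intro integral_mono int integrable_mult_right)
      fix x
      have "w e * f x \<le> w x * f x"
      proof (cases "e \<le> x")
        case True
        then have "w e \<le> w x" using d assms(1) unfolding w_def
          by (auto intro!: divide_right_mono mult_left_mono_neg)
        moreover have "0 \<le> f x" using True by (simp add: f_def)
        ultimately show ?thesis by (rule mult_right_mono)
      next
        case False
        then have "w x \<le> w e" using d assms(1) unfolding w_def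
          by (auto intro!: divide_right_mono mult_left_mono_neg)
        moreover have "f x \<le> 0" using False by (auto simp: f_def mult_le_0_iff)
        ultimately show ?thesis by (rule mult_right_mono_neg)
      qed
      from mult_left_mono[OF this normal_density_nonneg[of \<mu> \<sigma> x]]
      show "w e * (normal_density \<mu> \<sigma> x * f x) \<le> normal_density (\<mu> - d) \<sigma> x * f x"
        by (simp add: w mult_ac)
    qed
    then show "0 \<le> (\<integral>x. indicator {..c} x * (x - e) \<partial>gauss (\<mu> - d) \<sigma>)"
      using zero eq[of "\<mu> - d"] by linarith }
qed

text \<open>Divided by \<open>measure (gauss \<mu> \<sigma>) {..c}\<close>, this says that the mean
  of a normal variable conditioned on lying below \<open>c\<close> differs from its value
  \<open>e\<close> at \<open>b\<close> by at most \<open>\<bar>c - b\<bar>\<close>. Moving the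
  cutoff and the centre together by \<open>c - b\<close> is the same as moving the law the other
  way, and the sign of the moment after such a move is known from tilting. The undivided form is the
  one that can be summed over rounds.\<close>

lemma truncated_moment_lipschitz:
  assumes "0 < \<sigma>" and J: "(\<integral>x. indicator {..b} x * (x - e) \<partial>gauss \<mu> \<sigma>) = 0"
  shows "\<bar>\<integral>x. indicator {..c} x * (x - e) \<partial>gauss \<mu> \<sigma>\<bar> \<le> \<bar>c - b\<bar> * measure (gauss \<mu> \<sigma>) {..c}"
proof -
  interpret prob_space "gauss \<mu> \<sigma>" using assms(1) by (rule prob_space_normal_density)
  define J where "J a = (\<integral>x. indicator {..a} x * (x - e) \<partial>gauss \<mu> \<sigma>)" for a
  have int: "integrable (gauss \<mu> \<sigma>) (\<lambda>x. indicator A x * (x - u))" if "A \<in> sets borel" for A u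
    by (rule integrable_truncated[OF assms(1) that])
  have Jb: "J b = 0" using J by (simp add: J_def)
  have inc: "J b' = J a + (\<integral>x. indicator {a<..b'} x * (x - e) \<partial>gauss \<mu> \<sigma>)" if "a \<le> b'" for a b'
  proof -
    have "(\<lambda>x. indicator {..b'} x * (x - e)) = (\<lambda>x. indicator {..a} x * (x - e) + indicator {a<..b'} x * (x - e))"
      using that by (auto simp: indicator_def)
    then show ?thesis unfolding J_def by (subst Bochner_Integration.integral_add[symmetric]) (auto intro: int)
  qed
  \<comment> \<open>A mean over values up to \<open>b\<close> cannot exceed \<open>b\<close>. This
    fixes the sign of the integrand between \<open>b\<close> and \<open>c\<close> and thus the other
    half of each absolute value.\<close>
  have eb: "e \<le> b"
  proof (rule ccontr)
    assume "\<not> e \<le> b"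
    have "J b \<le> (\<integral>x. indicator {..b} x * (b - e) \<partial>gauss \<mu> \<sigma>)"
      unfolding J_def
      by (intro integral_mono int integrable_mult_left integrable_real_indicator)
         (auto simp: indicator_def emeasure_eq_measure)
    also have "\<dots> = (b - e) * measure (gauss \<mu> \<sigma>) {..b}"
    proof -
      have "(\<integral>x. indicator {..b} x * (b - e) \<partial>gauss \<mu> \<sigma>) = (\<integral>x. indicator {..b} x \<partial>gauss \<mu> \<sigma>) * (b - e)"
        by (rule integral_mult_left_zero)
      also have "(\<integral>x. indicator {..b} x \<partial>gauss \<mu> \<sigma>) = measure (gauss \<mu> \<sigma>) {..b}"
        by (subst Bochner_Integration.integral_indicator) simp
      finally show ?thesis by (simp add: mult.commute)
    qed
    also have "\<dots> < 0" using \<open>\<not> e \<le> b\<close> measure_gauss_atMost_pos[OF assms(1)] by (intro mult_neg_pos) auto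
    finally show False using Jb by simp
  qed
  have [simp]: "integrable (gauss \<mu> \<sigma>) (indicat_real {..c})"
    by (intro integrable_real_indicator) (simp_all add: emeasure_eq_measure)
  define d where "d = c - b"
  have "(\<integral>x. indicator {..c} x * (x - (e + d)) \<partial>gauss \<mu> \<sigma>) = (\<integral>x. indicator {..c} x * (x - e) - indicator {..c} x * d \<partial>gauss \<mu> \<sigma>)"
    by (intro Bochner_Integration.integral_cong) (auto simp: algebra_simps)
  also have "\<dots> = J c - d * measure (gauss \<mu> \<sigma>) {..c}"
    unfolding J_def by (subst Bochner_Integration.integral_diff) (auto intro: int)
  finally have shift: "J c - d * measure (gauss \<mu> \<sigma>) {..c} = (\<integral>x. indicator {..b} x * (x - e) \<partial>gauss (\<mu> - d) \<sigma>)"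
    using truncated_moment_shift[OF assms(1), where c = b and d = d and e = e and \<mu> = \<mu>] by (simp add: d_def)
  show ?thesis
  proof (cases "b \<le> c")
    case True
    have "J c \<le> d * measure (gauss \<mu> \<sigma>) {..c}"
      using truncated_moment_tilt(1)[OF assms, of d] shift True by (simp add: d_def)
    moreover have "0 \<le> J c"
      unfolding inc[OF True] Jb using eb
      by (auto intro!: Bochner_Integration.integral_nonneg simp: indicator_def)
    ultimately show ?thesis using True by (simp add: J_def d_def)
  next
    case False
    have "d * measure (gauss \<mu> \<sigma>) {..c} \<le> J c"
      using truncated_moment_tilt(2)[OF assms, of d] shift False by (simp add: d_def)
    \<comment> \<open>Up to \<open>e\<close> the integrand is nonpositive. Beyond \<open>e\<close>,
      the piece from \<open>c\<close> to \<open>b\<close> is nonnegative, and adding it to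
      \<open>J c\<close> gives \<open>J b = 0\<close>.\<close>
    moreover have "J c \<le> 0"
    proof (cases "c \<le> e")
      case True
      have "0 \<le> (\<integral>x. - (indicator {..c} x * (x - e)) \<partial>gauss \<mu> \<sigma>)"
        using True by (intro Bochner_Integration.integral_nonneg) (auto simp: indicator_def)
      then show ?thesis by (simp add: J_def)
    next
      case c: False
      have "0 \<le> (\<integral>x. indicator {c<..b} x * (x - e) \<partial>gauss \<mu> \<sigma>)"
        using c by (intro Bochner_Integration.integral_nonneg) (auto simp: indicator_def)
      then show ?thesis using inc[of c b] False Jb by simp
    qed
    ultimately show ?thesis using False by (simp add: J_def d_def algebra_simps)
  qed
qed

section \<open>Divergence-minimizing means\<close>

abbreviation option_space :: "real option measure" where
  "option_space \<equiv> sigma UNIV {A. Some -` A \<in> sets borel}"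

text \<open>The generating family is already closed under complements and countable unions, so
  membership of a set can be read off from its preimage under \<open>Some\<close>.\<close>

lemma sets_option_space: "sets option_space = {A. Some -` A \<in> sets borel}"
proof -
  have "sigma_algebra UNIV {A :: real option set. Some -` A \<in> sets borel}"
    unfolding sigma_algebra_iff2
  proof (intro conjI ballI allI impI)
    fix A :: "real option set" assume "A \<in> {A. Some -` A \<in> sets borel}"
    then have "UNIV - Some -` A \<in> sets borel" by auto
    then show "UNIV - A \<in> {A. Some -` A \<in> sets borel}" by (simp add: vimage_Diff)
  next
    fix A :: "nat \<Rightarrow> real option set" assume "range A \<subseteq> {A. Some -` A \<in> sets borel}"
    then have "(\<Union>i. Some -` A i) \<in> sets borel" by (intro sets.countable_UN) auto
    then show "(\<Union>i. A i) \<in> {A. Some -` A \<in> sets borel}" by (simp add: vimage_UN)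
  qed auto
  then show ?thesis by (simp add: sigma_algebra.sigma_sets_eq)
qed

lemma measurable_history [measurable]:
  assumes [measurable]: "Measurable.pred borel S"
  shows "history S \<in> borel \<rightarrow>\<^sub>M history_space"
proof -
  have "(\<lambda>p. if S (fst p) then None else Some (snd p)) \<in> borel \<Otimes>\<^sub>M borel \<rightarrow>\<^sub>M option_space"
  proof (rule measurableI)
    fix A assume "A \<in> sets option_space"
    then have [measurable]: "Some -` A \<in> sets borel" by (simp add: sets_option_space)
    have "(\<lambda>p. if S (fst p) then None else Some (snd p)) -` A \<inter> space (borel \<Otimes>\<^sub>M borel) =
      {p \<in> space (borel \<Otimes>\<^sub>M borel). if S (fst p) then None \<in> A else snd p \<in> Some -` A}"
      by auto
    also have "\<dots> \<in> sets (borel \<Otimes>\<^sub>M borel)" by measurable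
    finally show "(\<lambda>p. if S (fst p) then None else Some (snd p)) -` A \<inter> space (borel \<Otimes>\<^sub>M borel) \<in> sets (borel \<Otimes>\<^sub>M borel)" .
  qed simp
  then have "(\<lambda>p. (fst p, if S (fst p) then None else Some (snd p))) \<in> borel \<Otimes>\<^sub>M borel \<rightarrow>\<^sub>M history_space"
    unfolding history_space_def by measurable
  moreover have "history S = (\<lambda>p. (fst p, if S (fst p) then None else Some (snd p)))"
    by (auto simp: history_def)
  ultimately show ?thesis by (simp add: borel_prod)
qed

lemma borel_measurable_case_history:
  fixes g :: "real \<Rightarrow> real \<Rightarrow> real"
  assumes [measurable]: "f \<in> borel_measurable borel" "(\<lambda>p. g (fst p) (snd p)) \<in> borel_measurable (borel \<Otimes>\<^sub>M borel)"
  shows "(\<lambda>h. case h of (x, None) \<Rightarrow> f x | (x, Some y) \<Rightarrow> g x y) \<in> borel_measurable history_space"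
proof -
  have [measurable]: "the \<in> option_space \<rightarrow>\<^sub>M borel"
    by (rule measurableI) (simp_all add: sets_option_space vimage_def)
  have [measurable]: "Measurable.pred option_space (\<lambda>o'. o' = None)"
    by (simp add: pred_def sets_option_space vimage_def)
  have "(\<lambda>h. if snd h = None then f (fst h) else (\<lambda>p. g (fst p) (snd p)) (fst h, the (snd h)))
      \<in> borel_measurable (borel \<Otimes>\<^sub>M option_space)"
    by measurable
  also have "(\<lambda>h. if snd h = None then f (fst h) else (\<lambda>p. g (fst p) (snd p)) (fst h, the (snd h))) =
      (\<lambda>h. case h of (x, None) \<Rightarrow> f x | (x, Some y) \<Rightarrow> g x y)"
    by (auto split: option.split)
  finally show ?thesis by (simp add: history_space_def)
qed

text \<open>Both models share the law \<mu> of the first draw, so a stopped history carries no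
  information on the difference and has ratio one; a continued history has the ratio of the
  conditional densities of the second draw.\<close>

lemma history_law_density:
  fixes \<nu> r \<mu> m \<gamma> :: real
  assumes "0 < \<sigma>" and S[measurable]: "Measurable.pred borel S"
  defines "\<rho> \<equiv> \<lambda>h. case h of (x, None) \<Rightarrow> 1
    | (x, Some y) \<Rightarrow> normal_density (\<nu> - r * (x - \<mu>)) \<sigma> y / normal_density (m - \<gamma> * (x - \<mu>)) \<sigma> y"
  shows "history_law (Psi \<sigma> \<mu> \<nu> r) S = density (history_law (Psi \<sigma> \<mu> m \<gamma>) S) (\<lambda>h. ennreal (\<rho> h))"
    and "\<rho> \<in> borel_measurable history_space"
proof -
  show \<rho>[measurable]: "\<rho> \<in> borel_measurable history_space"
    unfolding \<rho>_def
    by (intro borel_measurable_case_history) (simp_all add: normal_density_def)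
  have H[measurable]: "history S \<in> Psi \<sigma> \<mu>1 \<mu>2 \<gamma>' \<rightarrow>\<^sub>M history_space" for \<mu>1 \<mu>2 \<gamma>'
    using measurable_history[OF S] by (simp add: measurable_cong_sets[OF sets_Psi refl])
  show "history_law (Psi \<sigma> \<mu> \<nu> r) S = density (history_law (Psi \<sigma> \<mu> m \<gamma>) S) (\<lambda>h. ennreal (\<rho> h))"
    (is "?L = ?R")
  proof (rule measure_eqI)
    show "sets ?L = sets ?R" by (simp add: history_law_def)
    fix A assume "A \<in> sets ?L"
    then have A[measurable]: "A \<in> sets history_space" by (simp add: history_law_def)
    have m1: "(\<lambda>p. indicator A (history S p) :: ennreal) \<in> borel_measurable borel" by measurable
    have m2: "(\<lambda>p. ennreal (\<rho> (history S p)) * indicator A (history S p)) \<in> borel_measurable borel" by measurable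
    have P[measurable]: "Pair x \<in> borel \<rightarrow>\<^sub>M (borel :: (real \<times> real) measure)" for x :: real
      by (subst borel_prod[symmetric]) measurable
    have "emeasure ?L A = (\<integral>\<^sup>+h. indicator A h \<partial>?L)"
      using A by (simp add: history_law_def)
    also have "\<dots> = (\<integral>\<^sup>+p. indicator A (history S p) \<partial>Psi \<sigma> \<mu> \<nu> r)"
      unfolding history_law_def by (subst nn_integral_distr) simp_all
    also have "\<dots> = (\<integral>\<^sup>+x. \<integral>\<^sup>+y. indicator A (history S (x, y)) \<partial>gauss (\<nu> - r * (x - \<mu>)) \<sigma> \<partial>gauss \<mu> \<sigma>)"
      by (rule nn_integral_Psi[OF m1])
    also have "\<dots> = (\<integral>\<^sup>+x. \<integral>\<^sup>+y. ennreal (\<rho> (history S (x, y))) * indicator A (history S (x, y)) \<partial>gauss (m - \<gamma> * (x - \<mu>)) \<sigma> \<partial>gauss \<mu> \<sigma>)"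
    proof (rule nn_integral_cong)
      fix x
      have y1: "(\<lambda>y. indicator A (history S (x, y)) :: ennreal) \<in> borel_measurable borel"
        by (rule measurable_compose[OF P m1])
      have y2: "(\<lambda>y. ennreal (\<rho> (history S (x, y))) * indicator A (history S (x, y))) \<in> borel_measurable borel"
        by (rule measurable_compose[OF P m2])
      show "(\<integral>\<^sup>+y. indicator A (history S (x, y)) \<partial>gauss (\<nu> - r * (x - \<mu>)) \<sigma>) =
        (\<integral>\<^sup>+y. ennreal (\<rho> (history S (x, y))) * indicator A (history S (x, y)) \<partial>gauss (m - \<gamma> * (x - \<mu>)) \<sigma>)"
      proof (cases "S x")
        case True
        \<comment> \<open>After stopping, the integrand is constant in \<open>y\<close>, and both
          conditional laws have total mass one.\<close>
        interpret a: prob_space "gauss (\<nu> - r * (x - \<mu>)) \<sigma>" using assms(1) by (rule prob_space_normal_density)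
        interpret b: prob_space "gauss (m - \<gamma> * (x - \<mu>)) \<sigma>" using assms(1) by (rule prob_space_normal_density)
        from True show ?thesis using a.emeasure_space_1 b.emeasure_space_1
          by (simp add: history_def \<rho>_def)
      next
        case False
        have "(\<integral>\<^sup>+y. indicator A (history S (x, y)) \<partial>gauss (\<nu> - r * (x - \<mu>)) \<sigma>) =
          (\<integral>\<^sup>+y. ennreal (normal_density (\<nu> - r * (x - \<mu>)) \<sigma> y) * indicator A (history S (x, y)) \<partial>lborel)"
          by (rule nn_integral_density) (use y1 in simp_all)
        also have "\<dots> = (\<integral>\<^sup>+y. ennreal (normal_density (m - \<gamma> * (x - \<mu>)) \<sigma> y) * (ennreal (\<rho> (history S (x, y))) * indicator A (history S (x, y))) \<partial>lborel)"
        proof (rule nn_integral_cong)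
          fix y
          have pos: "0 < normal_density (m - \<gamma> * (x - \<mu>)) \<sigma> y" by (rule normal_density_pos[OF assms(1)])
          have "\<rho> (history S (x, y)) = normal_density (\<nu> - r * (x - \<mu>)) \<sigma> y / normal_density (m - \<gamma> * (x - \<mu>)) \<sigma> y"
            using False by (simp add: history_def \<rho>_def)
          then have "ennreal (normal_density (\<nu> - r * (x - \<mu>)) \<sigma> y) =
             ennreal (normal_density (m - \<gamma> * (x - \<mu>)) \<sigma> y) * ennreal (\<rho> (history S (x, y)))"
            using pos by (simp add: ennreal_mult'[symmetric])
          then show "ennreal (normal_density (\<nu> - r * (x - \<mu>)) \<sigma> y) * indicator A (history S (x, y)) =
            ennreal (normal_density (m - \<gamma> * (x - \<mu>)) \<sigma> y) * (ennreal (\<rho> (history S (x, y))) * indicator A (history S (x, y)))"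
            by (simp add: mult.assoc)
        qed
        also have "\<dots> = (\<integral>\<^sup>+y. ennreal (\<rho> (history S (x, y))) * indicator A (history S (x, y)) \<partial>gauss (m - \<gamma> * (x - \<mu>)) \<sigma>)"
          by (rule nn_integral_density[symmetric]) (use y2 in simp_all)
        finally show ?thesis .
      qed
    qed
    also have "\<dots> = (\<integral>\<^sup>+p. ennreal (\<rho> (history S p)) * indicator A (history S p) \<partial>Psi \<sigma> \<mu> m \<gamma>)"
      by (rule nn_integral_Psi[OF m2, symmetric])
    also have "\<dots> = (\<integral>\<^sup>+h. ennreal (\<rho> h) * indicator A h \<partial>history_law (Psi \<sigma> \<mu> m \<gamma>) S)"
      unfolding history_law_def by (subst nn_integral_distr) simp_all
    also have "\<dots> = emeasure ?R A"
      by (rule emeasure_density[symmetric]) (simp_all add: history_law_def)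
    finally show "emeasure ?L A = emeasure ?R A" .
  qed
qed

text \<open>The log-ratio of two normal densities of equal variance is a difference of squared
  residuals, so the divergence becomes an integral that is explicitly quadratic in
  \<open>m\<close>.\<close>

lemma history_KL_eq:
  assumes "0 < \<sigma>" and S[measurable]: "Measurable.pred borel S"
  shows "history_KL (Psi \<sigma> \<mu> \<nu> r) (Psi \<sigma> \<mu> m \<gamma>) S =
    (\<integral>p. (if S (fst p) then 0 else ((snd p - (m - \<gamma> * (fst p - \<mu>)))\<^sup>2 - (snd p - (\<nu> - r * (fst p - \<mu>)))\<^sup>2) / (2 * \<sigma>\<^sup>2)) \<partial>Psi \<sigma> \<mu> \<nu> r)"
proof -
  define \<rho> where "\<rho> = (\<lambda>h. case h of (x, None) \<Rightarrow> 1
    | (x, Some y) \<Rightarrow> normal_density (\<nu> - r * (x - \<mu>)) \<sigma> y / normal_density (m - \<gamma> * (x - \<mu>)) \<sigma> y)"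
  note hd = history_law_density[OF assms, where \<nu> = \<nu> and r = r and \<mu> = \<mu> and m = m and \<gamma> = \<gamma>, folded \<rho>_def]
  have \<rho>m[measurable]: "\<rho> \<in> borel_measurable history_space" by (rule hd(2))
  have H[measurable]: "history S \<in> Psi \<sigma> \<mu>1 \<mu>2 \<gamma>' \<rightarrow>\<^sub>M history_space" for \<mu>1 \<mu>2 \<gamma>'
    using measurable_history[OF S] by (simp add: measurable_cong_sets[OF sets_Psi refl])
  interpret Psi: prob_space "Psi \<sigma> \<mu> m \<gamma>" by (rule prob_space_Psi[OF assms(1)])
  interpret M: prob_space "history_law (Psi \<sigma> \<mu> m \<gamma>) S"
    unfolding history_law_def by (rule Psi.prob_space_distr) measurable
  have \<rho>0: "0 \<le> \<rho> h" for h by (auto simp: \<rho>_def split: prod.split option.split)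
  have b: "1 < exp (1::real)" by simp
  have "history_KL (Psi \<sigma> \<mu> \<nu> r) (Psi \<sigma> \<mu> m \<gamma>) S =
      KL_divergence (exp 1) (history_law (Psi \<sigma> \<mu> m \<gamma>) S) (density (history_law (Psi \<sigma> \<mu> m \<gamma>) S) (\<lambda>h. ennreal (\<rho> h)))"
    unfolding history_KL_def hd(1) ..
  also have "\<dots> = (\<integral>h. \<rho> h * log (exp 1) (\<rho> h) \<partial>history_law (Psi \<sigma> \<mu> m \<gamma>) S)"
    by (rule M.KL_density[OF b]) (use \<rho>0 in \<open>simp_all add: history_law_def\<close>)
  \<comment> \<open>The factor \<rho> in front of the logarithm is absorbed as the density of the
    true law with respect to the model.\<close>
  also have "\<dots> = (\<integral>h. ln (\<rho> h) \<partial>density (history_law (Psi \<sigma> \<mu> m \<gamma>) S) (\<lambda>h. ennreal (\<rho> h)))"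
    using \<rho>0 by (subst integral_real_density) (simp_all add: history_law_def log_def)
  also have "\<dots> = (\<integral>h. ln (\<rho> h) \<partial>history_law (Psi \<sigma> \<mu> \<nu> r) S)" unfolding hd(1) ..
  also have "\<dots> = (\<integral>p. ln (\<rho> (history S p)) \<partial>Psi \<sigma> \<mu> \<nu> r)"
    unfolding history_law_def by (rule integral_distr) measurable
  also have "\<dots> = (\<integral>p. (if S (fst p) then 0 else ((snd p - (m - \<gamma> * (fst p - \<mu>)))\<^sup>2 - (snd p - (\<nu> - r * (fst p - \<mu>)))\<^sup>2) / (2 * \<sigma>\<^sup>2)) \<partial>Psi \<sigma> \<mu> \<nu> r)"
  proof (intro Bochner_Integration.integral_cong refl)
    fix p :: "real \<times> real"
    obtain x y where p: "p = (x, y)" by (cases p)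
    have "normal_density a \<sigma> y / normal_density b \<sigma> y = exp (((y - b)\<^sup>2 - (y - a)\<^sup>2) / (2 * \<sigma>\<^sup>2))" for a b
    proof -
      have "normal_density a \<sigma> y / normal_density b \<sigma> y = exp (- (y - a)\<^sup>2 / (2 * \<sigma>\<^sup>2)) / exp (- (y - b)\<^sup>2 / (2 * \<sigma>\<^sup>2))"
        using assms(1) by (simp add: normal_density_def)
      also have "\<dots> = exp (((y - b)\<^sup>2 - (y - a)\<^sup>2) / (2 * \<sigma>\<^sup>2))"
        by (simp add: exp_diff[symmetric] diff_divide_distrib)
      finally show ?thesis .
    qed
    then show "ln (\<rho> (history S p)) = (if S (fst p) then 0 else
        ((snd p - (m - \<gamma> * (fst p - \<mu>)))\<^sup>2 - (snd p - (\<nu> - r * (fst p - \<mu>)))\<^sup>2) / (2 * \<sigma>\<^sup>2))"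
      by (simp add: p \<rho>_def history_def)
  qed
  finally show ?thesis .
qed

section \<open>Moment condition at the minimum\<close>

lemma integral_Psi_indicator_affine:
  assumes "0 < \<sigma>" and A[measurable]: "A \<in> sets borel"
  shows "integrable (Psi \<sigma> \<mu> \<nu> r) (\<lambda>p. indicator A (fst p) * (snd p + \<gamma> * fst p - k))" (is ?I)
    and "(\<integral>p. indicator A (fst p) * (snd p + \<gamma> * fst p - k) \<partial>Psi \<sigma> \<mu> \<nu> r) =
      (\<integral>x. indicator A x * (\<nu> - r * (x - \<mu>) + \<gamma> * x - k) \<partial>gauss \<mu> \<sigma>)"
proof -
  interpret Z: prob_space "gauss 0 \<sigma>" using assms(1) by (rule prob_space_normal_density)
  have "integrable (Psi \<sigma> \<mu> \<nu> r) (\<lambda>p. (case p of (x, y) \<Rightarrow> - k + \<gamma> * x + 1 * y) * indicator (A \<times> UNIV) p)"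
    by (intro integrable_real_mult_indicator integrable_Psi_affine assms)
       (simp add: borel_prod[symmetric] del: borel_prod)
  also have "(\<lambda>p. (case p of (x, y) \<Rightarrow> - k + \<gamma> * x + 1 * y) * indicator (A \<times> UNIV) p) =
      (\<lambda>p. indicator A (fst p) * (snd p + \<gamma> * fst p - k))"
    by (auto simp: indicator_def)
  finally show ?I .
  note integral_Psi[OF assms(1) this]
  also have "(\<integral>x. \<integral>z. indicator A (fst (x, \<nu> - r * (x - \<mu>) + z)) * (snd (x, \<nu> - r * (x - \<mu>) + z) + \<gamma> * fst (x, \<nu> - r * (x - \<mu>) + z) - k)
      \<partial>gauss 0 \<sigma> \<partial>gauss \<mu> \<sigma>) = (\<integral>x. indicator A x * (\<nu> - r * (x - \<mu>) + \<gamma> * x - k) \<partial>gauss \<mu> \<sigma>)"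
  proof (intro Bochner_Integration.integral_cong refl)
    fix x
    have "(\<integral>z. indicator A (fst (x, \<nu> - r * (x - \<mu>) + z)) * (snd (x, \<nu> - r * (x - \<mu>) + z) + \<gamma> * fst (x, \<nu> - r * (x - \<mu>) + z) - k) \<partial>gauss 0 \<sigma>) =
      (\<integral>z. indicator A x * (\<nu> - r * (x - \<mu>) + \<gamma> * x - k) + indicator A x * z \<partial>gauss 0 \<sigma>)"
      by (intro Bochner_Integration.integral_cong) (auto simp: algebra_simps)
    also have "\<dots> = indicator A x * (\<nu> - r * (x - \<mu>) + \<gamma> * x - k)"
      using integrable_gauss_id[OF assms(1), of 0] integral_gauss_id[OF assms(1), of 0] Z.prob_space by simp
    finally show "(\<integral>z. indicator A (fst (x, \<nu> - r * (x - \<mu>) + z)) * (snd (x, \<nu> - r * (x - \<mu>) + z) + \<gamma> * fst (x, \<nu> - r * (x - \<mu>) + z) - k) \<partial>gauss 0 \<sigma>) =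
      indicator A x * (\<nu> - r * (x - \<mu>) + \<gamma> * x - k)" .
  qed
  finally show "(\<integral>p. indicator A (fst p) * (snd p + \<gamma> * fst p - k) \<partial>Psi \<sigma> \<mu> \<nu> r) =
      (\<integral>x. indicator A x * (\<nu> - r * (x - \<mu>) + \<gamma> * x - k) \<partial>gauss \<mu> \<sigma>)" .
qed

text \<open>First-order condition of a least-squares problem: the minimizing
  \<open>m + \<gamma> * \<mu>\<close> is the mean of \<open>X2 + \<gamma> * X1\<close> given
  continuation. Moving \<open>m\<close> by \<open>e\<close> changes the divergence by a quadratic in
  \<open>e\<close> without constant term, and a nonnegative one cannot have a linear term.\<close>

lemma KL_minimal_moment:
  assumes "0 < \<sigma>"
    and min: "\<And>m'. history_KL (Psi \<sigma> \<mu> \<nu> r) (Psi \<sigma> \<mu> m \<gamma>) (\<lambda>x. c \<le> x)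
            \<le> history_KL (Psi \<sigma> \<mu> \<nu> r) (Psi \<sigma> \<mu> m' \<gamma>) (\<lambda>x. c \<le> x)"
  shows "(\<integral>p. indicator {..c} (fst p) * (snd p + \<gamma> * fst p - (m + \<gamma> * \<mu>)) \<partial>Psi \<sigma> \<mu> \<nu> r) = 0"
proof -
  interpret T: prob_space "Psi \<sigma> \<mu> \<nu> r" by (rule prob_space_Psi[OF assms(1)])
  interpret X: prob_space "gauss \<mu> \<sigma>" using assms(1) by (rule prob_space_normal_density)
  define w where "w p = indicator {..<c} (fst p) * (snd p + \<gamma> * fst p - (m + \<gamma> * \<mu>))" for p :: "real \<times> real"
  define kl where "kl m' p = (if c \<le> fst p then 0 else ((snd p - (m' - \<gamma> * (fst p - \<mu>)))\<^sup>2 - (snd p - (\<nu> - r * (fst p - \<mu>)))\<^sup>2) / (2 * \<sigma>\<^sup>2))"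
    for m' :: real and p :: "real \<times> real"
  have w: "integrable (Psi \<sigma> \<mu> \<nu> r) w"
    unfolding w_def by (rule integral_Psi_indicator_affine[OF assms(1)]) simp
  have A: "{..<c} \<times> UNIV \<in> sets (Psi \<sigma> \<mu> \<nu> r)"
    by (simp add: borel_prod[symmetric] del: borel_prod)
  have kl: "integrable (Psi \<sigma> \<mu> \<nu> r) (kl m')" for m'
  proof -
    have "integrable (Psi \<sigma> \<mu> \<nu> r) (\<lambda>p. ((case p of (x, y) \<Rightarrow> (- (m' + \<gamma> * \<mu>) + \<gamma> * x + 1 * y)\<^sup>2)
       - (case p of (x, y) \<Rightarrow> (- (\<nu> + r * \<mu>) + r * x + 1 * y)\<^sup>2)) / (2 * \<sigma>\<^sup>2) * indicator ({..<c} \<times> UNIV) p)"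
      by (intro integrable_real_mult_indicator integrable_divide Bochner_Integration.integrable_diff integrable_Psi_square assms A)
    also have "(\<lambda>p. ((case p of (x, y) \<Rightarrow> (- (m' + \<gamma> * \<mu>) + \<gamma> * x + 1 * y)\<^sup>2)
       - (case p of (x, y) \<Rightarrow> (- (\<nu> + r * \<mu>) + r * x + 1 * y)\<^sup>2)) / (2 * \<sigma>\<^sup>2) * indicator ({..<c} \<times> UNIV) p) = kl m'"
      by (auto simp: kl_def fun_eq_iff indicator_def algebra_simps)
    finally show ?thesis .
  qed
  have "0 \<le> e * (e * T.prob ({..<c} \<times> UNIV) - 2 * T.expectation w)" for e
  proof -
    have "T.expectation (kl m) \<le> T.expectation (kl (m + e))"
      using min[of "m + e"] history_KL_eq[OF assms(1), of "\<lambda>x. c \<le> x"] by (simp add: kl_def[abs_def])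
    then have "0 \<le> T.expectation (\<lambda>p. kl (m + e) p - kl m p)"
      using kl by simp
    also have "(\<lambda>p. kl (m + e) p - kl m p) = (\<lambda>p. (e\<^sup>2 * indicator ({..<c} \<times> UNIV) p - 2 * e * w p) / (2 * \<sigma>\<^sup>2))"
    proof
      fix p :: "real \<times> real"
      define t where "t = snd p + \<gamma> * fst p - (m + \<gamma> * \<mu>)"
      define s where "s = (snd p - (\<nu> - r * (fst p - \<mu>)))\<^sup>2"
      have t: "snd p - (m - \<gamma> * (fst p - \<mu>)) = t" "snd p - (m + e - \<gamma> * (fst p - \<mu>)) = t - e"
        by (simp_all add: t_def algebra_simps)
      have "((t - e)\<^sup>2 - s) / (2 * \<sigma>\<^sup>2) - (t\<^sup>2 - s) / (2 * \<sigma>\<^sup>2) = (e\<^sup>2 - 2 * e * t) / (2 * \<sigma>\<^sup>2)"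
        unfolding diff_divide_distrib[symmetric] by (simp add: power2_diff mult_ac)
      then show "kl (m + e) p - kl m p = (e\<^sup>2 * indicator ({..<c} \<times> UNIV) p - 2 * e * w p) / (2 * \<sigma>\<^sup>2)"
        by (auto simp: kl_def w_def t s_def[symmetric] t_def[symmetric] indicator_def mem_Times_iff)
    qed
    also have "T.expectation \<dots> = (e\<^sup>2 * T.prob ({..<c} \<times> UNIV) - 2 * e * T.expectation w) / (2 * \<sigma>\<^sup>2)"
      using w A by (simp add: T.emeasure_eq_measure)
    finally have "0 * (2 * \<sigma>\<^sup>2) \<le> e\<^sup>2 * T.prob ({..<c} \<times> UNIV) - 2 * e * T.expectation w"
      using assms(1) by (subst (asm) pos_le_divide_eq) auto
    then show ?thesis by (simp add: power2_eq_square algebra_simps)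
  qed
  \<comment> \<open>With \<open>e\<close> equal to the linear coefficient the quadratic is the
    square of that coefficient times \<open>prob - 2\<close>, which is negative unless the
    coefficient is zero.\<close>
  from this[of "T.expectation w"]
  have "0 \<le> (T.expectation w)\<^sup>2 * (T.prob ({..<c} \<times> UNIV) - 2)" by (simp add: power2_eq_square algebra_simps)
  moreover have "T.prob ({..<c} \<times> UNIV) - 2 < 0" using T.prob_le_1[of "{..<c} \<times> UNIV"] by linarith
  ultimately have "T.expectation w = 0"
    by (simp add: zero_le_mult_iff)
  then have "(\<integral>x. indicator {..<c} x * (\<nu> - r * (x - \<mu>) + \<gamma> * x - (m + \<gamma> * \<mu>)) \<partial>gauss \<mu> \<sigma>) = 0"
    using integral_Psi_indicator_affine(2)[OF assms(1), where A = "{..<c}" and \<gamma> = \<gamma> and k = "m + \<gamma> * \<mu>" and \<mu> = \<mu> and \<nu> = \<nu> and r = r] by (simp add: w_def[abs_def])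
  \<comment> \<open>The steady-state strategy stops at \<open>c\<close> itself while the learning
    agents continue at their cutoff. The point \<open>c\<close> is a null set, so the two
    conventions agree.\<close>
  also have "(\<integral>x. indicator {..<c} x * (\<nu> - r * (x - \<mu>) + \<gamma> * x - (m + \<gamma> * \<mu>)) \<partial>gauss \<mu> \<sigma>) =
     (\<integral>x. indicator {..c} x * (\<nu> - r * (x - \<mu>) + \<gamma> * x - (m + \<gamma> * \<mu>)) \<partial>gauss \<mu> \<sigma>)"
  proof (rule integral_cong_AE)
    have "AE x in lborel. x \<noteq> c" by (rule AE_lborel_singleton)
    then show "AE x in gauss \<mu> \<sigma>. indicator {..<c} x * (\<nu> - r * (x - \<mu>) + \<gamma> * x - (m + \<gamma> * \<mu>)) =
      indicator {..c} x * (\<nu> - r * (x - \<mu>) + \<gamma> * x - (m + \<gamma> * \<mu>))"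
      by (subst AE_density) (auto simp: indicator_def)
  qed simp_all
  finally show ?thesis
    using integral_Psi_indicator_affine(2)[OF assms(1), where A = "{..c}" and \<gamma> = \<gamma> and k = "m + \<gamma> * \<mu>" and \<mu> = \<mu> and \<nu> = \<nu> and r = r] by simp
qed

text \<open>Given \<open>X1 = x\<close>, the residual has a conditional mean affine in
  \<open>x\<close> with slope \<open>\<gamma> - r\<close>: the mistake in the reversal parameter is
  what transmits a displaced cutoff into the inferred mean.\<close>

lemma continuation_moment_lipschitz:
  assumes "0 < \<sigma>" "r \<noteq> \<gamma>"
    and zero: "(\<integral>p. indicator {..b} (fst p) * (snd p + \<gamma> * fst p - k) \<partial>Psi \<sigma> \<mu> \<nu> r) = 0"
  shows "\<bar>\<integral>p. indicator {..c} (fst p) * (snd p + \<gamma> * fst p - k) \<partial>Psi \<sigma> \<mu> \<nu> r\<bar>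
    \<le> \<bar>r - \<gamma>\<bar> * \<bar>c - b\<bar> * measure (gauss \<mu> \<sigma>) {..c}"
proof -
  \<comment> \<open>The first draw at which the conditional mean of the residual is zero; it exists
    because \<open>r \<noteq> \<gamma>\<close>.\<close>
  define e where "e = (k - \<nu> - r * \<mu>) / (\<gamma> - r)"
  have eq: "(\<integral>p. indicator {..a} (fst p) * (snd p + \<gamma> * fst p - k) \<partial>Psi \<sigma> \<mu> \<nu> r) =
      (\<gamma> - r) * (\<integral>x. indicator {..a} x * (x - e) \<partial>gauss \<mu> \<sigma>)" for a
  proof -
    have "\<nu> - r * (x - \<mu>) + \<gamma> * x - k = (\<gamma> - r) * (x - e)" for x
      using assms(2) by (simp add: e_def field_simps)
    then show ?thesis
      by (subst integral_Psi_indicator_affine(2)[OF assms(1)]) (simp_all add: mult.left_commute)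
  qed
  have "(\<integral>x. indicator {..b} x * (x - e) \<partial>gauss \<mu> \<sigma>) = 0"
    using zero assms(2) by (simp add: eq)
  from truncated_moment_lipschitz[OF assms(1) this, of c]
  have "\<bar>\<gamma> - r\<bar> * \<bar>\<integral>x. indicator {..c} x * (x - e) \<partial>gauss \<mu> \<sigma>\<bar> \<le> \<bar>\<gamma> - r\<bar> * (\<bar>c - b\<bar> * measure (gauss \<mu> \<sigma>) {..c})"
    by (intro mult_left_mono) auto
  then show ?thesis by (simp add: eq abs_mult abs_minus_commute mult.assoc)
qed

section \<open>Cutoffs\<close>

text \<open>The expected gap \<open>?H\<close> is continuous and strictly increasing and changes
  sign, so the cutoff defined by \<open>THE\<close> exists and is unique. The equivalence reads
  sublevel sets of the cutoff as signs of an integral, which serves measurability. In the bound,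
  deviations of \<nu> up to \<open>l\<close> move the cutoff one for one up to the factor
  \<open>1 + \<gamma>\<close>, whereas only the mean excess over \<open>l\<close> is magnified by
  \<open>1 / (1 - q)\<close>. A direct Lipschitz bound would magnify the whole deviation and lose
  the contraction.\<close>

lemma opt_cutoff_bounds:
  fixes M :: "(real \<times> real) measure"
  assumes \<sigma>: "0 < \<sigma>" and q: "0 \<le> q" "q < 1" and \<gamma>: "- 1 < \<gamma>"
    and M: "prob_space M" "sets M = sets borel"
    and U: "AE p in M. \<bar>snd p + \<gamma> * fst p - \<nu>\<bar> \<le> U"
    and c: "gap q \<kappa> \<sigma> ((1 + \<gamma>) * c - \<nu>) = 0"
  shows "opt_cutoff \<sigma> q \<kappa> \<gamma> M \<le> a \<longleftrightarrow> 0 \<le> (\<integral>p. gap q \<kappa> \<sigma> ((1 + \<gamma>) * a - (snd p + \<gamma> * fst p)) \<partial>M)" (is "_ \<longleftrightarrow> 0 \<le> ?H a")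
    and "0 \<le> l \<Longrightarrow> (1 + \<gamma>) * \<bar>opt_cutoff \<sigma> q \<kappa> \<gamma> M - c\<bar> \<le>
      l + (\<integral>p. max 0 (\<bar>snd p + \<gamma> * fst p - \<nu>\<bar> - l) \<partial>M) / (1 - q)"
proof -
  interpret M: prob_space M by (rule M(1))
  define u where "u p = snd p + \<gamma> * fst p - \<nu>" for p :: "real \<times> real"
  define y where "y = (1 + \<gamma>) * c - \<nu>"
  define G where "G = gap q \<kappa> \<sigma>"
  have [measurable]: "u \<in> borel_measurable M"
    unfolding measurable_cong_sets[OF M(2) refl] u_def by (subst borel_prod[symmetric]) measurable
  have [measurable]: "G \<in> borel_measurable borel" unfolding G_def by (rule borel_measurable_gap[OF \<sigma> q])
  have U': "AE p in M. \<bar>u p\<bar> \<le> U" using U by (simp add: u_def)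
  have U0: "0 \<le> U"
  proof -
    have "AE p in M. 0 \<le> U" using U' by eventually_elim linarith
    then show ?thesis using M.AE_const by auto
  qed
  have lip: "\<bar>G a - G b\<bar> \<le> \<bar>a - b\<bar>" for a b
    unfolding G_def by (rule gap_lipschitz[OF \<sigma> q])
  have slope: "(1 - q) * (b - a) \<le> G b - G a" if "a \<le> b" for a b
    unfolding G_def by (rule gap_slope(1)[OF \<sigma> q(1) that])
  have int_u: "integrable M (\<lambda>p. \<bar>u p\<bar>)"
    by (rule M.integrable_const_bound[where B = U]) (use U' in auto)
  have int_G: "integrable M (\<lambda>p. G (k - u p))" for k
  proof (rule Bochner_Integration.integrable_bound)
    show "integrable M (\<lambda>p. \<bar>G k\<bar> + \<bar>u p\<bar>)" using int_u by simp
    show "AE p in M. norm (G (k - u p)) \<le> norm (\<bar>G k\<bar> + \<bar>u p\<bar>)"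
    proof (rule AE_I2)
      fix p show "norm (G (k - u p)) \<le> norm (\<bar>G k\<bar> + \<bar>u p\<bar>)" using lip[of "k - u p" k] by simp
    qed
  qed measurable
  have arg: "(1 + \<gamma>) * a - (snd p + \<gamma> * fst p) = y + (1 + \<gamma>) * (a - c) - u p" for a and p :: "real \<times> real"
    by (simp add: y_def u_def algebra_simps)
  have H: "?H a = (\<integral>p. G (y + (1 + \<gamma>) * (a - c) - u p) \<partial>M)" for a
    unfolding arg G_def ..
  have H_slope: "(1 - q) * ((1 + \<gamma>) * (b - a)) \<le> ?H b - ?H a" if "a \<le> b" for a b
  proof -
    have le: "0 \<le> (1 + \<gamma>) * (b - a)" using \<gamma> that by simp
    have "(\<integral>p. G (y + (1 + \<gamma>) * (a - c) - u p) + (1 - q) * ((1 + \<gamma>) * (b - a)) \<partial>M)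
      \<le> (\<integral>p. G (y + (1 + \<gamma>) * (b - c) - u p) \<partial>M)"
    proof (intro integral_mono Bochner_Integration.integrable_add int_G)
      fix p
      have "y + (1 + \<gamma>) * (b - c) - u p - (y + (1 + \<gamma>) * (a - c) - u p) = (1 + \<gamma>) * (b - a)"
        by (simp add: algebra_simps)
      then show "G (y + (1 + \<gamma>) * (a - c) - u p) + (1 - q) * ((1 + \<gamma>) * (b - a)) \<le> G (y + (1 + \<gamma>) * (b - c) - u p)"
        using slope[of "y + (1 + \<gamma>) * (a - c) - u p" "y + (1 + \<gamma>) * (b - c) - u p"] le by simp
    qed simp
    then show ?thesis unfolding H using int_G M.prob_space by simp
  qed
  have H_lip: "\<bar>?H b - ?H a\<bar> \<le> (1 + \<gamma>) * \<bar>b - a\<bar>" for a b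
  proof -
    have "\<bar>?H b - ?H a\<bar> = \<bar>\<integral>p. G (y + (1 + \<gamma>) * (b - c) - u p) - G (y + (1 + \<gamma>) * (a - c) - u p) \<partial>M\<bar>"
      unfolding H using int_G by simp
    also have "\<dots> \<le> (\<integral>p. \<bar>G (y + (1 + \<gamma>) * (b - c) - u p) - G (y + (1 + \<gamma>) * (a - c) - u p)\<bar> \<partial>M)"
      by (rule integral_abs_bound)
    also have "\<dots> \<le> (\<integral>p. (1 + \<gamma>) * \<bar>b - a\<bar> \<partial>M)"
    proof (intro integral_mono integrable_abs Bochner_Integration.integrable_diff int_G)
      fix p
      have "y + (1 + \<gamma>) * (b - c) - u p - (y + (1 + \<gamma>) * (a - c) - u p) = (1 + \<gamma>) * (b - a)"
        by (simp add: algebra_simps)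
      then show "\<bar>G (y + (1 + \<gamma>) * (b - c) - u p) - G (y + (1 + \<gamma>) * (a - c) - u p)\<bar> \<le> (1 + \<gamma>) * \<bar>b - a\<bar>"
        using lip[of "y + (1 + \<gamma>) * (b - c) - u p" "y + (1 + \<gamma>) * (a - c) - u p"] \<gamma> by (simp add: abs_mult)
    qed simp
    finally show ?thesis using M.prob_space by simp
  qed
  have cont: "continuous_on A ?H" for A
  proof -
    have "(1 + \<gamma>)-lipschitz_on A ?H"
      using H_lip \<gamma> by (intro lipschitz_onI) (auto simp: dist_real_def)
    then show ?thesis by (rule lipschitz_on_continuous_on)
  qed
  have strict: "?H a < ?H b" if "a < b" for a b
  proof -
    have "0 < (1 - q) * ((1 + \<gamma>) * (b - a))" using q \<gamma> that by simp
    then show ?thesis using H_slope[of a b] that by simp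
  qed
  \<comment> \<open>A shift of the argument by \<open>U\<close> outweighs every \<open>u p\<close>,
    so the signs of \<open>?H\<close> at \<open>c - d\<close> and \<open>c + d\<close> are
    known.\<close>
  define d where "d = U / (1 + \<gamma>)"
  have d: "(1 + \<gamma>) * d = U" "0 \<le> d" using \<gamma> U0 by (auto simp: d_def field_simps)
  have Gy: "G y = 0" using c by (simp add: G_def y_def)
  have mono: "G a \<le> G b" if "a \<le> b" for a b
    unfolding G_def by (rule gap_mono[OF \<sigma> q that])
  have lo: "?H (c - d) \<le> 0"
  proof -
    have "(\<integral>p. G (y + (1 + \<gamma>) * (c - d - c) - u p) \<partial>M) \<le> (\<integral>p. 0 \<partial>M)"
      using U'
    proof (intro integral_mono_AE int_G, simp, eventually_elim)
      case (elim p)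
      then show ?case using mono[of "y + (1 + \<gamma>) * (c - d - c) - u p" y] d Gy by simp
    qed
    then show ?thesis unfolding H by simp
  qed
  have hi: "0 \<le> ?H (c + d)"
  proof -
    have "(\<integral>p. 0 \<partial>M) \<le> (\<integral>p. G (y + (1 + \<gamma>) * (c + d - c) - u p) \<partial>M)"
      using U'
    proof (intro integral_mono_AE int_G, simp, eventually_elim)
      case (elim p)
      then show ?case using mono[of y "y + (1 + \<gamma>) * (c + d - c) - u p"] d Gy by simp
    qed
    then show ?thesis unfolding H by simp
  qed
  obtain C where C: "?H C = 0"
    using IVT'[of ?H "c - d" 0 "c + d", OF lo hi] cont d by auto
  have uniq: "b = C" if "?H b = 0" for b
    using strict[of b C] strict[of C b] C that by (metis linorder_neqE_linordered_idom less_irrefl)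
  have eqn: "u1 b = (\<integral>(\<mu>1, \<mu>2). (\<integral>x2. u2 q \<kappa> b x2 \<partial>X2_law \<sigma> \<gamma> \<mu>1 \<mu>2 b) \<partial>M) \<longleftrightarrow> ?H b = 0" for b
  proof -
    have "(\<integral>(\<mu>1, \<mu>2). (\<integral>x2. u2 q \<kappa> b x2 \<partial>X2_law \<sigma> \<gamma> \<mu>1 \<mu>2 b) \<partial>M) =
      (\<integral>p. b - G (y + (1 + \<gamma>) * (b - c) - u p) \<partial>M)"
      by (intro Bochner_Integration.integral_cong refl)
         (simp add: case_prod_beta' integral_u2_X2_law[OF \<sigma>] arg[symmetric] G_def)
    also have "\<dots> = b - ?H b" unfolding H using int_G M.prob_space by simp
    finally show ?thesis by (simp add: u1_def)
  qed
  have opt: "opt_cutoff \<sigma> q \<kappa> \<gamma> M = C"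
    unfolding opt_cutoff_def eqn using C uniq by (rule the_equality)
  show "opt_cutoff \<sigma> q \<kappa> \<gamma> M \<le> a \<longleftrightarrow> 0 \<le> ?H a"
  proof (cases "C \<le> a")
    case True
    then have "?H C \<le> ?H a" using strict[of C a] by (cases "C = a") auto
    then show ?thesis using True C opt by simp
  next
    case False
    then have "?H a < ?H C" using strict[of a C] by simp
    then show ?thesis using False C opt by simp
  qed
  show "(1 + \<gamma>) * \<bar>opt_cutoff \<sigma> q \<kappa> \<gamma> M - c\<bar> \<le>
      l + (\<integral>p. max 0 (\<bar>snd p + \<gamma> * fst p - \<nu>\<bar> - l) \<partial>M) / (1 - q)" if l: "0 \<le> l"
  proof -
    define h where "h p = max 0 (\<bar>u p\<bar> - l)" for p
    have h0: "0 \<le> h p" for p by (simp add: h_def)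
    have [measurable]: "h \<in> borel_measurable M" by (simp add: h_def[abs_def])
    have int_h: "integrable M h"
      by (rule M.integrable_const_bound[where B = U]) (use U' U0 l in \<open>auto simp: h_def\<close>)
    have Eh: "0 \<le> (\<integral>p. h p \<partial>M)" using h0 by simp
    define \<Delta> where "\<Delta> = (1 + \<gamma>) * (C - c)"
    have zero: "(\<integral>p. G (y + \<Delta> - u p) \<partial>M) = 0" using C unfolding H \<Delta>_def .
    \<comment> \<open>When \<open>\<Delta> > l\<close>, the argument of \<open>G\<close> is at least
      \<open>y + \<Delta> - l - h p\<close>. The slope bound gives \<open>G\<close> at least
      \<open>(1 - q) * (\<Delta> - l)\<close> at \<open>y + \<Delta> - l\<close>, and the Lipschitz
      bound loses at most \<open>h p\<close>. Integrating against \<open>zero\<close> gives the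
      claim; negative \<Delta> is symmetric.\<close>
    have "(1 - q) * (\<bar>\<Delta>\<bar> - l) \<le> (\<integral>p. h p \<partial>M)"
    proof (cases "\<bar>\<Delta>\<bar> \<le> l")
      case True
      then have "(1 - q) * (\<bar>\<Delta>\<bar> - l) \<le> 0" using q by (intro mult_nonneg_nonpos) auto
      then show ?thesis using Eh by simp
    next
      case False
      show ?thesis
      proof (cases "0 \<le> \<Delta>")
        case True
        have "(\<integral>p. (1 - q) * (\<Delta> - l) \<partial>M) \<le> (\<integral>p. G (y + \<Delta> - u p) + h p \<partial>M)"
        proof (intro integral_mono Bochner_Integration.integrable_add int_G int_h)
          fix p
          have "G (y + \<Delta> - l - h p) \<le> G (y + \<Delta> - u p)" by (rule mono) (simp add: h_def)
          moreover have "\<bar>G (y + \<Delta> - l) - G (y + \<Delta> - l - h p)\<bar> \<le> h p"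
            using lip[of "y + \<Delta> - l" "y + \<Delta> - l - h p"] h0[of p] by simp
          moreover have "(1 - q) * (\<Delta> - l) \<le> G (y + \<Delta> - l)"
            using slope[of y "y + \<Delta> - l"] False True Gy by simp
          ultimately show "(1 - q) * (\<Delta> - l) \<le> G (y + \<Delta> - u p) + h p" by linarith
        qed simp
        then show ?thesis using zero int_h int_G M.prob_space True by simp
      next
        case neg: False
        have "(\<integral>p. (1 - q) * (- \<Delta> - l) \<partial>M) \<le> (\<integral>p. - G (y + \<Delta> - u p) + h p \<partial>M)"
        proof (intro integral_mono Bochner_Integration.integrable_add integrable_minus int_G int_h)
          fix p
          have "G (y + \<Delta> - u p) \<le> G (y + \<Delta> + l + h p)" by (rule mono) (simp add: h_def)
          moreover have "\<bar>G (y + \<Delta> + l + h p) - G (y + \<Delta> + l)\<bar> \<le> h p"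
            using lip[of "y + \<Delta> + l + h p" "y + \<Delta> + l"] h0[of p] by simp
          moreover have "(1 - q) * (- \<Delta> - l) \<le> - G (y + \<Delta> + l)"
            using slope[of "y + \<Delta> + l" y] False neg Gy by simp
          ultimately show "(1 - q) * (- \<Delta> - l) \<le> - G (y + \<Delta> - u p) + h p" by linarith
        qed simp
        then show ?thesis using zero int_h int_G M.prob_space neg by simp
      qed
    qed
    then have "\<bar>\<Delta>\<bar> - l \<le> (\<integral>p. h p \<partial>M) / (1 - q)"
      using q by (simp add: field_simps)
    then show ?thesis using \<gamma> by (simp add: opt \<Delta>_def abs_mult h_def u_def)
  qed
qed

section \<open>Posterior beliefs\<close>

lemma likelihood_eq:
  "likelihood \<sigma> \<gamma> (history (\<lambda>x1. c < x1) y) p =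
    normal_density (fst p) \<sigma> (fst y) * (if fst y \<le> c then normal_density (snd p - \<gamma> * (fst y - fst p)) \<sigma> (snd y) else 1)"
  by (auto simp: likelihood_def history_def split: prod.split)

lemma normal_density_le: "0 < \<sigma> \<Longrightarrow> normal_density \<mu> \<sigma> x \<le> 1 / sqrt (2 * pi * \<sigma>\<^sup>2)"
  unfolding normal_density_def by (intro mult_left_le) auto

text \<open>With \<open>w = x - b\<close>, the exponent comes from \<open>(w - v)\<^sup>2 - (w - (1
  - a) * v)\<^sup>2 = a * ((2 - a) * v\<^sup>2 - 2 * v * w)\<close>. The factor
  \<open>2 - a\<close>, rather than \<open>2\<close>, is the source of \<open>1 - a / 2\<close> in
  the posterior bounds.\<close>

lemma normal_density_scale:
  assumes "0 < \<sigma>"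
  shows "normal_density (b + (1 - a) * v) \<sigma> x = normal_density (b + v) \<sigma> x *
    exp (a / (2 * \<sigma>\<^sup>2) * ((2 - a) * v\<^sup>2 - 2 * v * (x - b)))"
proof -
  have "- (x - (b + (1 - a) * v))\<^sup>2 / (2 * \<sigma>\<^sup>2) = - (x - (b + v))\<^sup>2 / (2 * \<sigma>\<^sup>2) +
    a / (2 * \<sigma>\<^sup>2) * ((2 - a) * v\<^sup>2 - 2 * v * (x - b))"
    using assms by (simp add: field_simps power2_eq_square)
  then show ?thesis by (simp add: normal_density_def exp_add[symmetric])
qed

text \<open>\<open>(p1, p2)\<close> stands for the true first mean and the steady-state second mean,
  \<open>c\<close> for the steady-state cutoff. The prior density enters the estimates through its
  bounds \<open>mlo\<close> and \<open>mhi\<close> on the rectangle.\<close>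

locale posterior =
  fixes \<sigma> q \<kappa> \<gamma> l1 h1 l2 h2 p1 p2 c mlo mhi :: real
    and m0 :: "real \<times> real \<Rightarrow> real" and M0 :: "(real \<times> real) measure"
  assumes \<sigma>: "0 < \<sigma>" and q: "0 \<le> q" "q < 1" and \<gamma>: "- 1 < \<gamma>"
    and p: "l1 \<le> p1" "p1 \<le> h1" "l2 \<le> p2" "p2 \<le> h2"
    and indifferent: "gap q \<kappa> \<sigma> ((1 + \<gamma>) * c - (p2 + \<gamma> * p1)) = 0"
    and m0: "0 < mlo" "\<And>p. p \<in> {l1..h1} \<times> {l2..h2} \<Longrightarrow> mlo \<le> m0 p"
      "\<And>p. p \<in> {l1..h1} \<times> {l2..h2} \<Longrightarrow> m0 p \<le> mhi"
    and m0_measurable: "(\<lambda>p. indicator ({l1..h1} \<times> {l2..h2}) p * m0 p) \<in> borel_measurable borel"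
    and M0_eq: "M0 = density lborel (\<lambda>p. ennreal (indicator ({l1..h1} \<times> {l2..h2}) p * m0 p))"
    and M0_prob: "prob_space M0"
begin

abbreviation "R \<equiv> {l1..h1} \<times> {l2..h2}"

sublocale M0: prob_space M0 by (rule M0_prob)

lemma sets_M0 [simp, measurable_cong]: "sets M0 = sets borel"
  by (simp add: M0_eq)

lemma space_M0 [simp]: "space M0 = UNIV"
  by (simp add: M0_eq)

lemma AE_M0: "AE p in M0. p \<in> R"
  unfolding M0_eq by (subst AE_density) (use m0_measurable in \<open>auto simp: indicator_def\<close>)

abbreviation "bel \<equiv> belief \<sigma> q \<kappa> \<gamma> M0"
abbreviation "thr \<equiv> cutoff \<sigma> q \<kappa> \<gamma> M0"

text \<open>The cutoff \<open>thr x s\<close> is fixed by the data and does not vary with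
  \<open>p\<close>, so the selection of the continuing rounds contributes no factor depending on
  \<open>p\<close>.\<close>

definition lik1 :: "(nat \<Rightarrow> real \<times> real) \<Rightarrow> nat \<Rightarrow> real \<times> real \<Rightarrow> real" where
  "lik1 x s p = normal_density (fst p) \<sigma> (fst (x s)) *
     (if fst (x s) \<le> thr x s then normal_density (snd p - \<gamma> * (fst (x s) - fst p)) \<sigma> (snd (x s)) else 1)"

definition lik :: "(nat \<Rightarrow> real \<times> real) \<Rightarrow> nat \<Rightarrow> real \<times> real \<Rightarrow> real" where
  "lik x t p = (\<Prod>s=1..t. lik1 x s p)"

lemma lik_Suc: "lik x (Suc t) p = lik x t p * lik1 x (Suc t) p"
  by (simp add: lik_def)

lemma lik1_pos: "0 < lik1 x s p"
  using normal_density_pos[OF \<sigma>] by (simp add: lik1_def)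

lemma lik_pos: "0 < lik x t p"
  unfolding lik_def by (intro prod_pos lik1_pos)

lemma lik1_measurable [measurable]: "lik1 x s \<in> borel_measurable borel"
  unfolding lik1_def[abs_def] normal_density_def by (subst borel_prod[symmetric]) measurable

lemma lik_measurable [measurable]: "lik x t \<in> borel_measurable borel"
  unfolding lik_def[abs_def] by measurable

lemma lik_bounded: "\<exists>B. \<forall>p. lik x t p \<le> B"
proof -
  define k where "k = 1 / sqrt (2 * pi * \<sigma>\<^sup>2)"
  have k: "normal_density \<mu> \<sigma> y \<le> k" "0 \<le> k" for \<mu> y
    using normal_density_le[OF \<sigma>] by (auto simp: k_def)
  have "lik1 x s p \<le> k * max 1 k" for s p
    unfolding lik1_def using k by (intro mult_mono) (auto intro: le_max_iff_disj[THEN iffD2])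
  then have "lik x t p \<le> (\<Prod>s=1..t. k * max 1 k)" for p
    unfolding lik_def by (intro prod_mono conjI less_imp_le[OF lik1_pos])
  then show ?thesis by blast
qed

lemma lik_integrable [simp]: "integrable M0 (lik x t)"
proof -
  obtain B where "\<And>p. lik x t p \<le> B" using lik_bounded by blast
  then show ?thesis
    by (intro M0.integrable_const_bound[where B = B]) (auto simp: lik_pos less_imp_le)
qed

definition norm_const :: "(nat \<Rightarrow> real \<times> real) \<Rightarrow> nat \<Rightarrow> real" where
  "norm_const x t = (\<integral>p. lik x t p \<partial>M0)"

lemma norm_const_pos: "0 < norm_const x t"
proof -
  have "norm_const x t \<noteq> 0"
  proof
    assume "norm_const x t = 0"
    then have "AE p in M0. lik x t p = 0"
      unfolding norm_const_def
      by (subst (asm) integral_nonneg_eq_0_iff_AE) (auto simp: lik_pos less_imp_le)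
    then have "AE p in M0. False" by eventually_elim (metis lik_pos less_irrefl)
    then show False by simp
  qed
  moreover have "0 \<le> norm_const x t"
    unfolding norm_const_def by (intro Bochner_Integration.integral_nonneg less_imp_le lik_pos)
  ultimately show ?thesis by simp
qed

text \<open>The Bayes denominator of each round is a quotient of consecutive values of
  \<open>norm_const\<close>, so the denominators telescope and sequential updating amounts to a
  single update of the prior by the product likelihood.\<close>

lemma belief_eq: "bel x t = density M0 (\<lambda>p. ennreal (lik x t p / norm_const x t))"
proof (induction t)
  case 0
  have "density M0 (\<lambda>p. ennreal (lik x 0 p / norm_const x 0)) = density M0 (\<lambda>p. 1)"
    using M0.prob_space by (simp add: lik_def norm_const_def)
  then show ?case by (simp add: density_1)
next
  case (Suc t)
  have lik1: "likelihood \<sigma> \<gamma> (history (\<lambda>x1. opt_cutoff \<sigma> q \<kappa> \<gamma> (bel x t) < x1) (x (Suc t))) = lik1 x (Suc t)"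
    by (auto simp: likelihood_eq lik1_def cutoff_def)
  have "(\<integral>p'. lik1 x (Suc t) p' \<partial>bel x t) = (\<integral>p'. lik x t p' / norm_const x t * lik1 x (Suc t) p' \<partial>M0)"
    unfolding Suc using norm_const_pos[of x t]
    by (subst integral_real_density) (auto simp: lik_pos less_imp_le)
  also have "\<dots> = norm_const x (Suc t) / norm_const x t"
    by (simp add: norm_const_def lik_Suc)
  finally have Z: "(\<integral>p'. lik1 x (Suc t) p' \<partial>bel x t) = norm_const x (Suc t) / norm_const x t" .
  have "bel x (Suc t) = density (bel x t) (\<lambda>p. ennreal (lik1 x (Suc t) p / (norm_const x (Suc t) / norm_const x t)))"
    by (simp add: bayes_update_def lik1 Z)
  also have "\<dots> = density M0 (\<lambda>p. ennreal (lik x t p / norm_const x t) * ennreal (lik1 x (Suc t) p / (norm_const x (Suc t) / norm_const x t)))"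
    unfolding Suc by (subst density_density_eq) simp_all
  also have "\<dots> = density M0 (\<lambda>p. ennreal (lik x (Suc t) p / norm_const x (Suc t)))"
  proof (intro density_cong AE_I2)
    fix p
    show "ennreal (lik x t p / norm_const x t) * ennreal (lik1 x (Suc t) p / (norm_const x (Suc t) / norm_const x t))
      = ennreal (lik x (Suc t) p / norm_const x (Suc t))"
      using norm_const_pos[of x t] norm_const_pos[of x "Suc t"] lik_pos[of x t p] lik1_pos[of x "Suc t" p]
      by (subst ennreal_mult[symmetric]) (auto simp: lik_Suc intro!: divide_nonneg_nonneg)
  qed simp_all
  finally show ?case .
qed

lemma sets_belief [simp, measurable_cong]: "sets (bel x t) = sets borel"
  by (simp add: belief_eq)

lemma space_belief [simp]: "space (bel x t) = UNIV"
  by (simp add: belief_eq)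

lemma integral_belief:
  fixes f :: "real \<times> real \<Rightarrow> real"
  assumes "f \<in> borel_measurable borel"
  shows "(\<integral>p. f p \<partial>bel x t) = (\<integral>p. lik x t p * f p \<partial>M0) / norm_const x t"
  unfolding belief_eq using assms norm_const_pos[of x t]
  by (subst integral_real_density) (auto simp: lik_pos less_imp_le)

lemma prob_space_belief: "prob_space (bel x t)"
proof
  have "emeasure (bel x t) (space (bel x t)) = (\<integral>\<^sup>+p. ennreal (lik x t p / norm_const x t) \<partial>M0)"
    unfolding belief_eq by (subst emeasure_density) auto
  also have "\<dots> = ennreal (\<integral>p. lik x t p / norm_const x t \<partial>M0)"
    using norm_const_pos[of x t] by (intro nn_integral_eq_integral) (auto simp: lik_pos less_imp_le)
  also have "\<dots> = 1" using norm_const_pos[of x t] by (simp add: norm_const_def)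
  finally show "emeasure (bel x t) (space (bel x t)) = 1" .
qed

lemma AE_belief: "AE p in bel x t. p \<in> R"
  unfolding belief_eq by (subst AE_density) (use AE_M0 in auto)

section \<open>Effect of a contraction on the likelihood\<close>

definition dev :: "real \<times> real \<Rightarrow> real" where
  "dev p = snd p + \<gamma> * fst p - (p2 + \<gamma> * p1)"

text \<open>Three sums through which the data enter \<open>gain\<close>: \<open>sumN\<close> counts
  the continuing agents, and \<open>sumB / sumN\<close> is the difference
  \<open>V - \<nu>inf\<close> of the overview.\<close>

definition sumA :: "(nat \<Rightarrow> real \<times> real) \<Rightarrow> nat \<Rightarrow> real" where
  "sumA x t = (\<Sum>s=1..t. fst (x s) - p1)"
definition sumN :: "(nat \<Rightarrow> real \<times> real) \<Rightarrow> nat \<Rightarrow> real" where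
  "sumN x t = (\<Sum>s=1..t. indicator {..thr x s} (fst (x s)))"
definition sumB :: "(nat \<Rightarrow> real \<times> real) \<Rightarrow> nat \<Rightarrow> real" where
  "sumB x t = (\<Sum>s=1..t. indicator {..thr x s} (fst (x s)) * (snd (x s) + \<gamma> * fst (x s) - (p2 + \<gamma> * p1)))"

text \<open>The gain in log-likelihood when \<open>p\<close> is moved to \<open>shrink a p\<close>.\<close>

definition gain :: "real \<Rightarrow> (nat \<Rightarrow> real \<times> real) \<Rightarrow> nat \<Rightarrow> real \<times> real \<Rightarrow> real" where
  "gain a x t p = a / (2 * \<sigma>\<^sup>2) * ((2 - a) * (t * (fst p - p1)\<^sup>2 + sumN x t * (dev p)\<^sup>2)
     - 2 * (fst p - p1) * sumA x t - 2 * dev p * sumB x t)"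

definition shrink :: "real \<Rightarrow> real \<times> real \<Rightarrow> real \<times> real" where
  "shrink a p = a *\<^sub>R (p1, p2) + (1 - a) *\<^sub>R p"

lemma shrink_components:
  "fst (shrink a p) = p1 + (1 - a) * (fst p - p1)" "snd (shrink a p) = p2 + (1 - a) * (snd p - p2)"
  "dev (shrink a p) = (1 - a) * dev p"
  by (simp_all add: shrink_def dev_def algebra_simps)

lemma shrink_R:
  assumes "p \<in> R" "0 \<le> a" "a \<le> 1" shows "shrink a p \<in> R"
proof -
  have "convex R" by (intro convex_Times) auto
  moreover have "(p1, p2) \<in> R" using p by simp
  ultimately show ?thesis unfolding shrink_def using assms by (intro convexD) auto
qed

text \<open>In the coordinates \<open>fst p - p1\<close> and \<open>dev p\<close> the contraction
  multiplies both by \<open>1 - a\<close>, and each normal factor depends on one of them only, so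
  the gains of single factors add up to \<open>gain\<close>.\<close>

lemma lik_shrink: "lik x t (shrink a p) = lik x t p * exp (gain a x t p)"
proof (induction t)
  case 0
  show ?case by (simp add: lik_def gain_def sumA_def sumN_def sumB_def)
next
  case (Suc t)
  define y where "y = x (Suc t)"
  define i where "i = indicat_real {..thr x (Suc t)} (fst y)"
  have 1: "normal_density (fst (shrink a p)) \<sigma> (fst y) = normal_density (fst p) \<sigma> (fst y) *
      exp (a / (2 * \<sigma>\<^sup>2) * ((2 - a) * (fst p - p1)\<^sup>2 - 2 * (fst p - p1) * (fst y - p1)))"
    using normal_density_scale[OF \<sigma>, of p1 a "fst p - p1" "fst y"] by (simp add: shrink_components)
  have 2: "normal_density (snd (shrink a p) - \<gamma> * (fst y - fst (shrink a p))) \<sigma> (snd y) =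
      normal_density (snd p - \<gamma> * (fst y - fst p)) \<sigma> (snd y) *
      exp (a / (2 * \<sigma>\<^sup>2) * ((2 - a) * (dev p)\<^sup>2 - 2 * dev p * (snd y + \<gamma> * fst y - (p2 + \<gamma> * p1))))"
  proof -
    \<comment> \<open>Believed mean of the second draw under \<open>(p1, p2)\<close>; under
      \<open>p\<close> it is \<open>b + dev p\<close>.\<close>
    define b where "b = p2 + \<gamma> * p1 - \<gamma> * fst y"
    have "snd (shrink a p) - \<gamma> * (fst y - fst (shrink a p)) = b + (1 - a) * dev p"
        "snd p - \<gamma> * (fst y - fst p) = b + dev p"
        "snd y + \<gamma> * fst y - (p2 + \<gamma> * p1) = snd y - b"
      by (simp_all add: shrink_components b_def dev_def algebra_simps)
    then show ?thesis using normal_density_scale[OF \<sigma>, of b a "dev p" "snd y"] by simp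
  qed
  have "lik1 x (Suc t) (shrink a p) = lik1 x (Suc t) p *
    exp (a / (2 * \<sigma>\<^sup>2) * ((2 - a) * (fst p - p1)\<^sup>2 - 2 * (fst p - p1) * (fst y - p1)) +
      i * (a / (2 * \<sigma>\<^sup>2) * ((2 - a) * (dev p)\<^sup>2 - 2 * dev p * (snd y + \<gamma> * fst y - (p2 + \<gamma> * p1)))))"
    unfolding lik1_def y_def[symmetric] 1 2 by (auto simp: i_def exp_add)
  moreover have "gain a x (Suc t) p = gain a x t p +
    (a / (2 * \<sigma>\<^sup>2) * ((2 - a) * (fst p - p1)\<^sup>2 - 2 * (fst p - p1) * (fst y - p1)) +
      i * (a / (2 * \<sigma>\<^sup>2) * ((2 - a) * (dev p)\<^sup>2 - 2 * dev p * (snd y + \<gamma> * fst y - (p2 + \<gamma> * p1)))))"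
  proof -
    define k where "k = a / (2 * \<sigma>\<^sup>2)"
    have eqs: "sumA x (Suc t) = sumA x t + (fst y - p1)" "sumN x (Suc t) = sumN x t + i"
        "sumB x (Suc t) = sumB x t + i * (snd y + \<gamma> * fst y - (p2 + \<gamma> * p1))"
      by (simp_all add: sumA_def sumN_def sumB_def i_def y_def)
    show ?thesis unfolding gain_def k_def[symmetric] eqs by (simp add: algebra_simps)
  qed
  ultimately show ?case by (simp only: lik_Suc Suc.IH exp_add mult_ac)
qed

lemma gain_measurable [measurable]: "gain a x t \<in> borel_measurable borel"
  unfolding gain_def[abs_def] dev_def[abs_def] by (subst borel_prod[symmetric]) measurable

lemma nn_integral_M0:
  assumes [measurable]: "f \<in> borel_measurable borel"
  shows "(\<integral>\<^sup>+p. f p \<partial>M0) = (\<integral>\<^sup>+p. ennreal (indicator R p * m0 p) * f p \<partial>lborel)"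
  unfolding M0_eq using m0_measurable by (subst nn_integral_density) auto

lemma mhi_pos: "0 < mhi"
  using m0(1) m0(2,3)[of "(p1, p2)"] p by auto

text \<open>Shrinking the rectangle towards \<open>(p1, p2)\<close> keeps it inside itself, so the posterior mass of
  the image is at most one; after the change of variables this becomes an exponential moment bound.\<close>

lemma exp_gain_le:
  assumes "0 < a" "a < 1"
  shows "(\<integral>\<^sup>+p. ennreal (exp (gain a x t p)) \<partial>bel x t) \<le> ennreal (mhi / (mlo * (1 - a)\<^sup>2))"
proof -
  define Z where "Z = norm_const x t"
  have Z: "0 < Z" unfolding Z_def by (rule norm_const_pos)
  define F where "F p = ennreal (indicator R p * m0 p) * ennreal (lik x t p)" for p
  have [measurable]: "F \<in> borel_measurable borel"
    unfolding F_def[abs_def] using m0_measurable by measurable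
  have "ennreal Z = (\<integral>\<^sup>+p. ennreal (lik x t p) \<partial>M0)"
    unfolding Z_def norm_const_def by (intro nn_integral_eq_integral[symmetric]) (auto simp: lik_pos less_imp_le)
  also have "\<dots> = (\<integral>\<^sup>+p. F p \<partial>lborel)" unfolding F_def by (intro nn_integral_M0) measurable
  \<comment> \<open>Change of variables along the contraction of the plane, with Jacobian
    \<open>(1 - a)\<^sup>2\<close>.\<close>
  also have "\<dots> = (\<integral>\<^sup>+p. ennreal ((1 - a)\<^sup>2) * F (shrink a p) \<partial>lborel)"
  proof -
    have m: "shrink a \<in> borel \<rightarrow>\<^sub>M borel" unfolding shrink_def by measurable
    have "(\<integral>\<^sup>+p. F p \<partial>lborel) = (\<integral>\<^sup>+p. F p \<partial>density (distr lborel borel (shrink a)) (\<lambda>_. ennreal (\<bar>1 - a\<bar> ^ DIM(real \<times> real))))"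
      using lborel_affine[of "1 - a" "a *\<^sub>R (p1, p2)"] assms by (simp add: shrink_def[abs_def])
    also have "\<dots> = (\<integral>\<^sup>+p. ennreal ((1 - a)\<^sup>2) * F p \<partial>distr lborel borel (shrink a))"
      using assms by (subst nn_integral_density) (auto simp: numeral_2_eq_2)
    also have "\<dots> = (\<integral>\<^sup>+p. ennreal ((1 - a)\<^sup>2) * F (shrink a p) \<partial>lborel)"
      using m by (subst nn_integral_distr) auto
    finally show ?thesis .
  qed
  \<comment> \<open>Points outside \<open>R\<close> whose images lie in \<open>R\<close> are
    dropped, and inside \<open>R\<close> the prior density at the image is at least
    \<open>mlo / mhi\<close> times that at \<open>p\<close>.\<close>
  also have "\<dots> \<ge> (\<integral>\<^sup>+p. ennreal (indicator R p * m0 p) * ennreal ((1 - a)\<^sup>2 * (mlo / mhi) * (lik x t p * exp (gain a x t p))) \<partial>lborel)"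
  proof (intro nn_integral_mono)
    fix p
    show "ennreal (indicator R p * m0 p) * ennreal ((1 - a)\<^sup>2 * (mlo / mhi) * (lik x t p * exp (gain a x t p)))
      \<le> ennreal ((1 - a)\<^sup>2) * F (shrink a p)"
    proof (cases "p \<in> R")
      case True
      have s: "shrink a p \<in> R" using True assms by (intro shrink_R) auto
      have "m0 p * (mlo / mhi) \<le> mlo"
        using m0(1) m0(3)[OF True] mhi_pos by (simp add: field_simps)
      also have "mlo \<le> m0 (shrink a p)" by (rule m0(2)[OF s])
      finally have le: "m0 p * (mlo / mhi) \<le> m0 (shrink a p)" .
      have pos: "0 < lik x t p * exp (gain a x t p)" by (simp add: lik_pos)
      have "0 \<le> m0 p" "0 \<le> m0 (shrink a p)" using m0(1) m0(2)[OF True] m0(2)[OF s] by linarith+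
      then have "ennreal (indicator R p * m0 p) * ennreal ((1 - a)\<^sup>2 * (mlo / mhi) * (lik x t p * exp (gain a x t p)))
        = ennreal ((1 - a)\<^sup>2 * ((m0 p * (mlo / mhi)) * (lik x t p * exp (gain a x t p))))"
      proof (subst ennreal_mult[symmetric])
        show "0 \<le> (1 - a)\<^sup>2 * (mlo / mhi) * (lik x t p * exp (gain a x t p))"
          using m0(1) mhi_pos by (intro mult_nonneg_nonneg) (auto intro: less_imp_le[OF lik_pos])
      qed (use True \<open>0 \<le> m0 p\<close> in \<open>simp_all add: mult_ac\<close>)
      also have "\<dots> \<le> ennreal ((1 - a)\<^sup>2 * (m0 (shrink a p) * (lik x t p * exp (gain a x t p))))"
        using le pos by (intro ennreal_leI mult_left_mono mult_right_mono) auto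
      also have "\<dots> = ennreal ((1 - a)\<^sup>2) * F (shrink a p)"
        using s pos \<open>0 \<le> m0 (shrink a p)\<close> by (simp add: F_def lik_shrink ennreal_mult)
      finally show ?thesis .
    qed simp
  qed
  finally have "(\<integral>\<^sup>+p. ennreal ((1 - a)\<^sup>2 * (mlo / mhi) * (lik x t p * exp (gain a x t p))) \<partial>M0) \<le> ennreal Z"
    by (subst nn_integral_M0) auto
  also have "(\<integral>\<^sup>+p. ennreal ((1 - a)\<^sup>2 * (mlo / mhi) * (lik x t p * exp (gain a x t p))) \<partial>M0) =
    (\<integral>\<^sup>+p. ennreal ((1 - a)\<^sup>2 * (mlo / mhi) * Z) * (ennreal (lik x t p / Z) * ennreal (exp (gain a x t p))) \<partial>M0)"
  proof (intro nn_integral_cong)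
    fix p
    have "0 \<le> (1 - a)\<^sup>2 * (mlo / mhi) * Z" using m0(1) mhi_pos Z by simp
    then show "ennreal ((1 - a)\<^sup>2 * (mlo / mhi) * (lik x t p * exp (gain a x t p))) =
      ennreal ((1 - a)\<^sup>2 * (mlo / mhi) * Z) * (ennreal (lik x t p / Z) * ennreal (exp (gain a x t p)))"
      using lik_pos[of x t p] Z by (simp add: ennreal_mult[symmetric] mult.assoc)
  qed
  also have "\<dots> = ennreal ((1 - a)\<^sup>2 * (mlo / mhi) * Z) * (\<integral>\<^sup>+p. ennreal (lik x t p / Z) * ennreal (exp (gain a x t p)) \<partial>M0)"
    by (rule nn_integral_cmult) measurable
  also have "(\<integral>\<^sup>+p. ennreal (lik x t p / Z) * ennreal (exp (gain a x t p)) \<partial>M0) = (\<integral>\<^sup>+p. ennreal (exp (gain a x t p)) \<partial>bel x t)"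
    unfolding belief_eq Z_def by (subst nn_integral_density) auto
  finally have le: "ennreal ((1 - a)\<^sup>2 * (mlo / mhi) * Z) * (\<integral>\<^sup>+p. ennreal (exp (gain a x t p)) \<partial>bel x t) \<le> ennreal Z" .
  define k where "k = (1 - a)\<^sup>2 * (mlo / mhi) * Z"
  have k: "0 < k" using assms m0(1) mhi_pos Z by (simp add: k_def)
  have "(\<integral>\<^sup>+p. ennreal (exp (gain a x t p)) \<partial>bel x t) = ennreal (1 / k) * (ennreal k * (\<integral>\<^sup>+p. ennreal (exp (gain a x t p)) \<partial>bel x t))"
    using k by (simp add: mult.assoc[symmetric] ennreal_mult[symmetric])
  also have "\<dots> \<le> ennreal (1 / k) * ennreal Z"
    using le unfolding k_def by (rule mult_left_mono) simp
  also have "\<dots> = ennreal (mhi / (mlo * (1 - a)\<^sup>2))"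
  proof -
    have "1 / k * Z = mhi / (mlo * (1 - a)\<^sup>2)" using Z by (simp add: k_def)
    moreover have "ennreal (1 / k) * ennreal Z = ennreal (1 / k * Z)"
      using k Z by (intro ennreal_mult[symmetric]) auto
    ultimately show ?thesis by simp
  qed
  finally show ?thesis .
qed

end

section \<open>Moment bounds for the posterior\<close>

context posterior begin

definition "diam1 = h1 - l1"
definition "diam = (h2 - l2) + \<bar>\<gamma>\<bar> * (h1 - l1)"
text \<open>The bound on the exponential moment divided by the prefactor
  \<open>a / (2 * \<sigma>\<^sup>2)\<close> of \<open>gain\<close>. It depends neither on
  \<open>t\<close> nor on the data, so it disappears after division by \<open>t\<close>.\<close>

definition "slack a = 2 * \<sigma>\<^sup>2 / a * (mhi / (mlo * (1 - a)\<^sup>2))"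

lemma diam_nonneg: "0 \<le> diam1" "0 \<le> diam"
  using p by (auto simp: diam1_def diam_def)

lemma R_bounds:
  assumes "x \<in> R" shows "\<bar>fst x - p1\<bar> \<le> diam1" "\<bar>dev x\<bar> \<le> diam"
proof -
  show 1: "\<bar>fst x - p1\<bar> \<le> diam1" using assms p by (auto simp: diam1_def)
  have "\<bar>dev x\<bar> \<le> \<bar>snd x - p2\<bar> + \<bar>\<gamma>\<bar> * \<bar>fst x - p1\<bar>"
    unfolding dev_def abs_mult[symmetric] by (simp add: algebra_simps)
  also have "\<bar>snd x - p2\<bar> \<le> h2 - l2" using assms p by auto
  also have "\<bar>\<gamma>\<bar> * \<bar>fst x - p1\<bar> \<le> \<bar>\<gamma>\<bar> * (h1 - l1)" using 1 by (intro mult_left_mono) (auto simp: diam1_def)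
  finally show "\<bar>dev x\<bar> \<le> diam" by (simp add: diam_def)
qed

lemma dev_measurable [measurable]: "dev \<in> borel_measurable borel"
  unfolding dev_def[abs_def] by (subst borel_prod[symmetric]) measurable

lemma AE_bounds:
  "AE p in bel x t. \<bar>fst p - p1\<bar> \<le> diam1" "AE p in bel x t. \<bar>dev p\<bar> \<le> diam"
proof -
  show "AE p in bel x t. \<bar>fst p - p1\<bar> \<le> diam1"
    using AE_belief[of x t] by eventually_elim (rule R_bounds)
  show "AE p in bel x t. \<bar>dev p\<bar> \<le> diam"
    using AE_belief[of x t] by eventually_elim (rule R_bounds)
qed

lemma integrable_belief:
  fixes f :: "real \<times> real \<Rightarrow> real"
  assumes "f \<in> borel_measurable borel" "\<And>p. p \<in> R \<Longrightarrow> \<bar>f p\<bar> \<le> B"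
  shows "integrable (bel x t) f"
proof -
  interpret prob_space "bel x t" by (rule prob_space_belief)
  show ?thesis
    by (rule integrable_const_bound[where B = B])
       (use AE_belief[of x t] assms in \<open>auto elim: eventually_mono\<close>)
qed

lemma fst_measurable [measurable]: "(fst :: real \<times> real \<Rightarrow> real) \<in> borel_measurable borel"
  by (subst borel_prod[symmetric]) measurable

lemma gain_pos_part:
  assumes "0 < a" "a < 1"
  shows "integrable (bel x t) (\<lambda>p. max 0 (gain a x t p))"
    and "(\<integral>p. max 0 (gain a x t p) \<partial>bel x t) \<le> mhi / (mlo * (1 - a)\<^sup>2)"
proof -
  have K: "0 \<le> mhi / (mlo * (1 - a)\<^sup>2)" using mhi_pos m0(1) by simp
  have "v \<le> exp v" for v :: real using exp_ge_add_one_self[of v] by linarith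
  then have "max 0 v \<le> exp v" for v :: real by simp
  then have "(\<integral>\<^sup>+p. ennreal (max 0 (gain a x t p)) \<partial>bel x t) \<le> (\<integral>\<^sup>+p. ennreal (exp (gain a x t p)) \<partial>bel x t)"
    by (intro nn_integral_mono ennreal_leI)
  also have "\<dots> \<le> ennreal (mhi / (mlo * (1 - a)\<^sup>2))" by (rule exp_gain_le[OF assms])
  finally have le: "(\<integral>\<^sup>+p. ennreal (max 0 (gain a x t p)) \<partial>bel x t) \<le> ennreal (mhi / (mlo * (1 - a)\<^sup>2))" .
  show int: "integrable (bel x t) (\<lambda>p. max 0 (gain a x t p))"
    by (rule integrableI_nonneg) (use le in \<open>auto intro: le_less_trans\<close>)
  have "ennreal (\<integral>p. max 0 (gain a x t p) \<partial>bel x t) = (\<integral>\<^sup>+p. ennreal (max 0 (gain a x t p)) \<partial>bel x t)"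
    by (rule nn_integral_eq_integral[symmetric, OF int]) simp
  with le have "ennreal (\<integral>p. max 0 (gain a x t p) \<partial>bel x t) \<le> ennreal (mhi / (mlo * (1 - a)\<^sup>2))" by simp
  then show "(\<integral>p. max 0 (gain a x t p) \<partial>bel x t) \<le> mhi / (mlo * (1 - a)\<^sup>2)"
    using K by (simp add: ennreal_le_iff)
qed

text \<open>The exponential moment bounds the mean positive part of \<open>gain\<close>, so anything
  that exceeds \<open>k\<close> only where the gain is correspondingly large has posterior mean at
  most \<open>k\<close> plus a constant. The level \<open>k\<close> may depend on the data.\<close>

lemma expectation_le_of_gain:
  assumes a: "0 < a" "a < 1" and f: "f \<in> borel_measurable borel" "\<And>p. p \<in> R \<Longrightarrow> \<bar>f p\<bar> \<le> B"
    and le: "\<And>p. p \<in> R \<Longrightarrow> a / (2 * \<sigma>\<^sup>2) * (f p - k) \<le> max 0 (gain a x t p)"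
  shows "(\<integral>p. f p \<partial>bel x t) \<le> k + slack a"
proof -
  interpret prob_space "bel x t" by (rule prob_space_belief)
  have int: "integrable (bel x t) f" by (rule integrable_belief[OF f])
  have pos: "0 < a / (2 * \<sigma>\<^sup>2)" using a \<sigma> by simp
  have "(\<integral>p. a / (2 * \<sigma>\<^sup>2) * (f p - k) \<partial>bel x t) \<le> (\<integral>p. max 0 (gain a x t p) \<partial>bel x t)"
  proof (intro integral_mono_AE gain_pos_part a integrable_mult_right Bochner_Integration.integrable_diff int)
    show "AE p in bel x t. a / (2 * \<sigma>\<^sup>2) * (f p - k) \<le> max 0 (gain a x t p)"
      using AE_belief[of x t] by eventually_elim (rule le)
  qed simp
  also have "\<dots> \<le> mhi / (mlo * (1 - a)\<^sup>2)" by (rule gain_pos_part[OF a])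
  finally have "a / (2 * \<sigma>\<^sup>2) * ((\<integral>p. f p \<partial>bel x t) - k) \<le> mhi / (mlo * (1 - a)\<^sup>2)"
    using int prob_space by simp
  then have "(\<integral>p. f p \<partial>bel x t) - k \<le> (mhi / (mlo * (1 - a)\<^sup>2)) / (a / (2 * \<sigma>\<^sup>2))"
    by (subst pos_le_divide_eq[OF pos], subst mult.commute)
  then show ?thesis by (simp add: slack_def mult_ac)
qed

text \<open>Where \<open>\<bar>dev p\<bar>\<close> exceeds \<open>l\<close>, contracting pays at
  least \<open>sumN x t * (h p)\<^sup>2\<close> in the \<nu> direction. The \<mu>1 direction can
  take back at most \<open>2 * diam1 * \<bar>sumA x t\<bar>\<close>, which will be of smaller order
  than \<open>t\<close>.\<close>

lemma excess_bound:
  assumes a: "0 < a" "a < 1" and N: "0 < sumN x t"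
  shows "(\<integral>p. max 0 (\<bar>dev p\<bar> - \<bar>sumB x t\<bar> / sumN x t / (1 - a / 2)) \<partial>bel x t)\<^sup>2
    \<le> (2 * diam1 * \<bar>sumA x t\<bar> + slack a) / sumN x t"
proof -
  interpret prob_space "bel x t" by (rule prob_space_belief)
  define v where "v = \<bar>sumB x t\<bar> / sumN x t"
  \<comment> \<open>The larger root in \<open>\<bar>dev p\<bar>\<close> of \<open>(2 - a) *
    \<bar>dev p\<bar>\<^sup>2 - 2 * v * \<bar>dev p\<bar>\<close>, the worst case of the \<nu> part
    of the gain per continuing agent.\<close>
  define l where "l = v / (1 - a / 2)"
  define h where "h p = max 0 (\<bar>dev p\<bar> - l)" for p
  have v: "\<bar>sumB x t\<bar> = sumN x t * v" "0 \<le> v" using N by (auto simp: v_def)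
  have l: "(2 - a) * l = 2 * v" "0 \<le> l" using a v by (auto simp: l_def field_simps)
  have [measurable]: "h \<in> borel_measurable borel" unfolding h_def[abs_def] by measurable
  have h: "0 \<le> h p" "h p \<le> \<bar>dev p\<bar>" for p using l(2) by (auto simp: h_def)
  have hb: "\<bar>h p\<bar> \<le> diam" if "p \<in> R" for p using h[of p] R_bounds(2)[OF that] by linarith
  have hb2: "\<bar>(h p)\<^sup>2\<bar> \<le> diam\<^sup>2" if "p \<in> R" for p
    using h[of p] hb[OF that] by (auto intro: power_mono)
  have "(\<integral>p. sumN x t * (h p)\<^sup>2 \<partial>bel x t) \<le> 2 * diam1 * \<bar>sumA x t\<bar> + slack a"
  proof (rule expectation_le_of_gain[OF a, where B = "sumN x t * diam\<^sup>2"])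
    show "\<bar>sumN x t * (h p)\<^sup>2\<bar> \<le> sumN x t * diam\<^sup>2" if "p \<in> R" for p
      using hb2[OF that] N by (simp add: abs_mult)
    fix p assume p: "p \<in> R"
    define d where "d = fst p - p1"
    have pos: "0 \<le> a / (2 * \<sigma>\<^sup>2)" using a \<sigma> by simp
    have d: "\<bar>d\<bar> \<le> diam1" using R_bounds(1)[OF p] by (simp add: d_def)
    have "d * sumA x t \<le> diam1 * \<bar>sumA x t\<bar>"
      using mult_right_mono[OF d, of "\<bar>sumA x t\<bar>"] by (simp add: abs_mult[symmetric])
    moreover have "0 \<le> (2 - a) * (t * d\<^sup>2)" using a by simp
    ultimately have A: "- (2 * diam1 * \<bar>sumA x t\<bar>) \<le> (2 - a) * (t * d\<^sup>2) - 2 * d * sumA x t" by simp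
    show "a / (2 * \<sigma>\<^sup>2) * (sumN x t * (h p)\<^sup>2 - 2 * diam1 * \<bar>sumA x t\<bar>) \<le> max 0 (gain a x t p)"
    proof (cases "\<bar>dev p\<bar> \<le> l")
      case True
      then have "h p = 0" by (simp add: h_def)
      then have "sumN x t * (h p)\<^sup>2 - 2 * diam1 * \<bar>sumA x t\<bar> \<le> 0" using diam_nonneg by simp
      then have "a / (2 * \<sigma>\<^sup>2) * (sumN x t * (h p)\<^sup>2 - 2 * diam1 * \<bar>sumA x t\<bar>) \<le> 0"
        using pos by (intro mult_nonneg_nonpos)
      then show ?thesis by simp
    next
      case False
      then have hp: "h p = \<bar>dev p\<bar> - l" by (simp add: h_def)
      have "dev p * sumB x t \<le> \<bar>dev p\<bar> * (sumN x t * v)"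
        using abs_ge_self[of "dev p * sumB x t"] by (simp add: abs_mult v)
      then have "(2 - a) * (sumN x t * (dev p)\<^sup>2) - 2 * dev p * sumB x t
          \<ge> (2 - a) * (sumN x t * (dev p)\<^sup>2) - \<bar>dev p\<bar> * sumN x t * (2 * v)" by simp
      also have "(2 - a) * (sumN x t * (dev p)\<^sup>2) - \<bar>dev p\<bar> * sumN x t * (2 * v) =
          (2 - a) * (sumN x t * (\<bar>dev p\<bar> * h p))"
        unfolding l(1)[symmetric] hp by (simp add: algebra_simps power2_eq_square flip: abs_mult)
      finally have "(2 - a) * (sumN x t * (\<bar>dev p\<bar> * h p)) \<le> (2 - a) * (sumN x t * (dev p)\<^sup>2) - 2 * dev p * sumB x t" .
      \<comment> \<open>Uses \<open>2 - a \<ge> 1\<close> and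
        \<open>\<bar>dev p\<bar> \<ge> h p\<close>.\<close>
      moreover have "1 * (sumN x t * (h p * h p)) \<le> (2 - a) * (sumN x t * (\<bar>dev p\<bar> * h p))"
        using a N h[of p] by (intro mult_mono mult_left_mono mult_right_mono) auto
      ultimately have "sumN x t * (h p)\<^sup>2 - 2 * diam1 * \<bar>sumA x t\<bar> \<le>
        (2 - a) * (t * d\<^sup>2 + sumN x t * (dev p)\<^sup>2) - 2 * d * sumA x t - 2 * dev p * sumB x t"
        using A unfolding power2_eq_square[of "h p"] distrib_left by linarith
      from mult_left_mono[OF this pos] show ?thesis
        by (simp add: gain_def d_def)
    qed
  qed measurable
  then have "sumN x t * (\<integral>p. (h p)\<^sup>2 \<partial>bel x t) \<le> 2 * diam1 * \<bar>sumA x t\<bar> + slack a" by simp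
  then have "(\<integral>p. (h p)\<^sup>2 \<partial>bel x t) \<le> (2 * diam1 * \<bar>sumA x t\<bar> + slack a) / sumN x t"
    using N by (simp add: pos_le_divide_eq mult.commute)
  moreover have "(\<integral>p. h p \<partial>bel x t)\<^sup>2 \<le> (\<integral>p. (h p)\<^sup>2 \<partial>bel x t)"
  proof -
    \<comment> \<open>Nonnegativity of the variance turns the second moment into the square of the
      first, which is what the cutoff estimate consumes.\<close>
    have "0 \<le> variance h" by (intro Bochner_Integration.integral_nonneg) simp
    also have "variance h = (\<integral>p. (h p)\<^sup>2 \<partial>bel x t) - (\<integral>p. h p \<partial>bel x t)\<^sup>2"
      by (intro variance_eq integrable_belief[OF _ hb] integrable_belief[OF _ hb2]) measurable
    finally show ?thesis by simp
  qed
  ultimately show ?thesis by (simp add: h_def l_def v_def)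
qed

text \<open>Here the linear terms of the gain are bounded by the diameters of the rectangle. This is
  too crude to drive the contraction, but enough once both \<open>sumA\<close> and
  \<open>sumB\<close> are known to be of smaller order than \<open>t\<close>.\<close>

lemma second_moment_bound:
  assumes a: "0 < a" "a < 1"
  shows "(\<integral>p. t * (fst p - p1)\<^sup>2 + sumN x t * (dev p)\<^sup>2 \<partial>bel x t)
    \<le> 2 * diam1 * \<bar>sumA x t\<bar> + 2 * diam * \<bar>sumB x t\<bar> + slack a"
proof (rule expectation_le_of_gain[OF a, where B = "t * diam1\<^sup>2 + sumN x t * diam\<^sup>2"])
  have N: "0 \<le> sumN x t" unfolding sumN_def by (intro sum_nonneg) simp
  fix p assume p: "p \<in> R"
  note b = R_bounds[OF p]
  have "(fst p - p1)\<^sup>2 \<le> diam1\<^sup>2" "(dev p)\<^sup>2 \<le> diam\<^sup>2"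
    using b diam_nonneg by (auto simp: abs_le_square_iff[symmetric])
  then show "\<bar>t * (fst p - p1)\<^sup>2 + sumN x t * (dev p)\<^sup>2\<bar> \<le> t * diam1\<^sup>2 + sumN x t * diam\<^sup>2"
    using N by (simp add: add_mono mult_left_mono)
  define Q where "Q = t * (fst p - p1)\<^sup>2 + sumN x t * (dev p)\<^sup>2"
  have "0 \<le> Q" using N by (simp add: Q_def)
  then have "1 * Q \<le> (2 - a) * Q" using a by (intro mult_right_mono) auto
  moreover define d where "d = fst p - p1"
  have "d * sumA x t \<le> diam1 * \<bar>sumA x t\<bar>"
    using mult_right_mono[OF b(1), of "\<bar>sumA x t\<bar>"] by (simp add: d_def abs_mult[symmetric])
  moreover have "dev p * sumB x t \<le> diam * \<bar>sumB x t\<bar>"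
    using mult_right_mono[OF b(2), of "\<bar>sumB x t\<bar>"] by (simp add: abs_mult[symmetric])
  ultimately have "Q - (2 * diam1 * \<bar>sumA x t\<bar> + 2 * diam * \<bar>sumB x t\<bar>) \<le>
      (2 - a) * Q - 2 * d * sumA x t - 2 * dev p * sumB x t" by simp
  from mult_left_mono[OF this, of "a / (2 * \<sigma>\<^sup>2)"]
  show "a / (2 * \<sigma>\<^sup>2) * (t * (fst p - p1)\<^sup>2 + sumN x t * (dev p)\<^sup>2 - (2 * diam1 * \<bar>sumA x t\<bar> + 2 * diam * \<bar>sumB x t\<bar>))
    \<le> max 0 (gain a x t p)"
    using a by (simp add: gain_def Q_def d_def)
qed measurable

section \<open>Cutoffs as functions of the belief and of the draws\<close>

lemma thr_Suc: "thr x (Suc t) = opt_cutoff \<sigma> q \<kappa> \<gamma> (bel x t)"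
  by (simp add: cutoff_def)

text \<open>The level \<open>l\<close> stays free: \<open>diam\<close> makes the excess vanish, and
  a multiple of \<open>\<bar>sumB\<bar> / sumN\<close> makes it small.\<close>

lemma thr_dist:
  assumes "0 \<le> l"
  shows "(1 + \<gamma>) * \<bar>thr x (Suc t) - c\<bar> \<le> l + (\<integral>p. max 0 (\<bar>dev p\<bar> - l) \<partial>bel x t) / (1 - q)"
  unfolding thr_Suc dev_def
  by (rule opt_cutoff_bounds(2)[OF \<sigma> q \<gamma> prob_space_belief sets_belief _ indifferent assms, where U = diam])
     (use AE_bounds(2)[of x t] in \<open>simp add: dev_def\<close>)

text \<open>Confines all cutoffs to a fixed bounded interval whatever the draws, so the probability
  of continuing stays away from zero.\<close>

lemma thr_bounded: "(1 + \<gamma>) * \<bar>thr x (Suc t) - c\<bar> \<le> diam"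
proof -
  have "(\<integral>p. max 0 (\<bar>dev p\<bar> - diam) \<partial>bel x t) = (\<integral>p. 0 \<partial>bel x t)"
    using AE_bounds(2)[of x t] by (intro integral_cong_AE) (auto elim: eventually_mono)
  then show ?thesis using thr_dist[OF diam_nonneg(2), of x t] by simp
qed

text \<open>The positive normalizing constant drops out, leaving an integral against the fixed prior
  whose integrand alone depends on the draws.\<close>

lemma thr_le_iff:
  "thr x (Suc t) \<le> b \<longleftrightarrow> 0 \<le> (\<integral>p. lik x t p * gap q \<kappa> \<sigma> ((1 + \<gamma>) * b - (snd p + \<gamma> * fst p)) \<partial>M0)"
proof -
  note [measurable] = borel_measurable_gap[OF \<sigma> q, of \<kappa>]
  have [measurable]: "(snd :: real \<times> real \<Rightarrow> real) \<in> borel_measurable borel"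
    by (subst borel_prod[symmetric]) measurable
  have "thr x (Suc t) \<le> b \<longleftrightarrow> 0 \<le> (\<integral>p. gap q \<kappa> \<sigma> ((1 + \<gamma>) * b - (snd p + \<gamma> * fst p)) \<partial>bel x t)"
    unfolding thr_Suc
    by (rule opt_cutoff_bounds(1)[OF \<sigma> q \<gamma> prob_space_belief sets_belief _ indifferent, where U = diam])
       (use AE_bounds(2)[of x t] in \<open>simp add: dev_def\<close>)
  also have "\<dots> \<longleftrightarrow> 0 \<le> (\<integral>p. lik x t p * gap q \<kappa> \<sigma> ((1 + \<gamma>) * b - (snd p + \<gamma> * fst p)) \<partial>M0)"
    using norm_const_pos[of x t] by (subst integral_belief) (simp_all add: zero_le_divide_iff)
  finally show ?thesis .
qed

lemma belief_cong: "(\<And>s. 1 \<le> s \<Longrightarrow> s \<le> t \<Longrightarrow> x s = x' s) \<Longrightarrow> bel x t = bel x' t"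
  by (induction t) simp_all

lemma thr_cong: "(\<And>s. 1 \<le> s \<Longrightarrow> s < t \<Longrightarrow> x s = x' s) \<Longrightarrow> thr x t = thr x' t"
  unfolding cutoff_def by (subst belief_cong[of "t - 1" x x']) auto

text \<open>Strong induction is needed because the likelihood behind the cutoff of round
  \<open>t\<close> contains the cutoffs of all earlier rounds. Given these, the sublevel sets are
  described by a parametrized integral over \<open>M0\<close>.\<close>

lemma thr_measurable:
  assumes "\<And>s. 1 \<le> s \<Longrightarrow> s < t \<Longrightarrow> y s \<in> N \<rightarrow>\<^sub>M borel" "1 \<le> t"
  shows "(\<lambda>n. thr (\<lambda>s. y s n) t) \<in> borel_measurable N"
  using assms
proof (induction t rule: less_induct)
  case (less t)
  obtain u where u: "t = Suc u" using less.prems(2) by (cases t) auto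
  note [measurable] = borel_measurable_gap[OF \<sigma> q, of \<kappa>]
  have l1: "(\<lambda>z. lik1 (\<lambda>s. y s (fst z)) s (snd z)) \<in> borel_measurable (N \<Otimes>\<^sub>M ((borel :: real measure) \<Otimes>\<^sub>M (borel :: real measure)))"
    if s: "s \<in> {1..u}" for s
  proof -
    have [measurable]: "(\<lambda>n. thr (\<lambda>s. y s n) s) \<in> borel_measurable N"
      using s u less.prems by (intro less.IH) auto
    have [measurable]: "y s \<in> N \<rightarrow>\<^sub>M borel \<Otimes>\<^sub>M borel"
      using s u less.prems by (simp add: borel_prod)
    show ?thesis unfolding lik1_def normal_density_def by measurable
  qed
  have [measurable]: "(\<lambda>z. lik (\<lambda>s. y s (fst z)) u (snd z)) \<in> borel_measurable (N \<Otimes>\<^sub>M ((borel :: real measure) \<Otimes>\<^sub>M (borel :: real measure)))"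
    unfolding lik_def using l1 by (intro borel_measurable_prod) auto
  have "(\<lambda>n. \<integral>p. lik (\<lambda>s. y s n) u p * gap q \<kappa> \<sigma> ((1 + \<gamma>) * b - (snd p + \<gamma> * fst p)) \<partial>M0) \<in> borel_measurable N" for b
  proof (rule M0.borel_measurable_lebesgue_integral)
    have sets: "sets (N \<Otimes>\<^sub>M ((borel :: real measure) \<Otimes>\<^sub>M (borel :: real measure))) = sets (N \<Otimes>\<^sub>M M0)"
      by (intro sets_pair_measure_cong) (simp_all only: borel_prod sets_M0)
    have "(\<lambda>z. lik (\<lambda>s. y s (fst z)) u (snd z) * gap q \<kappa> \<sigma> ((1 + \<gamma>) * b - (snd (snd z) + \<gamma> * fst (snd z))))
      \<in> borel_measurable (N \<Otimes>\<^sub>M ((borel :: real measure) \<Otimes>\<^sub>M (borel :: real measure)))"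
      by measurable
    then show "(\<lambda>(n, p). lik (\<lambda>s. y s n) u p * gap q \<kappa> \<sigma> ((1 + \<gamma>) * b - (snd p + \<gamma> * fst p))) \<in> borel_measurable (N \<Otimes>\<^sub>M M0)"
      unfolding measurable_cong_sets[OF sets refl]
      by (simp add: case_prod_beta')
  qed
  then have "{n \<in> space N. thr (\<lambda>s. y s n) t \<le> b} \<in> sets N" for b
    unfolding u thr_le_iff by measurable
  then show ?case by (intro borel_measurableI_le) 
qed

end

section \<open>Convergence\<close>

context posterior begin

text \<open>A statement about one fixed sequence of draws. \<open>F\<close> will be the probability
  of continuing at a given cutoff and \<open>g\<close> the truncated mean of the residual; the bound
  on \<open>g\<close> carries the feedback factor \<open>k0\<close>.\<close>

lemma pathwise_convergence:
  assumes F: "0 < pF" "\<And>s. pF \<le> F (thr x s)" "\<And>s. F (thr x s) \<le> 1"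
    and k0: "0 < k0" "k0 < 1"
    and g: "\<And>s. \<bar>g (thr x s)\<bar> \<le> F (thr x s) * (k0 * ((1 + \<gamma>) * \<bar>thr x s - c\<bar>))"
    and A: "(\<lambda>t. sumA x t / t) \<longlonglongrightarrow> 0"
    and N: "(\<lambda>t. (sumN x t - (\<Sum>s=1..t. F (thr x s))) / t) \<longlonglongrightarrow> 0"
    and B: "(\<lambda>t. (sumB x t - (\<Sum>s=1..t. g (thr x s))) / t) \<longlonglongrightarrow> 0"
  shows "thr x \<longlonglongrightarrow> c"
    and "(\<lambda>t. \<integral>p. \<bar>fst p - p1\<bar> + \<bar>snd p - p2\<bar> \<partial>bel x t) \<longlonglongrightarrow> 0"
proof -
  \<comment> \<open>The contraction fraction is half the margin \<open>1 - k0\<close>, so that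
    \<open>m = (3 + k0) / 4\<close> still exceeds \<open>k0\<close>.\<close>
  define lam where "lam = (1 - k0) / 2"
  have lam: "0 < lam" "lam < 1" using k0 by (auto simp: lam_def)
  define m where "m = 1 - lam / 2"
  have m: "0 < m" "k0 / m < 1" using k0 by (auto simp: m_def lam_def field_simps)
  \<comment> \<open>While nobody has continued, the default values \<open>0\<close> for
    \<open>a\<close> and \<open>diam\<close> for \<open>e\<close> keep the estimate
    \<open>dist\<close> true, by the a priori bound on cutoffs.\<close>
  define a where "a t = (if 0 < sumN x t then \<bar>sumB x t\<bar> / sumN x t else 0)" for t
  define e where "e t = (if 0 < sumN x t then sqrt ((2 * diam1 * \<bar>sumA x t\<bar> + slack lam) / sumN x t) / (1 - q) else diam)" for t
  define d where "d s = k0 * ((1 + \<gamma>) * \<bar>thr x s - c\<bar>)" for s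
  have slack: "0 \<le> slack lam" using lam m0(1) mhi_pos by (simp add: slack_def)
  have N0: "0 \<le> sumN x t" for t unfolding sumN_def by (intro sum_nonneg) simp
  have a0: "0 \<le> a t" for t using N0[of t] by (simp add: a_def)
  \<comment> \<open>Holds for \<open>s = 0\<close> too: truncated subtraction gives
    \<open>thr x 0\<close> the value of \<open>thr x 1\<close>.\<close>
  have bdd: "(1 + \<gamma>) * \<bar>thr x s - c\<bar> \<le> diam" for s
    using thr_bounded[of x "s - 1"] by (simp add: cutoff_def)
  have dist: "(1 + \<gamma>) * \<bar>thr x (Suc t) - c\<bar> \<le> a t / m + e t" for t
  proof (cases "0 < sumN x t")
    case True
    let ?h = "\<integral>p. max 0 (\<bar>dev p\<bar> - a t / m) \<partial>bel x t"
    have "?h\<^sup>2 \<le> (2 * diam1 * \<bar>sumA x t\<bar> + slack lam) / sumN x t"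
      using excess_bound[OF lam True] True by (simp add: a_def m_def)
    then have "?h \<le> sqrt ((2 * diam1 * \<bar>sumA x t\<bar> + slack lam) / sumN x t)"
      by (rule real_le_rsqrt)
    then have "?h / (1 - q) \<le> e t" using q True by (simp add: e_def divide_right_mono)
    moreover have "0 \<le> a t / m" using a0 m by simp
    ultimately show ?thesis using thr_dist[of "a t / m" x t] by linarith
  next
    case False
    then show ?thesis using bdd[of "Suc t"] by (simp add: a_def e_def)
  qed
  \<comment> \<open>Continuations occur in a positive fraction of rounds, so division by
    \<open>sumN\<close> is as good as division by \<open>t\<close>.\<close>
  have N_lower: "\<forall>\<^sub>F t in sequentially. pF / 2 * t \<le> sumN x t"
  proof -
    have "\<forall>\<^sub>F t in sequentially. dist ((sumN x t - (\<Sum>s=1..t. F (thr x s))) / t) 0 < pF / 2"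
      by (rule tendstoD[OF N]) (use F(1) in simp)
    then show ?thesis using eventually_gt_at_top[of 0]
    proof eventually_elim
      case (elim t)
      have "pF * t \<le> (\<Sum>s=1..t. F (thr x s))"
        using sum_mono[of "{1..t}" "\<lambda>_. pF" "\<lambda>s. F (thr x s)"] F(2) by (simp add: mult.commute)
      moreover have "\<bar>sumN x t - (\<Sum>s=1..t. F (thr x s))\<bar> < pF / 2 * t"
        using elim by (simp add: dist_real_def abs_divide pos_divide_less_eq)
      ultimately show ?case unfolding abs_less_iff by linarith
    qed
  qed
  have inv: "(\<lambda>t. 1 / real t) \<longlonglongrightarrow> 0" by (rule lim_1_over_n)
  have absA: "(\<lambda>t. \<bar>sumA x t\<bar> / t) \<longlonglongrightarrow> 0"
    using tendsto_rabs[OF A] by (simp add: abs_divide)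
  have e: "e \<longlonglongrightarrow> 0"
  proof (rule Lim_null_comparison)
    show "(\<lambda>t. sqrt ((2 * diam1 * (\<bar>sumA x t\<bar> / t) + slack lam * (1 / t)) * (2 / pF)) / (1 - q)) \<longlonglongrightarrow> 0"
    proof -
      have "(\<lambda>t. sqrt ((2 * diam1 * (\<bar>sumA x t\<bar> / t) + slack lam * (1 / t)) * (2 / pF)) / (1 - q))
          \<longlonglongrightarrow> sqrt ((2 * diam1 * 0 + slack lam * 0) * (2 / pF)) / (1 - q)"
        using q by (intro tendsto_intros absA inv) auto
      then show ?thesis by simp
    qed
    show "\<forall>\<^sub>F t in sequentially. norm (e t) \<le> sqrt ((2 * diam1 * (\<bar>sumA x t\<bar> / t) + slack lam * (1 / t)) * (2 / pF)) / (1 - q)"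
      using N_lower eventually_gt_at_top[of 0]
    proof eventually_elim
      case (elim t)
      have pos: "0 < pF / 2 * t" using elim(2) F(1) by simp
      then have Np: "0 < sumN x t" using elim(1) by linarith
      have num: "0 \<le> 2 * diam1 * \<bar>sumA x t\<bar> + slack lam" using diam_nonneg slack by simp
      have "(2 * diam1 * \<bar>sumA x t\<bar> + slack lam) / sumN x t \<le> (2 * diam1 * \<bar>sumA x t\<bar> + slack lam) / (pF / 2 * t)"
        using elim(1) pos Np num by (intro divide_left_mono) auto
      also have "\<dots> = (2 * diam1 * (\<bar>sumA x t\<bar> / t) + slack lam * (1 / t)) * (2 / pF)"
        using elim(2) F(1) by (simp add: field_simps)
      finally have "sqrt ((2 * diam1 * \<bar>sumA x t\<bar> + slack lam) / sumN x t) \<le> sqrt ((2 * diam1 * (\<bar>sumA x t\<bar> / t) + slack lam * (1 / t)) * (2 / pF))"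
        by simp
      from divide_right_mono[OF this, of "1 - q"]
      have "e t \<le> sqrt ((2 * diam1 * (\<bar>sumA x t\<bar> / t) + slack lam * (1 / t)) * (2 / pF)) / (1 - q)"
        using Np q unfolding e_def by (simp only: if_True)
      moreover have "0 \<le> e t" using num Np q by (simp add: e_def)
      ultimately show ?case by (simp only: real_norm_def abs_of_nonneg)
    qed
  qed
  have a_lim: "a \<longlonglongrightarrow> 0"
  proof (rule weighted_average_contraction[where p = pF and w = "\<lambda>s. F (thr x s)" and k = "k0 / m" and d = d and U = diam
        and e = "\<lambda>s. k0 * e (s - 1)" and N = "sumN x" and B = "\<lambda>t. \<bar>sumB x t\<bar>"
        and eB = "\<lambda>t. \<bar>sumB x t - (\<Sum>s=1..t. g (thr x s))\<bar>"])
    show "0 \<le> k0 / m" using k0 m by simp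
    show "d s \<le> diam" for s
    proof -
      have "d s \<le> 1 * ((1 + \<gamma>) * \<bar>thr x s - c\<bar>)" unfolding d_def using k0 \<gamma> by (intro mult_right_mono) auto
      then show ?thesis using bdd[of s] by simp
    qed
    show "d s \<le> k0 / m * a (s - 1) + k0 * e (s - 1)" if "1 \<le> s" for s
      using mult_left_mono[OF dist[of "s - 1"], of k0] that k0 by (simp add: d_def distrib_left)
    show "(\<lambda>s. k0 * e (s - 1)) \<longlonglongrightarrow> 0"
      using tendsto_mult_right_zero[OF filterlim_compose[OF e filterlim_minus_const_nat_at_top]] .
    show "(\<lambda>t. \<bar>sumB x t - (\<Sum>s=1..t. g (thr x s))\<bar> / t) \<longlonglongrightarrow> 0"
      using tendsto_rabs[OF B] by (simp add: abs_divide)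
    show "\<bar>sumB x t\<bar> \<le> (\<Sum>s=1..t. F (thr x s) * d s) + \<bar>sumB x t - (\<Sum>s=1..t. g (thr x s))\<bar>" for t
    proof -
      have "\<bar>\<Sum>s=1..t. g (thr x s)\<bar> \<le> (\<Sum>s=1..t. F (thr x s) * d s)"
        by (rule order_trans[OF sum_abs]) (intro sum_mono, simp add: d_def g)
      then show ?thesis by linarith
    qed
    show "a t * sumN x t \<le> \<bar>sumB x t\<bar>" for t using N0[of t] by (simp add: a_def)
  qed (use F m N a0 in auto)
  have upper: "(\<lambda>t. (a t / m + e t) / (1 + \<gamma>)) \<longlonglongrightarrow> 0"
  proof -
    have "(\<lambda>t. (a t / m + e t) / (1 + \<gamma>)) \<longlonglongrightarrow> (0 / m + 0) / (1 + \<gamma>)"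
      using m \<gamma> by (intro tendsto_intros a_lim e) auto
    then show ?thesis by simp
  qed
  have "(\<lambda>t. thr x (Suc t) - c) \<longlonglongrightarrow> 0"
  proof (rule Lim_null_comparison[OF always_eventually upper], rule allI)
    fix t show "norm (thr x (Suc t) - c) \<le> (a t / m + e t) / (1 + \<gamma>)"
      using dist[of t] \<gamma> by (simp add: pos_le_divide_eq mult.commute)
  qed
  then have "(\<lambda>t. thr x (Suc t)) \<longlonglongrightarrow> c" by (simp add: LIM_zero_iff)
  then show "thr x \<longlonglongrightarrow> c" by (rule LIMSEQ_imp_Suc)
  \<comment> \<open>With \<open>a\<close> known to vanish, the crude second-moment bound becomes
    effective and also controls the \<mu>1 direction, about which the cutoffs say nothing.\<close>
  define V1 where "V1 t = (\<integral>p. (fst p - p1)\<^sup>2 \<partial>bel x t)" for t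
  define V where "V t = (\<integral>p. (dev p)\<^sup>2 \<partial>bel x t)" for t
  have V0: "0 \<le> V1 t" "0 \<le> V t" for t by (simp_all add: V1_def V_def)
  have i1: "integrable (bel x t) (\<lambda>p. (fst p - p1)\<^sup>2)" "integrable (bel x t) (\<lambda>p. \<bar>fst p - p1\<bar>)" for t
  proof -
    show "integrable (bel x t) (\<lambda>p. (fst p - p1)\<^sup>2)"
      by (rule integrable_belief[where B = "diam1\<^sup>2"])
         (use R_bounds(1) diam_nonneg in \<open>auto simp: abs_le_square_iff[symmetric]\<close>)
    show "integrable (bel x t) (\<lambda>p. \<bar>fst p - p1\<bar>)"
      by (rule integrable_belief[where B = "diam1"]) (use R_bounds(1) in auto)
  qed
  have i2: "integrable (bel x t) (\<lambda>p. (dev p)\<^sup>2)" "integrable (bel x t) (\<lambda>p. \<bar>dev p\<bar>)" for t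
  proof -
    show "integrable (bel x t) (\<lambda>p. (dev p)\<^sup>2)"
      by (rule integrable_belief[where B = "diam\<^sup>2"])
         (use R_bounds(2) diam_nonneg in \<open>auto simp: abs_le_square_iff[symmetric]\<close>)
    show "integrable (bel x t) (\<lambda>p. \<bar>dev p\<bar>)"
      by (rule integrable_belief[where B = "diam"]) (use R_bounds(2) in auto)
  qed
  define rhs where "rhs t = 2 * diam1 * (\<bar>sumA x t\<bar> / t) + 2 * diam * a t + slack lam * (1 / t)" for t
  have rhs: "rhs \<longlonglongrightarrow> 0"
  proof -
    have "rhs \<longlonglongrightarrow> 2 * diam1 * 0 + 2 * diam * 0 + slack lam * 0"
      unfolding rhs_def by (intro tendsto_intros absA a_lim inv)
    then show ?thesis by simp
  qed
  have ev: "\<forall>\<^sub>F t in sequentially. V1 t + pF / 2 * V t \<le> rhs t"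
    using N_lower eventually_gt_at_top[of 0]
  proof eventually_elim
    case (elim t)
    have "0 < pF / 2 * t" using elim(2) F(1) by simp
    then have Np: "0 < sumN x t" using elim(1) by linarith
    have "sumN x t \<le> (\<Sum>s=1..t. 1)" unfolding sumN_def by (intro sum_mono) simp
    then have Nt: "sumN x t \<le> t" by simp
    have "\<bar>sumB x t\<bar> = a t * sumN x t" using Np by (simp add: a_def)
    also have "\<dots> \<le> a t * t" using Nt a0 by (intro mult_left_mono)
    finally have Bt: "\<bar>sumB x t\<bar> \<le> a t * t" .
    have "t * V1 t + sumN x t * V t = (\<integral>p. t * (fst p - p1)\<^sup>2 + sumN x t * (dev p)\<^sup>2 \<partial>bel x t)"
      using i1 i2 by (simp add: V1_def V_def)
    also have "\<dots> \<le> 2 * diam1 * \<bar>sumA x t\<bar> + 2 * diam * \<bar>sumB x t\<bar> + slack lam"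
      by (rule second_moment_bound[OF lam])
    also have "2 * diam * \<bar>sumB x t\<bar> \<le> 2 * diam * (a t * t)"
      using Bt diam_nonneg by (intro mult_left_mono) auto
    finally have "t * V1 t + sumN x t * V t \<le> 2 * diam1 * \<bar>sumA x t\<bar> + 2 * diam * (a t * t) + slack lam" by simp
    moreover have "pF / 2 * t * V t \<le> sumN x t * V t" using elim(1) V0 by (intro mult_right_mono)
    ultimately have "t * (V1 t + pF / 2 * V t) \<le> t * rhs t"
      using elim(2) by (simp add: rhs_def algebra_simps)
    then show ?case using elim(2) by simp
  qed
  have V1: "V1 \<longlonglongrightarrow> 0"
  proof (rule Lim_null_comparison[OF _ rhs])
    show "\<forall>\<^sub>F t in sequentially. norm (V1 t) \<le> rhs t"
      using ev
    proof eventually_elim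
      case (elim t)
      have "0 \<le> pF / 2 * V t" using F(1) V0 by simp
      then show ?case using elim V0(1)[of t] by simp
    qed
  qed
  have V: "V \<longlonglongrightarrow> 0"
  proof (rule Lim_null_comparison)
    show "\<forall>\<^sub>F t in sequentially. norm (V t) \<le> rhs t * (2 / pF)"
      using ev
    proof eventually_elim
      case (elim t)
      have "pF / 2 * V t \<le> rhs t" using elim V0(1)[of t] by simp
      then show ?case using F(1) V0(2)[of t] by (simp add: field_simps)
    qed
    show "(\<lambda>t. rhs t * (2 / pF)) \<longlonglongrightarrow> 0" using tendsto_mult_left_zero[OF rhs] .
  qed
  have l2: "(\<integral>p. \<bar>f p\<bar> \<partial>bel x t) \<le> sqrt (\<integral>p. (f p)\<^sup>2 \<partial>bel x t)"
    if "integrable (bel x t) (\<lambda>p. \<bar>f p\<bar>)" "integrable (bel x t) (\<lambda>p. (f p)\<^sup>2)" for f :: "real \<times> real \<Rightarrow> real" and t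
  proof -
    interpret prob_space "bel x t" by (rule prob_space_belief)
    have "0 \<le> variance (\<lambda>p. \<bar>f p\<bar>)" by (intro Bochner_Integration.integral_nonneg) simp
    also have "\<dots> = (\<integral>p. (f p)\<^sup>2 \<partial>bel x t) - (\<integral>p. \<bar>f p\<bar> \<partial>bel x t)\<^sup>2"
      using that by (subst variance_eq) auto
    finally show ?thesis by (intro real_le_rsqrt) simp
  qed
  show "(\<lambda>t. \<integral>p. \<bar>fst p - p1\<bar> + \<bar>snd p - p2\<bar> \<partial>bel x t) \<longlonglongrightarrow> 0"
  proof (rule Lim_null_comparison[OF always_eventually], rule allI)
    show "(\<lambda>t. (1 + \<bar>\<gamma>\<bar>) * sqrt (V1 t) + sqrt (V t)) \<longlonglongrightarrow> 0"
    proof -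
      have "(\<lambda>t. (1 + \<bar>\<gamma>\<bar>) * sqrt (V1 t) + sqrt (V t)) \<longlonglongrightarrow> (1 + \<bar>\<gamma>\<bar>) * sqrt 0 + sqrt 0"
        by (intro tendsto_intros V1 V)
      then show ?thesis by simp
    qed
    fix t
    have "(\<integral>p. \<bar>fst p - p1\<bar> + \<bar>snd p - p2\<bar> \<partial>bel x t) \<le> (\<integral>p. (1 + \<bar>\<gamma>\<bar>) * \<bar>fst p - p1\<bar> + \<bar>dev p\<bar> \<partial>bel x t)"
    proof (rule integral_mono')
      show "integrable (bel x t) (\<lambda>p. (1 + \<bar>\<gamma>\<bar>) * \<bar>fst p - p1\<bar> + \<bar>dev p\<bar>)" using i1 i2 by simp
      fix p :: "real \<times> real"
      \<comment> \<open>Return from the coordinate \<nu> to \<open>\<mu>2\<close>; the shear costs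
        the extra multiple \<open>\<bar>\<gamma>\<bar>\<close> of the error in
        \<open>\<mu>1\<close>.\<close>
      have "snd p - p2 = dev p - \<gamma> * (fst p - p1)" by (simp add: dev_def algebra_simps)
      then have "\<bar>snd p - p2\<bar> \<le> \<bar>dev p\<bar> + \<bar>\<gamma>\<bar> * \<bar>fst p - p1\<bar>"
        by (simp add: abs_mult[symmetric])
      then show "\<bar>fst p - p1\<bar> + \<bar>snd p - p2\<bar> \<le> (1 + \<bar>\<gamma>\<bar>) * \<bar>fst p - p1\<bar> + \<bar>dev p\<bar>"
        by (simp add: distrib_right)
    qed simp
    also have "\<dots> = (1 + \<bar>\<gamma>\<bar>) * (\<integral>p. \<bar>fst p - p1\<bar> \<partial>bel x t) + (\<integral>p. \<bar>dev p\<bar> \<partial>bel x t)"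
      using i1 i2 by simp
    also have "\<dots> \<le> (1 + \<bar>\<gamma>\<bar>) * sqrt (V1 t) + sqrt (V t)"
      unfolding V1_def V_def using i1 i2 by (intro add_mono mult_left_mono l2) auto
    finally show "norm (\<integral>p. \<bar>fst p - p1\<bar> + \<bar>snd p - p2\<bar> \<partial>bel x t) \<le> (1 + \<bar>\<gamma>\<bar>) * sqrt (V1 t) + sqrt (V t)"
      by (subst real_norm_def, subst abs_of_nonneg) (auto intro!: Bochner_Integration.integral_nonneg)
  qed
qed

end

lemma C1_on_continuous: "C1_on A f \<Longrightarrow> continuous_on A f"
  unfolding C1_on_def continuous_on_eq_continuous_within
  by (blast intro: has_derivative_continuous)

text \<open>Writes the probability of continuing as a truncated integral, so that the count
  \<open>sumN\<close> becomes the case \<open>v = 1\<close> of the truncated law.\<close>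

lemma integral_Psi_indicator_fst:
  assumes "0 < \<sigma>" "A \<in> sets borel"
  shows "(\<integral>p. indicator A (fst p) \<partial>Psi \<sigma> \<mu> \<nu> r) = measure (gauss \<mu> \<sigma>) A"
proof -
  interpret T: prob_space "Psi \<sigma> \<mu> \<nu> r" by (rule prob_space_Psi[OF assms(1)])
  interpret Z: prob_space "gauss 0 \<sigma>" using assms(1) by (rule prob_space_normal_density)
  have "integrable (Psi \<sigma> \<mu> \<nu> r) (indicator (A \<times> UNIV) :: real \<times> real \<Rightarrow> real)"
    using assms(2) by (intro integrable_real_indicator) (simp_all add: T.emeasure_eq_measure borel_prod[symmetric] del: borel_prod)
  also have "indicator (A \<times> UNIV) = (\<lambda>p. indicat_real A (fst p))" by (auto simp: indicator_def)
  finally have "(\<integral>p. indicator A (fst p) \<partial>Psi \<sigma> \<mu> \<nu> r) = (\<integral>x. \<integral>z. indicat_real A x \<partial>gauss 0 \<sigma> \<partial>gauss \<mu> \<sigma>)"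
    using integral_Psi[OF assms(1), of \<mu> \<nu> r "\<lambda>p. indicator A (fst p)"] by simp
  also have "\<dots> = (\<integral>x. indicat_real A x \<partial>gauss \<mu> \<sigma>)" using Z.prob_space by simp
  also have "\<dots> = measure (gauss \<mu> \<sigma>) A" by (subst Bochner_Integration.integral_indicator) simp
  finally show ?thesis .
qed

theorem proposition7:
  fixes \<sigma> q \<kappa> \<mu>1b \<mu>2b r \<gamma> \<mu>2inf cinf l1 h1 l2 h2 :: real
    and m0 :: "real \<times> real \<Rightarrow> real"
    and M0 :: "(real \<times> real) measure"
    and P :: "'w measure"
    and X :: "nat \<Rightarrow> 'w \<Rightarrow> real \<times> real"
  assumes "\<sigma> > 0" and "0 \<le> q" and "q < 1" and "r \<noteq> -1"
    and "\<bar>(r - \<gamma>) / (1 + \<gamma>)\<bar> < 1" and "r \<noteq> \<gamma>" and "\<gamma> > -1"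
    and "steady_state \<sigma> q \<kappa> (Psi \<sigma> \<mu>1b \<mu>2b r) \<gamma> \<mu>1b \<mu>2inf cinf"
    and "l1 < \<mu>1b" and "\<mu>1b < h1" and "l2 < \<mu>2inf" and "\<mu>2inf < h2"
    and "C1_on ({l1..h1} \<times> {l2..h2}) m0"
    and "\<forall>p \<in> {l1..h1} \<times> {l2..h2}. 0 < m0 p"
    and "M0 = density lborel (\<lambda>p. ennreal (indicator ({l1..h1} \<times> {l2..h2}) p * m0 p))"
    and "prob_space M0"
    and "prob_space P"
    and "prob_space.indep_vars P (\<lambda>_. borel) X {1..}"
    and "\<forall>t\<ge>1. distr P borel (X t) = Psi \<sigma> \<mu>1b \<mu>2b r"
  shows "AE \<omega> in P.
    ((\<lambda>t. cutoff \<sigma> q \<kappa> \<gamma> M0 (\<lambda>s. X s \<omega>) t) \<longlonglongrightarrow> cinf) \<and>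
    ((\<lambda>t. \<integral>(\<mu>1, \<mu>2). \<bar>\<mu>1 - \<mu>1b\<bar> + \<bar>\<mu>2 - \<mu>2inf\<bar>
            \<partial>belief \<sigma> q \<kappa> \<gamma> M0 (\<lambda>s. X s \<omega>) t) \<longlonglongrightarrow> 0)"
proof -
  define T where "T = Psi \<sigma> \<mu>1b \<mu>2b r"
  define k where "k = \<mu>2inf + \<gamma> * \<mu>1b"
  define v where "v y = snd y + \<gamma> * fst y - k" for y :: "real \<times> real"
  define F where "F a = measure (gauss \<mu>1b \<sigma>) {..a}" for a
  define g where "g a = (\<integral>y. indicator {..a} (fst y) * v y \<partial>T)" for a
  interpret P: prob_space P by fact
  interpret X1: prob_space "gauss \<mu>1b \<sigma>" using assms(1) by (rule prob_space_normal_density)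
  interpret T: prob_space T unfolding T_def using assms(1) by (rule prob_space_Psi)
  have opt: "optimal_strategy q \<kappa> (Psi \<sigma> \<mu>1b \<mu>2inf \<gamma>) (\<lambda>x. cinf \<le> x)"
    and KL: "\<And>m. history_KL T (Psi \<sigma> \<mu>1b \<mu>2inf \<gamma>) (\<lambda>x. cinf \<le> x) \<le> history_KL T (Psi \<sigma> \<mu>1b m \<gamma>) (\<lambda>x. cinf \<le> x)"
    using assms(8) by (auto simp: steady_state_def T_def)
  have indiff: "gap q \<kappa> \<sigma> ((1 + \<gamma>) * cinf - (\<mu>2inf + \<gamma> * \<mu>1b)) = 0"
    by (rule optimal_threshold_indifference[OF assms(1-3,7) opt])
  have "g cinf = 0"
    using KL_minimal_moment[OF assms(1) KL[unfolded T_def]] by (simp add: g_def v_def k_def T_def)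
  then have g_le: "\<bar>g a\<bar> \<le> \<bar>r - \<gamma>\<bar> * \<bar>a - cinf\<bar> * F a" for a
    using continuation_moment_lipschitz[OF assms(1,6), where b = cinf and k = k and \<mu> = \<mu>1b and \<nu> = \<mu>2b and c = a]
    by (simp add: g_def v_def F_def T_def)
  define R where "R = {l1..h1} \<times> {l2..h2}"
  have cont: "continuous_on R m0" using assms(13) unfolding R_def by (rule C1_on_continuous)
  have R: "compact R" "(\<mu>1b, \<mu>2inf) \<in> R" using assms(9-12) by (auto simp: R_def intro: compact_Times)
  then have ne: "R \<noteq> {}" by blast
  obtain plo where plo: "plo \<in> R" "\<And>p. p \<in> R \<Longrightarrow> m0 plo \<le> m0 p"
    using continuous_attains_inf[OF R(1) ne cont] by blast
  obtain phi where phi: "\<And>p. p \<in> R \<Longrightarrow> m0 p \<le> m0 phi"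
    using continuous_attains_sup[OF R(1) ne cont] by blast
  \<comment> \<open>Values of \<open>m0\<close> outside \<open>R\<close> are arbitrary; only the
    extension by zero is measurable, by continuity on a compact set.\<close>
  have m0_meas: "(\<lambda>p. indicator R p *\<^sub>R m0 p) \<in> borel_measurable borel"
    using R(1) cont by (intro borel_measurable_continuous_on_indicator borel_compact)
  interpret posterior \<sigma> q \<kappa> \<gamma> l1 h1 l2 h2 \<mu>1b \<mu>2inf cinf "m0 plo" "m0 phi" m0 M0
  proof (rule posterior.intro)
    show "0 < \<sigma>" "0 \<le> q" "q < 1" "- 1 < \<gamma>" "prob_space M0" by fact+
    show "l1 \<le> \<mu>1b" "\<mu>1b \<le> h1" "l2 \<le> \<mu>2inf" "\<mu>2inf \<le> h2" using assms(9-12) by simp_all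
    show "gap q \<kappa> \<sigma> ((1 + \<gamma>) * cinf - (\<mu>2inf + \<gamma> * \<mu>1b)) = 0" by (rule indiff)
    show "0 < m0 plo" using assms(14) plo(1) by (simp only: R_def)
    show "m0 plo \<le> m0 p" "m0 p \<le> m0 phi" if "p \<in> {l1..h1} \<times> {l2..h2}" for p
      using plo(2) phi that by (simp_all only: R_def)
    show "(\<lambda>p. indicator ({l1..h1} \<times> {l2..h2}) p * m0 p) \<in> borel_measurable borel"
      using m0_meas by (simp only: R_def real_scaleR_def)
    show "M0 = density lborel (\<lambda>p. ennreal (indicator ({l1..h1} \<times> {l2..h2}) p * m0 p))" by fact
  qed
  have X: "P.indep_vars (\<lambda>_. borel) X {1..}" and law: "\<And>t. 1 \<le> t \<Longrightarrow> distr P borel (X t) = T"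
    using assms(18,19) by (simp_all add: T_def)
  have cong: "thr x t = thr x' t" if "\<And>s. 1 \<le> s \<Longrightarrow> s < t \<Longrightarrow> x s = x' s" for x x' t
    using that by (rule thr_cong)
  have meas: "(\<lambda>x. thr x t) \<in> borel_measurable (PiM {1..<t} (\<lambda>_. borel))" if "1 \<le> t" for t
    using thr_measurable[of t "\<lambda>s x. x s" "PiM {1..<t} (\<lambda>_. borel)"] that
    by (auto intro: measurable_component_singleton)
  have [measurable]: "(snd :: real \<times> real \<Rightarrow> real) \<in> borel_measurable borel"
    by (subst borel_prod[symmetric]) measurable
  have v: "v \<in> borel_measurable borel" unfolding v_def[abs_def] by measurable
  have v2: "integrable T (\<lambda>y. (v y)\<^sup>2)"
    using integrable_Psi_square[OF assms(1), of \<mu>1b \<mu>2b r "- k" \<gamma> 1]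
    by (simp add: T_def v_def case_prod_beta' algebra_simps)
  have F_eq: "F a = (\<integral>y. indicator {..a} (fst y) * 1 \<partial>T)" for a
    using integral_Psi_indicator_fst[OF assms(1), of "{..a}"] by (simp add: F_def T_def)
  have lawA: "AE \<omega> in P. (\<lambda>t. sumA (\<lambda>s. X s \<omega>) t / t) \<longlonglongrightarrow> 0"
  proof -
    have sq: "integrable T (\<lambda>y. (\<bar>fst y - \<mu>1b\<bar>)\<^sup>2)"
      using integrable_Psi_square[OF assms(1), of \<mu>1b \<mu>2b r "- \<mu>1b" 1 0]
      by (simp add: T_def case_prod_beta' algebra_simps)
    have "integrable T (\<lambda>y. fst y - \<mu>1b)"
      using integrable_Psi_affine[OF assms(1), of \<mu>1b \<mu>2b r "- \<mu>1b" 1 0]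
      by (simp add: T_def case_prod_beta')
    from integral_Psi[OF assms(1) this[unfolded T_def]]
    have mean: "(\<integral>y. fst y - \<mu>1b \<partial>T) = 0"
      using integrable_gauss_id[OF assms(1), of \<mu>1b] integral_gauss_id[OF assms(1), of \<mu>1b]
        X1.prob_space prob_space.prob_space[OF prob_space_normal_density[OF assms(1), of 0]]
      by (simp add: T_def)
    \<comment> \<open>First draws are always observed, so the constant cutoff \<open>0\<close> is a
      dummy and the adapted law reduces to the ordinary one.\<close>
    have "AE \<omega> in P. (\<lambda>t. (\<Sum>s=1..t. (\<lambda>(c::real) y. fst y - \<mu>1b) 0 (X s \<omega>)) / t) \<longlonglongrightarrow> 0"
      by (rule P.adapted_strong_law[OF X law _ _ _ _ _ sq, where C = "\<lambda>_ _. 0"]) (simp_all add: mean)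
    then show ?thesis by (simp add: sumA_def)
  qed
  have lawN: "AE \<omega> in P. (\<lambda>t. (sumN (\<lambda>s. X s \<omega>) t - (\<Sum>s=1..t. F (thr (\<lambda>s. X s \<omega>) s))) / t) \<longlonglongrightarrow> 0"
    using P.truncated_strong_law[OF X law cong meas, of "\<lambda>_. 1"] unfolding F_eq sumN_def by simp
  have lawB: "AE \<omega> in P. (\<lambda>t. (sumB (\<lambda>s. X s \<omega>) t - (\<Sum>s=1..t. g (thr (\<lambda>s. X s \<omega>) s))) / t) \<longlonglongrightarrow> 0"
    using P.truncated_strong_law[OF X law cong meas v v2] unfolding g_def sumB_def v_def k_def by simp
  \<comment> \<open>Product of two sensitivities: the truncated mean of the residual moves at rate
    at most \<open>\<bar>r - \<gamma>\<bar>\<close> in the cutoff, and the cutoff at rate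
    \<open>1 / (1 + \<gamma>)\<close> in \<nu>.\<close>
  define k0 where "k0 = \<bar>r - \<gamma>\<bar> / (1 + \<gamma>)"
  have k0: "0 < k0" "k0 < 1" using assms(5-7) by (auto simp: k0_def abs_divide)
  \<comment> \<open>No cutoff falls below \<open>cinf - diam / (1 + \<gamma>)\<close>, by
    \<open>thr_bounded\<close>, so the probability of continuing there is a uniform lower
    bound.\<close>
  define pF where "pF = F (cinf - diam / (1 + \<gamma>))"
  have pF: "0 < pF" unfolding pF_def F_def by (rule measure_gauss_atMost_pos[OF assms(1)])
  have F_lo: "pF \<le> F (thr x s)" for x s
  proof -
    have "(1 + \<gamma>) * (cinf - thr x s) \<le> (1 + \<gamma>) * \<bar>thr x s - cinf\<bar>"
      using assms(7) by (intro mult_left_mono) auto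
    also have "\<dots> \<le> diam" using thr_bounded[of x "s - 1"] by (simp add: cutoff_def)
    finally have "cinf - thr x s \<le> diam / (1 + \<gamma>)" using assms(7) by (simp add: pos_le_divide_eq mult.commute)
    then show ?thesis unfolding pF_def F_def by (intro X1.finite_measure_mono) auto
  qed
  have F_hi: "F a \<le> 1" for a by (simp add: F_def)
  have g_thr: "\<bar>g a\<bar> \<le> F a * (k0 * ((1 + \<gamma>) * \<bar>a - cinf\<bar>))" for a
    using g_le[of a] assms(7) by (simp add: k0_def mult_ac)
  show ?thesis
    using lawA lawN lawB
  proof eventually_elim
    case (elim \<omega>)
    note path = pathwise_convergence[OF pF F_lo F_hi k0 g_thr elim]
    show ?case using path by (simp add: case_prod_beta')
  qed
qed

end
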